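(* For every $n$ there exists a sufficiently small constant $\epsilon_2>0$, depending only on $n$, such that the following holds. Let $\Omega\subset\mathbb{R}^n$ be a bounded, strictly convex domain with smooth boundary, and suppose there is a constant $k_0>0$ such that the curvature matrix $\{k_{ij}\}_{i,j=1}^{n-1}$ of $\partial\Omega$ satisfies $\{k_{ij}\}\ge k_0\{\delta_{ij}\}$ at every point of $\partial\Omega$. Let $N$ be the inward unit normal to $\partial\Omega$. Let $F$ be an admissible anisotropy on $\mathbb{R}^{n+1}$ with structure constants $c_1,c_2$ (as defined in the context) satisfying $$\frac{c_2}{c_1}<\epsilon_2 .$$ Let $\varphi\in C^3(\overline\Omega)$ and suppose there is a positive constant $\epsilon_1$ with $\|\varphi\|_{C^0(\overline\Omega)},\ \|D\varphi\|_{C^0(\overline\Omega)},\ \|D^2\varphi\|_{C^0(\overline\Omega)}<\epsilon_1$. Let $u_0\in C^3(\overline\Omega)$ satisfy $D_Nu_0=\varphi$ on $\partial\Omega$. Then there exists a constant $C$, independent of time (that is, independent of $T$), such that for every $T>0$ any solution $u\in C^{3,2}(\overline{Q_T})$ of $$\begin{cases} u_t=\sqrt{1+|Du|^2}\;D^2_{p_ip_j}F(Du,-1)\,u_{x_ix_j} & \text{in } Q_T=\Omega\times[0,T],\\ D_Nu=\varphi & \text{on } \Gamma_T=\partial\Omega\times[0,T],\\ u(\cdot,0)=u_0 & \text{in }\Omega\end{cases}$$ satisfies $$\sup_{\overline{Q_T}}|Du|\le C .$$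
   Context: Summation over repeated indices $1\le i,j\le n$ is understood; $Du$ is the spatial gradient and $D_N u$ the derivative in the direction $N$. $D^2_{p_ip_j}F$ ($1\le i,j\le n$) denotes second partial derivatives of $F$ with respect to its first $n$ variables. The curvature matrix of $\partial\Omega$ is the matrix of the differential of the normal map, with the sign making it positive for strictly convex domains. $C^{3,2}(\overline{Q_T})$ denotes functions of class $C^3$ in $x$ and $C^2$ in $t$ up to the boundary. Admissible anisotropy. $F:\mathbb{R}^{n+1}\to\mathbb{R}$ is smooth on $\mathbb{R}^{n+1}\setminus\{0\}$, positive there, convex, homogeneous of degree one ($F(\lambda p)=\lambda F(p)$ for all $\lambda\ge 0$), and symmetric in the last variable: $F(p',-1)=F(p',1)$ for all $p'\in\mathbb{R}^n$. Structure constants. For $p'\in\mathbb{R}^n\setminus\{0\}$ put $p=(p',-1)$, and let $\phi^1,\dots,\phi^n$ be any orthonormal basis of $\mathbb{R}^n$ with $\phi^n=p'/|p'|$; vectors of $\mathbb{R}^n$ are identified with vectors $(\cdot,0)\in\mathbb{R}^{n+1}$. Set $\tau^{\alpha\beta}=|p|\,D^2F|_{(p',-1)}(\phi^\alpha,\phi^\beta)$ for $1\le\alpha,\beta\le n$, and define the tensor on $\mathbb{R}^n$ $$T^3_{ijl}=-\frac{\partial}{\partial p_l}\big(|p|\,D^2_{p_ip_j}F\big)\Big|_{(p',-1)},\qquad T^3(a,b,c)=T^3_{ijl}a_ib_jc_l,\qquad 1\le i,j,l\le n .$$ Structure constants are positive constants $c_1,c_2,c_3$ such that, for all $1\le\alpha,\beta\le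 n-1$ with $\alpha\ne\beta$ and for all $p'\neq 0$ and all such bases, $$c_1\le\tau^{\alpha\alpha}\le c_3,\quad \frac{c_1}{|p|^2}\le\tau^{nn}\le\frac{c_3}{|p|^2},\quad |\tau^{\alpha\beta}|\le c_2,\quad |\tau^{\alpha n}|\le\frac{c_2}{|p|^2},$$ and such that $c_1\le C_5$ and $C_4\le c_2$, where $C_4,C_5,C_6$ are positive constants depending only on $F$ for which, for all $|p'|>1$, all such bases and all $1\le\alpha,\beta\le n-1$, $$|T^3(\phi^\alpha,\phi^\alpha,\phi^\beta)|\le\frac{C_4}{|p|},\qquad |T^3(\phi^\alpha,\phi^n,\phi^\beta)|\le\frac{C_4}{|p|}\ (\alpha\ne\beta),$$ $$|T^3(\phi^\alpha,\phi^\alpha,\phi^n)|,\ |T^3(\phi^\alpha,\phi^n,\phi^n)|,\ |T^3(\phi^n,\phi^n,\phi^\alpha)|\le\frac{C_4}{|p|^3},$$ $$\frac{C_5}{|p|}\le T^3(\phi^\alpha,\phi^n,\phi^\alpha)\le\frac{C_6}{|p|},\qquad \frac{C_5}{|p|^3}\le T^3(\phi^n,\phi^n,\phi^n)\le\frac{C_6}{|p|^3}.$$ *)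

theory Defs
  imports "HOL-Analysis.Analysis"
begin

section \<open>Derivatives up to the boundary\<close>

text \<open>
  All derivatives are relative to a set \<open>S\<close>. On an open set they are the ordinary derivatives.
  For \<open>S = closure \<Omega>\<close> with \<open>\<Omega>\<close> open, convex and nonempty they are unique, and
  \<open>Ck_on k S f\<close> says that the derivatives of \<open>f\<close> of order at most \<open>k\<close> in \<open>\<Omega>\<close> extend
  continuously to \<open>closure \<Omega>\<close>; the relative derivatives at boundary points are the values of
  these extensions.
\<close>

definition dderiv_on :: "'a::real_normed_vector set \<Rightarrow> 'a \<Rightarrow> ('a \<Rightarrow> real) \<Rightarrow> 'a \<Rightarrow> real" where
  "dderiv_on S v f x = frechet_derivative f (at x within S) v"

primrec Ck_on :: "nat \<Rightarrow> 'a::real_normed_vector set \<Rightarrow> ('a \<Rightarrow> real) \<Rightarrow> bool" where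
  "Ck_on 0 S f \<longleftrightarrow> continuous_on S f"
| "Ck_on (Suc k) S f \<longleftrightarrow> f differentiable_on S \<and> (\<forall>v. Ck_on k S (dderiv_on S v f))"

definition smooth_on :: "'a::real_normed_vector set \<Rightarrow> ('a \<Rightarrow> real) \<Rightarrow> bool" where
  "smooth_on S f \<longleftrightarrow> (\<forall>k. Ck_on k S f)"

definition grad_on :: "(real^'n) set \<Rightarrow> (real^'n \<Rightarrow> real) \<Rightarrow> real^'n \<Rightarrow> real^'n" where
  "grad_on S f x = (\<chi> i. dderiv_on S (axis i 1) f x)"

definition hess_on :: "(real^'n) set \<Rightarrow> (real^'n \<Rightarrow> real) \<Rightarrow> real^'n \<Rightarrow> real^'n^'n" where
  "hess_on S f x = (\<chi> i j. dderiv_on S (axis j 1) (dderiv_on S (axis i 1) f) x)"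

text \<open>
  Functions \<open>u x t\<close> on \<open>S \<times> I\<close> all of whose pure space (respectively time) derivatives of order
  at most \<open>k\<close> exist and are jointly continuous on \<open>S \<times> I\<close>.
\<close>

primrec Ck_space_on ::
  "nat \<Rightarrow> 'a::real_normed_vector set \<Rightarrow> real set \<Rightarrow> ('a \<Rightarrow> real \<Rightarrow> real) \<Rightarrow> bool" where
  "Ck_space_on 0 S I u \<longleftrightarrow> continuous_on (S \<times> I) (\<lambda>(x, t). u x t)"
| "Ck_space_on (Suc k) S I u \<longleftrightarrow>
     continuous_on (S \<times> I) (\<lambda>(x, t). u x t) \<and>
     (\<forall>t\<in>I. (\<lambda>x. u x t) differentiable_on S) \<and>
     (\<forall>v. Ck_space_on k S I (\<lambda>x t. dderiv_on S v (\<lambda>y. u y t) x))"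

primrec Ck_time_on ::
  "nat \<Rightarrow> 'a::real_normed_vector set \<Rightarrow> real set \<Rightarrow> ('a \<Rightarrow> real \<Rightarrow> real) \<Rightarrow> bool" where
  "Ck_time_on 0 S I u \<longleftrightarrow> continuous_on (S \<times> I) (\<lambda>(x, t). u x t)"
| "Ck_time_on (Suc k) S I u \<longleftrightarrow>
     continuous_on (S \<times> I) (\<lambda>(x, t). u x t) \<and>
     (\<forall>x\<in>S. u x differentiable_on I) \<and>
     Ck_time_on k S I (\<lambda>x t. vector_derivative (u x) (at t within I))"

definition C32 :: "(real^'n) set \<Rightarrow> real \<Rightarrow> (real^'n \<Rightarrow> real \<Rightarrow> real) \<Rightarrow> bool" where
  "C32 \<Omega> T u \<longleftrightarrow>
     Ck_space_on 3 (closure \<Omega>) {0..T} u \<and> Ck_time_on 2 (closure \<Omega>) {0..T} u"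


section \<open>Domains\<close>

definition strictly_convex :: "'a::real_normed_vector set \<Rightarrow> bool" where
  "strictly_convex \<Omega> \<longleftrightarrow>
     (\<forall>x\<in>closure \<Omega>. \<forall>y\<in>closure \<Omega>. x \<noteq> y \<longrightarrow> open_segment x y \<subseteq> interior \<Omega>)"

definition local_defining_function ::
  "(real^'n) set \<Rightarrow> (real^'n) set \<Rightarrow> (real^'n \<Rightarrow> real) \<Rightarrow> bool" where
  "local_defining_function \<Omega> U \<rho> \<longleftrightarrow>
     open U \<and> smooth_on U \<rho> \<and> \<Omega> \<inter> U = {y\<in>U. 0 < \<rho> y} \<and> (\<forall>y\<in>U. grad_on U \<rho> y \<noteq> 0)"

definition smooth_boundary :: "(real^'n) set \<Rightarrow> bool" where
  "smooth_boundary \<Omega> \<longleftrightarrow>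
     (\<forall>x\<in>frontier \<Omega>. \<exists>U \<rho>. x \<in> U \<and> local_defining_function \<Omega> U \<rho>)"

definition inward_normal :: "(real^'n) set \<Rightarrow> real^'n \<Rightarrow> real^'n" where
  "inward_normal \<Omega> x =
     (THE \<nu>. \<exists>U \<rho>. x \<in> U \<and> local_defining_function \<Omega> U \<rho> \<and> \<nu> = sgn (grad_on U \<rho> x))"

text \<open>As in the source, indices of frames and of matrices run over \<open>1, \<dots>, m\<close>.\<close>

definition orthonormal_frame :: "nat \<Rightarrow> (nat \<Rightarrow> 'a::real_inner) \<Rightarrow> bool" where
  "orthonormal_frame m e \<longleftrightarrow> (\<forall>i\<in>{1..m}. \<forall>j\<in>{1..m}. e i \<bullet> e j = (if i = j then 1 else 0))"

definition tangent_frame :: "(real^'n) set \<Rightarrow> real^'n \<Rightarrow> (nat \<Rightarrow> real^'n) \<Rightarrow> bool" where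
  "tangent_frame \<Omega> x e \<longleftrightarrow>
     orthonormal_frame (CARD('n) - 1) e \<and>
     (\<forall>i\<in>{1..CARD('n) - 1}. e i \<bullet> inward_normal \<Omega> x = 0)"

text \<open>
  The derivative of the normal map relative to \<open>frontier \<Omega>\<close> is determined on tangent vectors only,
  and it is applied only to those. For the inward normal the sign that makes the matrix positive on
  strictly convex domains is the minus sign.
\<close>

definition curvature_matrix ::
  "(real^'n) set \<Rightarrow> real^'n \<Rightarrow> (nat \<Rightarrow> real^'n) \<Rightarrow> nat \<Rightarrow> nat \<Rightarrow> real" where
  "curvature_matrix \<Omega> x e i j =
     - (frechet_derivative (inward_normal \<Omega>) (at x within frontier \<Omega>) (e i) \<bullet> e j)"

definition curvature_ge :: "(real^'n) set \<Rightarrow> real \<Rightarrow> bool" where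
  "curvature_ge \<Omega> k\<^sub>0 \<longleftrightarrow>
     (\<forall>x\<in>frontier \<Omega>. \<forall>e. tangent_frame \<Omega> x e \<longrightarrow>
        (\<forall>\<xi>::nat \<Rightarrow> real.
           (\<Sum>i=1..CARD('n) - 1. \<Sum>j=1..CARD('n) - 1. curvature_matrix \<Omega> x e i j * \<xi> i * \<xi> j)
           \<ge> k\<^sub>0 * (\<Sum>i=1..CARD('n) - 1. (\<xi> i)\<^sup>2)))"


section \<open>Anisotropies\<close>

text \<open>\<open>\<real>\<^sup>n\<^sup>+\<^sup>1\<close> is rendered as \<open>real^'n \<times> real\<close>, whose norm is Euclidean.\<close>

definition admissible_anisotropy :: "((real^'n) \<times> real \<Rightarrow> real) \<Rightarrow> bool" where
  "admissible_anisotropy F \<longleftrightarrow>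
     smooth_on (- {0}) F \<and>
     (\<forall>p. p \<noteq> 0 \<longrightarrow> 0 < F p) \<and>
     convex_on UNIV F \<and>
     (\<forall>p. \<forall>c\<ge>0. F (c *\<^sub>R p) = c * F p) \<and>
     (\<forall>p'. F (p', -1) = F (p', 1))"

definition D2 :: "((real^'n) \<times> real \<Rightarrow> real) \<Rightarrow> (real^'n) \<times> real \<Rightarrow> real^'n \<Rightarrow> real^'n \<Rightarrow> real" where
  "D2 F p a b = dderiv_on UNIV (b, 0) (dderiv_on UNIV (a, 0) F) p"

definition tau :: "((real^'n) \<times> real \<Rightarrow> real) \<Rightarrow> real^'n \<Rightarrow> real^'n \<Rightarrow> real^'n \<Rightarrow> real" where
  "tau F p' a b = norm (p', -1::real) * D2 F (p', -1) a b"

definition T3_coeff :: "((real^'n) \<times> real \<Rightarrow> real) \<Rightarrow> real^'n \<Rightarrow> 'n \<Rightarrow> 'n \<Rightarrow> 'n \<Rightarrow> real" where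
  "T3_coeff F p' i j l =
     - dderiv_on UNIV (axis l 1, 0) (\<lambda>q. norm q * D2 F q (axis i 1) (axis j 1)) (p', -1)"

definition T3 ::
  "((real^'n) \<times> real \<Rightarrow> real) \<Rightarrow> real^'n \<Rightarrow> real^'n \<Rightarrow> real^'n \<Rightarrow> real^'n \<Rightarrow> real" where
  "T3 F p' a b c = (\<Sum>i\<in>UNIV. \<Sum>j\<in>UNIV. \<Sum>l\<in>UNIV. T3_coeff F p' i j l * a$i * b$j * c$l)"

definition adapted_basis :: "real^'n \<Rightarrow> (nat \<Rightarrow> real^'n) \<Rightarrow> bool" where
  "adapted_basis p' \<phi> \<longleftrightarrow>
     orthonormal_frame CARD('n) \<phi> \<and> \<phi> CARD('n) = (1 / norm p') *\<^sub>R p'"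

definition tau_bounds :: "((real^'n) \<times> real \<Rightarrow> real) \<Rightarrow> real \<Rightarrow> real \<Rightarrow> real \<Rightarrow> bool" where
  "tau_bounds F c\<^sub>1 c\<^sub>2 c\<^sub>3 \<longleftrightarrow>
     (\<forall>p' \<phi>. p' \<noteq> 0 \<and> adapted_basis p' \<phi> \<longrightarrow>
       (let n = CARD('n); P = norm (p', -1::real); \<tau> = (\<lambda>\<alpha> \<beta>. tau F p' (\<phi> \<alpha>) (\<phi> \<beta>)) in
         c\<^sub>1 / P\<^sup>2 \<le> \<tau> n n \<and> \<tau> n n \<le> c\<^sub>3 / P\<^sup>2 \<and>
         (\<forall>\<alpha>\<in>{1..n-1}. c\<^sub>1 \<le> \<tau> \<alpha> \<alpha> \<and> \<tau> \<alpha> \<alpha> \<le> c\<^sub>3 \<and> \<bar>\<tau> \<alpha> n\<bar> \<le> c\<^sub>2 / P\<^sup>2) \<and>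
         (\<forall>\<alpha>\<in>{1..n-1}. \<forall>\<beta>\<in>{1..n-1}. \<alpha> \<noteq> \<beta> \<longrightarrow> \<bar>\<tau> \<alpha> \<beta>\<bar> \<le> c\<^sub>2)))"

definition T3_bounds :: "((real^'n) \<times> real \<Rightarrow> real) \<Rightarrow> real \<Rightarrow> real \<Rightarrow> real \<Rightarrow> bool" where
  "T3_bounds F C\<^sub>4 C\<^sub>5 C\<^sub>6 \<longleftrightarrow>
     (\<forall>p' \<phi>. 1 < norm p' \<and> adapted_basis p' \<phi> \<longrightarrow>
       (let n = CARD('n); P = norm (p', -1::real);
            T = (\<lambda>\<alpha> \<beta> \<gamma>. T3 F p' (\<phi> \<alpha>) (\<phi> \<beta>) (\<phi> \<gamma>)) in
         (\<forall>\<alpha>\<in>{1..n-1}. \<forall>\<beta>\<in>{1..n-1}.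
            \<bar>T \<alpha> \<alpha> \<beta>\<bar> \<le> C\<^sub>4 / P \<and> (\<alpha> \<noteq> \<beta> \<longrightarrow> \<bar>T \<alpha> n \<beta>\<bar> \<le> C\<^sub>4 / P)) \<and>
         (\<forall>\<alpha>\<in>{1..n-1}.
            \<bar>T \<alpha> \<alpha> n\<bar> \<le> C\<^sub>4 / P^3 \<and> \<bar>T \<alpha> n n\<bar> \<le> C\<^sub>4 / P^3 \<and> \<bar>T n n \<alpha>\<bar> \<le> C\<^sub>4 / P^3 \<and>
            C\<^sub>5 / P \<le> T \<alpha> n \<alpha> \<and> T \<alpha> n \<alpha> \<le> C\<^sub>6 / P) \<and>
         C\<^sub>5 / P^3 \<le> T n n n \<and> T n n n \<le> C\<^sub>6 / P^3))"

definition structure_constants ::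
  "((real^'n) \<times> real \<Rightarrow> real) \<Rightarrow> real \<Rightarrow> real \<Rightarrow> real \<Rightarrow> bool" where
  "structure_constants F c\<^sub>1 c\<^sub>2 c\<^sub>3 \<longleftrightarrow>
     0 < c\<^sub>1 \<and> 0 < c\<^sub>2 \<and> 0 < c\<^sub>3 \<and> tau_bounds F c\<^sub>1 c\<^sub>2 c\<^sub>3 \<and>
     (\<exists>C\<^sub>4 C\<^sub>5 C\<^sub>6. 0 < C\<^sub>4 \<and> 0 < C\<^sub>5 \<and> 0 < C\<^sub>6 \<and> T3_bounds F C\<^sub>4 C\<^sub>5 C\<^sub>6 \<and> c\<^sub>1 \<le> C\<^sub>5 \<and> C\<^sub>4 \<le> c\<^sub>2)"


section \<open>The flow\<close>

definition flow_solution ::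
  "(real^'n) set \<Rightarrow> ((real^'n) \<times> real \<Rightarrow> real) \<Rightarrow> (real^'n \<Rightarrow> real) \<Rightarrow> (real^'n \<Rightarrow> real) \<Rightarrow> real
     \<Rightarrow> (real^'n \<Rightarrow> real \<Rightarrow> real) \<Rightarrow> bool" where
  "flow_solution \<Omega> F \<phi> u\<^sub>0 T u \<longleftrightarrow>
     (\<forall>x\<in>\<Omega>. \<forall>t\<in>{0..T}.
        let Du = grad_on (closure \<Omega>) (\<lambda>y. u y t) x; D2u = hess_on (closure \<Omega>) (\<lambda>y. u y t) x in
        vector_derivative (u x) (at t within {0..T}) =
          sqrt (1 + (norm Du)\<^sup>2) *
          (\<Sum>i\<in>UNIV. \<Sum>j\<in>UNIV. D2 F (Du, -1) (axis i 1) (axis j 1) * D2u $ i $ j)) \<and>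
     (\<forall>x\<in>frontier \<Omega>. \<forall>t\<in>{0..T}.
        dderiv_on (closure \<Omega>) (inward_normal \<Omega> x) (\<lambda>y. u y t) x = \<phi> x) \<and>
     (\<forall>x\<in>\<Omega>. u x 0 = u\<^sub>0 x)"

end

theory Submission
  imports Defs
begin

text \<open>
  The bound is proved with a two-point maximum principle. Suppose first that \<open>n \<ge> 2\<close>.

  The Neumann datum is extended to a function \<open>g\<close> of class \<open>C\<^sup>3\<close> on \<open>closure \<Omega>\<close> with
  \<open>D\<^sub>N g = \<phi>\<close> on the boundary (lemma \<open>neumann_extension\<close>), so that \<open>w = u - g\<close> has vanishing normal
  derivative. With \<open>m\<close> the midpoint of \<open>x\<close> and \<open>y\<close>, the claim is that
  \<open>w x t - w y t \<le> L * |x - y| * (1 - \<alpha> * |m|\<^sup>2)\<close> at all times, for a small \<open>\<alpha> > 0\<close> and a large \<open>L\<close> that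
  depend on \<open>\<Omega>\<close>, \<open>F\<close>, \<open>\<phi>\<close> and \<open>u\<^sub>0\<close> only. Dividing by \<open>|x - y|\<close> and letting \<open>y\<close> tend to \<open>x\<close> gives
  \<open>|Dw| \<le> L\<close>. At time \<open>0\<close> the claim holds as soon as \<open>L\<close> exceeds twice the Lipschitz constant of
  \<open>u\<^sub>0 - g\<close>. If it fails later, the difference of the two sides has a positive maximum at some
  \<open>(x, y, t)\<close> with \<open>x \<noteq> y\<close> and \<open>t > 0\<close>, and each possible position is contradictory
  (lemma \<open>two_point_maximum_principle\<close>).

  If \<open>x\<close> lies on the boundary, the curvature bound and compactness give
  \<open>N x \<bullet> (y - x) \<ge> \<kappa> * |y - x|\<^sup>2\<close> (lemma \<open>uniformly_convex_at_boundary\<close>). So a step from \<open>x\<close> in the direction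
  \<open>N\<close> shortens \<open>|x - y|\<close> at a rate of at least \<open>\<kappa> * |x - y|\<close>, and for small \<open>\<alpha>\<close> the factor
  \<open>1 - \<alpha> * |m|\<^sup>2\<close> cannot compensate this. The right-hand side decreases while \<open>w\<close> is stationary. The
  point \<open>y\<close> is treated in the same way.

  If \<open>x\<close> and \<open>y\<close> are interior points, the gradients \<open>p\<close> and \<open>q\<close> of \<open>u\<close> at \<open>x\<close> and \<open>y\<close> have length of
  order \<open>L\<close> and differ by at most a multiple of \<open>\<alpha> * L * |x - y|\<close>. The coefficient matrix of the equation
  is written as \<open>\<Sum>b. \<sigma> p b \<otimes> \<sigma> p b\<close> (lemma \<open>anisotropy_factorization\<close>), and the second-order
  condition at the maximum is used along the directions \<open>(\<sigma> p b, \<sigma> q b)\<close>. The concavity of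
  \<open>1 - \<alpha> * |m|\<^sup>2\<close> contributes a negative term of order \<open>\<alpha> * L * |x - y|\<close>. The mismatch of the two
  directions costs a multiple of \<open>L * |\<sigma> p b - \<sigma> q b|\<^sup>2 / |x - y|\<close>. Since \<open>|p| D\<^sup>2F\<close> is homogeneous of
  degree zero, \<open>\<sigma>\<close> has Lipschitz constant of order \<open>1 / |p|\<close>, and this cost is only of order
  \<open>\<alpha>\<^sup>2 * L * |x - y|\<close>. The terms that come from \<open>g\<close> are of order \<open>|x - y|\<close> without the factor \<open>L\<close>. So first
  \<open>\<alpha>\<close> is chosen small and then \<open>L\<close> large (lemma \<open>two_point_interior_estimate\<close>).

  The factorization uses that \<open>|p| D\<^sup>2F\<close> on \<open>\<real>\<^sup>n\<^sup>+\<^sup>1\<close> annihilates \<open>p\<close> and that the structure constants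
  make it uniformly positive on the complement of \<open>p\<close>. This is where \<open>c\<^sub>2 / c\<^sub>1 < 1 / 2\<close> enters. Adding the projection onto
  \<open>p\<close> gives a uniformly positive operator, whose square root depends on it in a Lipschitz way.

  For \<open>n = 1\<close> there is no tangential direction, the trace of the coefficient matrix tends to zero for
  large gradients, and the concavity term is lost. But then \<open>\<alpha> = 0\<close> and \<open>g = 0\<close> are possible: both gradients at an
  interior maximum equal \<open>L * sgn (x - y)\<close>, the two coefficient matrices agree, and at a boundary point it
  suffices that \<open>L\<close> exceeds \<open>|\<phi>|\<close>.
\<close>


section \<open>Calculus relative to a set\<close>

text \<open>
  Derivatives relative to \<open>S\<close> are unique if \<open>S\<close> contains, at each of its points, a truncated open
  cone of directions. Unlike convexity with nonempty interior, this property passes to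
  intersections with open sets, so that regularity can be checked locally.
\<close>

definition cone_condition :: "'a::real_normed_vector set \<Rightarrow> bool" where
  "cone_condition S \<longleftrightarrow>
     (\<forall>x\<in>S. \<exists>z. \<exists>e>0. \<exists>d>0. \<forall>y\<in>ball z e. \<forall>s. 0 \<le> s \<and> s \<le> d \<longrightarrow> x + s *\<^sub>R y \<in> S)"

lemma cone_condition_open: "open S \<Longrightarrow> cone_condition S"
  unfolding cone_condition_def
proof
  fix x assume "open S" "x \<in> S"
  then obtain r where r: "r > 0" "ball x r \<subseteq> S" by (meson open_contains_ball)
  have "x + s *\<^sub>R y \<in> S" if "y \<in> ball 0 r" "0 \<le> s" "s \<le> 1" for y :: 'a and s :: real
  proof -
    have "s * norm y \<le> 1 * norm y" using that by (intro mult_right_mono) auto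
    then show ?thesis using that r by (intro subsetD[OF r(2)]) (auto simp: dist_norm)
  qed
  then show "\<exists>z. \<exists>e>0. \<exists>d>0. \<forall>y\<in>ball z e. \<forall>s. 0 \<le> s \<and> s \<le> d \<longrightarrow> x + s *\<^sub>R y \<in> S"
    using r(1) by (intro exI[of _ 0] exI[of _ r] conjI exI[of _ 1]) auto
qed

lemma cone_condition_Int_open:
  assumes "cone_condition S" "open V" shows "cone_condition (S \<inter> V)"
  unfolding cone_condition_def
proof
  fix x assume x: "x \<in> S \<inter> V"
  then obtain z e d where *: "e > 0" "d > 0"
      "\<And>y s. y \<in> ball z e \<Longrightarrow> 0 \<le> s \<Longrightarrow> s \<le> d \<Longrightarrow> x + s *\<^sub>R y \<in> S"
    using assms(1) unfolding cone_condition_def by blast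
  obtain r where r: "r > 0" "ball x r \<subseteq> V" using x assms(2) by (meson IntD2 open_contains_ball)
  define d' where "d' = min d (r / (norm z + e))"
  have ze: "norm z + e > 0" using * by (simp add: add_nonneg_pos)
  have "d' > 0" using * r ze by (simp add: d'_def)
  moreover have "x + s *\<^sub>R y \<in> S \<inter> V" if "y \<in> ball z e" "0 \<le> s" "s \<le> d'" for y s
  proof -
    have ny: "norm y < norm z + e"
      using that(1) norm_triangle_ineq[of z "y - z"] by (simp add: dist_norm norm_minus_commute)
    have "s * norm y < r"
    proof (cases "s = 0")
      case False
      then have "s * norm y < s * (norm z + e)" using ny that by simp
      also have "\<dots> \<le> r / (norm z + e) * (norm z + e)"
        using that ze by (intro mult_right_mono) (auto simp: d'_def)
      finally show ?thesis using ze by simp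
    qed (use r in simp)
    then have "x + s *\<^sub>R y \<in> V" using that r by (intro subsetD[OF r(2)]) (auto simp: dist_norm)
    then show ?thesis using *(3)[OF that(1)] that by (auto simp: d'_def)
  qed
  ultimately show "\<exists>z. \<exists>e>0. \<exists>d>0. \<forall>y\<in>ball z e. \<forall>s. 0 \<le> s \<and> s \<le> d \<longrightarrow> x + s *\<^sub>R y \<in> S \<inter> V"
    using *(1) by blast
qed

text \<open>
  The cone at \<open>x\<close> consists of the segments from \<open>x\<close> to a fixed ball inside \<open>\<Omega>\<close>.
\<close>

lemma cone_condition_closure_convex:
  assumes "convex \<Omega>" "open \<Omega>" "\<Omega> \<noteq> {}" shows "cone_condition (closure \<Omega>)"
  unfolding cone_condition_def
proof
  fix x assume x: "x \<in> closure \<Omega>"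
  obtain z e where ze: "e > 0" "ball z e \<subseteq> \<Omega>" using assms by (meson equals0I open_contains_ball)
  have "x + s *\<^sub>R y \<in> closure \<Omega>" if "y \<in> ball (z - x) e" "0 \<le> s" "s \<le> 1" for y s
  proof -
    have "x + y \<in> ball z e" using that(1) by (simp add: dist_norm algebra_simps)
    then have "x + y \<in> closure \<Omega>" using ze closure_subset by blast
    then have "(1 - s) *\<^sub>R x + s *\<^sub>R (x + y) \<in> closure \<Omega>"
      using x that convex_closure[OF assms(1)] by (simp add: convexD)
    then show ?thesis by (simp add: algebra_simps)
  qed
  then show "\<exists>z. \<exists>e>0. \<exists>d>0. \<forall>y\<in>ball z e. \<forall>s. 0 \<le> s \<and> s \<le> d \<longrightarrow> x + s *\<^sub>R y \<in> closure \<Omega>"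
    using ze(1) zero_less_one by blast
qed

lemma has_real_derivative_along_segment:
  fixes f :: "'a::real_normed_vector \<Rightarrow> real"
  assumes "(f has_derivative D) (at x within S)" "\<And>s. s \<in> I \<Longrightarrow> x + s *\<^sub>R y \<in> S"
  shows "((\<lambda>s. f (x + s *\<^sub>R y)) has_real_derivative D y) (at 0 within I)"
proof -
  have 1: "((\<lambda>s. x + s *\<^sub>R y) has_derivative (\<lambda>s. s *\<^sub>R y)) (at 0 within I)"
    by (auto intro!: derivative_eq_intros)
  have 2: "(f has_derivative D) (at (x + 0 *\<^sub>R y) within (\<lambda>s. x + s *\<^sub>R y) ` I)"
    using assms by (auto intro: has_derivative_subset)
  have "((\<lambda>s. f (x + s *\<^sub>R y)) has_derivative (\<lambda>s. D (s *\<^sub>R y))) (at 0 within I)"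
    using has_derivative_in_compose[OF 1 2] by simp
  moreover have "(\<lambda>s. D (s *\<^sub>R y)) = (*) (D y)"
    using linear_cmul[OF has_derivative_linear[OF assms(1)]] by (auto simp: fun_eq_iff)
  ultimately show ?thesis by (simp add: has_field_derivative_def)
qed

text \<open>
  Two derivatives agree along all segments of the cone, that is, on an open set of directions. Linear
  maps that agree on an open set are equal.
\<close>

lemma cone_condition_derivative_unique:
  fixes f :: "'a::real_normed_vector \<Rightarrow> real"
  assumes "cone_condition S" "x \<in> S"
    and D: "(f has_derivative D) (at x within S)" and D': "(f has_derivative D') (at x within S)"
  shows "D = D'"
proof
  fix v :: 'a
  obtain z e d where *: "e > 0" "d > 0"
      "\<And>y s. y \<in> ball z e \<Longrightarrow> 0 \<le> s \<Longrightarrow> s \<le> d \<Longrightarrow> x + s *\<^sub>R y \<in> S"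
    using assms(1,2) unfolding cone_condition_def by blast
  have eq: "D y = D' y" if y: "y \<in> ball z e" for y
  proof -
    note r = has_real_derivative_along_segment[OF _ , where I = "{0..d}" and y = y]
    have "((\<lambda>s. f (x + s *\<^sub>R y)) has_vector_derivative D y) (at 0 within {0..d})"
      "((\<lambda>s. f (x + s *\<^sub>R y)) has_vector_derivative D' y) (at 0 within {0..d})"
      using r[OF D] r[OF D'] * y by (auto simp: has_real_derivative_iff_has_vector_derivative)
    then show ?thesis
      using vector_derivative_unique_within_closed_interval[of 0 d 0 "\<lambda>s. f (x + s *\<^sub>R y)" "D y" "D' y"] * by auto
  qed
  \<comment> \<open>A multiple of \<open>v\<close> so short that \<open>z\<close> and its translate both lie in the cone of directions.\<close>
  define a where "a = e / (2 * (norm v + 1))"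
  have a: "a > 0" using * by (simp add: a_def add_nonneg_pos)
  have "a * norm v < e"
  proof -
    have "a * norm v \<le> a * (norm v + 1)" using a by (simp add: algebra_simps)
    also have "\<dots> = e / 2"
      using add_nonneg_pos[OF norm_ge_zero[of v] zero_less_one] by (simp add: a_def divide_simps)
    finally show ?thesis using * by simp
  qed
  then have "z \<in> ball z e" "z + a *\<^sub>R v \<in> ball z e" using * a by (auto simp: dist_norm)
  then have "D (z + a *\<^sub>R v) - D z = D' (z + a *\<^sub>R v) - D' z" using eq by simp
  then have "a * D v = a * D' v"
    using has_derivative_linear[OF D] has_derivative_linear[OF D']
    by (simp add: linear_add linear_cmul)
  then show "D v = D' v" using a by simp
qed

lemma dderiv_on_eqI:
  assumes "cone_condition S" "x \<in> S" "(f has_derivative D) (at x within S)"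
  shows "dderiv_on S v f x = D v"
proof -
  have "(f has_derivative frechet_derivative f (at x within S)) (at x within S)"
    using assms(3) differentiableI frechet_derivative_works by blast
  then show ?thesis
    unfolding dderiv_on_def using cone_condition_derivative_unique[OF assms(1,2) _ assms(3)] by metis
qed

lemma dderiv_on_cong:
  assumes "\<And>x. x \<in> S \<Longrightarrow> f x = g x" "x \<in> S"
  shows "dderiv_on S v f x = dderiv_on S v g x"
proof -
  have "(f has_derivative D) (at x within S) \<longleftrightarrow> (g has_derivative D) (at x within S)" for D
    using assms by (metis has_derivative_transform)
  then show ?thesis by (simp add: dderiv_on_def frechet_derivative_def)
qed

lemma has_derivative_dderiv_on:
  "f differentiable_on S \<Longrightarrow> x \<in> S \<Longrightarrow> (f has_derivative (\<lambda>v. dderiv_on S v f x)) (at x within S)"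
  unfolding dderiv_on_def differentiable_on_def
  by (metis (no_types, lifting) frechet_derivative_works has_derivative_eq_rhs)

lemma Ck_on_cong:
  assumes "\<And>x. x \<in> S \<Longrightarrow> f x = g x"
  shows "Ck_on k S f \<longleftrightarrow> Ck_on k S g"
  using assms
proof (induction k arbitrary: f g)
  case 0 then show ?case by (simp cong: continuous_on_cong)
next
  case (Suc k)
  have "f differentiable_on S \<longleftrightarrow> g differentiable_on S"
    unfolding differentiable_on_def using Suc.prems
    by (metis differentiable_transform_within zero_less_one)
  moreover have "Ck_on k S (dderiv_on S v f) \<longleftrightarrow> Ck_on k S (dderiv_on S v g)" for v
    by (rule Suc.IH) (rule dderiv_on_cong[OF Suc.prems])
  ultimately show ?case by simp
qed

lemma Ck_on_SucI:
  assumes "cone_condition S" "\<And>x. x \<in> S \<Longrightarrow> (f has_derivative D x) (at x within S)"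
    and "\<And>v. Ck_on k S (\<lambda>x. D x v)"
  shows "Ck_on (Suc k) S f"
proof -
  have "f differentiable_on S" using assms(2) differentiableI differentiable_on_def by blast
  moreover have "Ck_on k S (dderiv_on S v f)" for v
    using Ck_on_cong[of S "dderiv_on S v f" "\<lambda>x. D x v" k] dderiv_on_eqI[OF assms(1) _ assms(2)] assms(3) by auto
  ultimately show ?thesis by simp
qed

lemma Ck_on_SucD:
  assumes "Ck_on (Suc k) S f"
  shows "x \<in> S \<Longrightarrow> (f has_derivative (\<lambda>v. dderiv_on S v f x)) (at x within S)"
    and "Ck_on k S (dderiv_on S v f)"
  using assms has_derivative_dderiv_on by auto

lemma Ck_on_imp_continuous_on: "Ck_on k S f \<Longrightarrow> continuous_on S f"
  by (cases k) (auto intro: differentiable_imp_continuous_on)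

lemma Ck_on_Suc_imp: "Ck_on (Suc k) S f \<Longrightarrow> Ck_on k S f"
proof (induction k arbitrary: f)
  case 0 then show ?case using Ck_on_imp_continuous_on[of "Suc 0"] by simp
next
  case (Suc k) then show ?case by (metis Ck_on.simps(2))
qed

lemma Ck_on_le: "Ck_on k S f \<Longrightarrow> j \<le> k \<Longrightarrow> Ck_on j S f"
proof -
  assume "Ck_on k S f" "j \<le> k"
  show "Ck_on j S f"
    using \<open>j \<le> k\<close>
  proof (induction rule: inc_induct)
    case base show ?case by fact
  next
    case (step n) show ?case by (rule Ck_on_Suc_imp[OF step(3)])
  qed
qed

lemma Ck_on_const: "cone_condition S \<Longrightarrow> Ck_on k S (\<lambda>x. c)"
proof (induction k arbitrary: c)
  case (Suc k)
  show ?case by (rule Ck_on_SucI[OF Suc.prems, where D = "\<lambda>x v. 0"]) (auto intro: Suc)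
qed simp

lemma Ck_on_bounded_linear:
  assumes "cone_condition S" "bounded_linear l" shows "Ck_on k S l"
proof (cases k)
  case 0 then show ?thesis using assms by (simp add: linear_continuous_on)
next
  case (Suc j)
  show ?thesis unfolding Suc
    by (rule Ck_on_SucI[OF assms(1), where D = "\<lambda>x. l"])
      (auto intro: Ck_on_const[OF assms(1)] bounded_linear_imp_has_derivative assms(2))
qed

lemma Ck_on_add:
  assumes "cone_condition S" shows "Ck_on k S f \<Longrightarrow> Ck_on k S g \<Longrightarrow> Ck_on k S (\<lambda>x. f x + g x)"
proof (induction k arbitrary: f g)
  case 0 then show ?case by (simp add: continuous_on_add)
next
  case (Suc k)
  show ?case
  proof (rule Ck_on_SucI[OF assms])
    show "((\<lambda>x. f x + g x) has_derivative (\<lambda>v. dderiv_on S v f x + dderiv_on S v g x)) (at x within S)"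
      if "x \<in> S" for x
      using Ck_on_SucD(1)[OF Suc.prems(1) that] Ck_on_SucD(1)[OF Suc.prems(2) that]
      by (rule has_derivative_add)
    show "Ck_on k S (\<lambda>x. dderiv_on S v f x + dderiv_on S v g x)" for v
      using Suc Ck_on_SucD(2) by blast
  qed
qed

lemma Ck_on_mult:
  assumes "cone_condition S" shows "Ck_on k S f \<Longrightarrow> Ck_on k S g \<Longrightarrow> Ck_on k S (\<lambda>x. f x * g x)"
proof (induction k arbitrary: f g)
  case 0 then show ?case by (simp add: continuous_on_mult)
next
  case (Suc k)
  show ?case
  proof (rule Ck_on_SucI[OF assms])
    show "((\<lambda>x. f x * g x) has_derivative (\<lambda>v. f x * dderiv_on S v g x + dderiv_on S v f x * g x)) (at x within S)"
      if "x \<in> S" for x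
      using Ck_on_SucD(1)[OF Suc.prems(1) that] Ck_on_SucD(1)[OF Suc.prems(2) that]
      by (rule has_derivative_mult)
    show "Ck_on k S (\<lambda>x. f x * dderiv_on S v g x + dderiv_on S v f x * g x)" for v
      using Suc Ck_on_SucD(2) Ck_on_Suc_imp by (intro Ck_on_add[OF assms] Suc.IH) blast+
  qed
qed

lemma Ck_on_sum:
  assumes "cone_condition S" "\<And>i. i \<in> I \<Longrightarrow> Ck_on k S (f i)"
  shows "Ck_on k S (\<lambda>x. \<Sum>i\<in>I. f i x)"
  using assms(2) by (induction I rule: infinite_finite_induct)
    (auto intro: Ck_on_add[OF assms(1)] Ck_on_const[OF assms(1)])

text \<open>
  Real powers of positive functions cover reciprocals and reciprocal square roots in one induction,
  since the derivative of a power is again of this form.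
\<close>

lemma Ck_on_powr:
  assumes "cone_condition S" shows "Ck_on k S f \<Longrightarrow> (\<And>x. x \<in> S \<Longrightarrow> 0 < f x) \<Longrightarrow> Ck_on k S (\<lambda>x. f x powr a)"
proof (induction k arbitrary: a)
  case 0
  have "\<forall>x\<in>S. f x \<noteq> 0" using 0(2) by force
  then show ?case using 0(1) by (simp add: continuous_on_powr)
next
  case (Suc k)
  show ?case
  proof (rule Ck_on_SucI[OF assms])
    show "((\<lambda>x. f x powr a) has_derivative (\<lambda>v. dderiv_on S v f x * (a * f x powr (a - 1)))) (at x within S)"
      if "x \<in> S" for x
      using DERIV_compose_FDERIV[OF has_real_derivative_powr[OF Suc.prems(2)[OF that]] Ck_on_SucD(1)[OF Suc.prems(1) that]] .
    show "Ck_on k S (\<lambda>x. dderiv_on S v f x * (a * f x powr (a - 1)))" for v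
      using Suc Ck_on_SucD(2)[OF Suc.prems(1)] Ck_on_Suc_imp[OF Suc.prems(1)]
      by (intro Ck_on_mult[OF assms] Ck_on_const[OF assms] Suc.IH) blast+
  qed
qed

lemma has_real_derivative_pos_part_power:
  "((\<lambda>t::real. max 0 t ^ (m + 2)) has_real_derivative real (m + 2) * max 0 t ^ (m + 1)) (at t)"
proof -
  consider "t > 0" | "t < 0" | "t = 0" by linarith
  then show ?thesis
  proof cases
    case 1
    have "((\<lambda>t. t ^ (m + 2)) has_real_derivative real (m + 2) * t ^ (m + 1)) (at t)"
      by (rule derivative_eq_intros refl | simp)+
    then have "((\<lambda>t. max 0 t ^ (m + 2)) has_real_derivative real (m + 2) * t ^ (m + 1)) (at t)"
      by (rule DERIV_cong_ev[OF refl _ refl, THEN iffD1, rotated])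
        (use 1 eventually_nhds_in_open[of "{0<..}" t] in \<open>auto elim: eventually_mono\<close>)
    then show ?thesis using 1 by simp
  next
    case 2
    have "((\<lambda>t::real. 0::real) has_real_derivative 0) (at t)" by simp
    then have "((\<lambda>t. max 0 t ^ (m + 2)) has_real_derivative 0) (at t)"
      by (rule DERIV_cong_ev[OF refl _ refl, THEN iffD1, rotated])
        (use 2 eventually_nhds_in_open[of "{..<0}" t] in \<open>auto elim!: eventually_mono\<close>)
    then show ?thesis using 2 by simp
  next
    case 3
    have "((\<lambda>h::real. max 0 h ^ (m + 2) / h) \<longlongrightarrow> 0) (at 0)"
    proof (rule Lim_null_comparison)
      have "\<bar>max 0 h ^ (m + 2) / h\<bar> \<le> \<bar>h\<bar> ^ (m + 1)" if "h \<noteq> 0" for h :: real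
      proof (cases "h > 0")
        case False
        then have "max 0 h ^ (m + 2) / h = 0" by (simp add: max_absorb1)
        then show ?thesis by (simp only: abs_zero zero_le_power_abs)
      qed (use that in simp)
      then show "\<forall>\<^sub>F h in at 0. norm (max 0 h ^ (m + 2) / h :: real) \<le> \<bar>h\<bar> ^ (m + 1)"
        by (auto simp: eventually_at intro!: exI[of _ 1])
      show "((\<lambda>h::real. \<bar>h\<bar> ^ (m + 1)) \<longlongrightarrow> 0) (at 0)"
        by (rule tendsto_eq_intros refl | simp)+
    qed
    then show ?thesis using 3 by (simp add: DERIV_def)
  qed
qed

text \<open>
  The power makes the positive part differentiable; each differentiation lowers it by one, which
  is why the exponent is tied to the order.
\<close>

lemma Ck_on_pos_part_power:
  assumes "cone_condition S" shows "Ck_on k S f \<Longrightarrow> Ck_on k S (\<lambda>x. max 0 (f x) ^ (k + 1))"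
proof (induction k)
  case 0 then show ?case by (auto intro!: continuous_intros)
next
  case (Suc k)
  show ?case
  proof (rule Ck_on_SucI[OF assms])
    show "((\<lambda>x. max 0 (f x) ^ (Suc k + 1)) has_derivative
        (\<lambda>v. dderiv_on S v f x * (real (k + 2) * max 0 (f x) ^ (k + 1)))) (at x within S)"
      if "x \<in> S" for x
      using DERIV_compose_FDERIV[OF has_real_derivative_pos_part_power Ck_on_SucD(1)[OF Suc.prems that], of k] by simp
    show "Ck_on k S (\<lambda>x. dderiv_on S v f x * (real (k + 2) * max 0 (f x) ^ (k + 1)))" for v
      using Suc.IH Ck_on_SucD(2)[OF Suc.prems] Ck_on_Suc_imp[OF Suc.prems]
      by (intro Ck_on_mult[OF assms] Ck_on_const[OF assms])
  qed
qed

lemma Ck_on_subset: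
  assumes "cone_condition T" "T \<subseteq> S" shows "Ck_on k S f \<Longrightarrow> Ck_on k T f"
proof (induction k arbitrary: f)
  case 0 then show ?case using assms(2) continuous_on_subset by auto
next
  case (Suc k)
  show ?case
    by (rule Ck_on_SucI[OF assms(1), where D = "\<lambda>x v. dderiv_on S v f x"])
      (use Suc assms(2) Ck_on_SucD[OF Suc.prems] in \<open>auto intro: has_derivative_subset\<close>)
qed

lemma at_within_Int_open: "open V \<Longrightarrow> x \<in> V \<Longrightarrow> at x within (S \<inter> V) = at x within S"
  by (rule at_within_nhd[of x V]) auto

text \<open>
  At the points of an open set \<open>V\<close> the derivatives relative to \<open>S\<close> and to \<open>S \<inter> V\<close> coincide.
\<close>

lemma Ck_on_local:
  assumes "cone_condition S"
    and "\<And>x. x \<in> S \<Longrightarrow> \<exists>V. open V \<and> x \<in> V \<and> Ck_on k (S \<inter> V) f"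
  shows "Ck_on k S f"
  using assms(2)
proof (induction k arbitrary: f)
  case 0
  show ?case
    unfolding Ck_on.simps continuous_on_eq_continuous_within
  proof
    fix x assume "x \<in> S"
    then obtain V where V: "open V" "x \<in> V" "continuous_on (S \<inter> V) f" using 0[of x] by auto
    then have "continuous (at x within S \<inter> V) f"
      using \<open>x \<in> S\<close> by (simp add: continuous_on_eq_continuous_within)
    then show "continuous (at x within S) f"
      using V by (simp add: at_within_Int_open)
  qed
next
  case (Suc k)
  have der: "(f has_derivative (\<lambda>v. dderiv_on (S \<inter> V) v f x)) (at x within S)"
    if "open V" "x \<in> S \<inter> V" "Ck_on (Suc k) (S \<inter> V) f" for V x
    using Ck_on_SucD(1)[OF that(3,2)] that(1,2) by (simp only: at_within_Int_open IntD2)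
  show ?case
  proof (rule Ck_on_SucI[OF assms(1)])
    show "(f has_derivative (\<lambda>v. dderiv_on S v f x)) (at x within S)" if x: "x \<in> S" for x
    proof -
      obtain V where V: "open V" "x \<in> V" "Ck_on (Suc k) (S \<inter> V) f" using Suc.prems[OF x] by auto
      then show ?thesis
        using der[of V x] x dderiv_on_eqI[OF assms(1) x der[of V x]] by simp
    qed
    show "Ck_on k S (\<lambda>x. dderiv_on S v f x)" for v
    proof (rule Suc.IH)
      fix x assume x: "x \<in> S"
      obtain V where V: "open V" "x \<in> V" "Ck_on (Suc k) (S \<inter> V) f" using Suc.prems[OF x] by auto
      have "Ck_on k (S \<inter> V) (dderiv_on (S \<inter> V) v f)" using Ck_on_SucD(2)[OF V(3)] .
      moreover have "dderiv_on (S \<inter> V) v f y = dderiv_on S v f y" if "y \<in> S \<inter> V" for y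
        using dderiv_on_eqI[OF assms(1) _ der[OF V(1) that V(3)], of v] that by simp
      ultimately have "Ck_on k (S \<inter> V) (dderiv_on S v f)" using Ck_on_cong by blast
      then show "\<exists>V. open V \<and> x \<in> V \<and> Ck_on k (S \<inter> V) (dderiv_on S v f)" using V by auto
    qed
  qed
qed


section \<open>Square roots of positive operators\<close>

text \<open>
  Induction on the dimension of an invariant subspace. A maximum point of the quadratic form on the
  unit sphere of \<open>W\<close> is an eigenvector, because the first variation vanishes there. Its orthogonal
  complement in \<open>W\<close> is invariant, and the square root found there is extended by the square root of
  the eigenvalue.
\<close>

lemma selfadjoint_sqrt_on_subspace:
  fixes T :: "'a::euclidean_space \<Rightarrow> 'a"
  assumes lin: "linear T" and sa: "\<And>v w. T v \<bullet> w = v \<bullet> T w"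
    and c: "0 \<le> c" "\<And>v. c * (norm v)\<^sup>2 \<le> v \<bullet> T v"
    and W: "subspace W" "T ` W \<subseteq> W"
  shows "\<exists>S. linear S \<and> (\<forall>v w. S v \<bullet> w = v \<bullet> S w) \<and> range S \<subseteq> W \<and>
           (\<forall>v\<in>W. S (S v) = T v \<and> sqrt c * (norm v)\<^sup>2 \<le> v \<bullet> S v)"
  using W
proof (induction "dim W" arbitrary: W rule: less_induct)
  case less
  show ?case
  proof (cases "W \<subseteq> {0}")
    case True
    then show ?thesis
      using subspace_0[OF less(2)] linear_0[OF lin]
      by (intro exI[of _ "\<lambda>v. 0"]) (auto intro: linearI)
  next
    case False
    then obtain w where w: "w \<in> W" "w \<noteq> 0" by auto
    define K where "K = W \<inter> sphere 0 1"
    have "compact K" unfolding K_def using less(2)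
      by (intro closed_Int_compact closed_subspace) auto
    moreover have "sgn w \<in> K" using w less(2) by (simp add: K_def sgn_div_norm subspace_scale)
    moreover have "continuous_on K (\<lambda>v. v \<bullet> T v)"
      using lin by (intro continuous_intros linear_continuous_on) (simp add: linear_conv_bounded_linear)
    ultimately obtain x where x: "x \<in> K" "\<And>v. v \<in> K \<Longrightarrow> v \<bullet> T v \<le> x \<bullet> T x"
      using continuous_attains_sup[of K "\<lambda>v. v \<bullet> T v"] by blast
    define lam where "lam = x \<bullet> T x"
    have xW: "x \<in> W" and nx: "norm x = 1" "x \<bullet> x = 1"
      using x(1) by (auto simp: K_def dot_square_norm)
    have lam0: "0 \<le> lam" "c \<le> lam" using c(1) c(2)[of x] nx by (auto simp: lam_def)
    have max: "v \<bullet> T v \<le> lam * (v \<bullet> v)" if "v \<in> W" for v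
    proof (cases "v = 0")
      case False
      have "sgn v \<in> K" using that False less(2) by (simp add: K_def sgn_div_norm subspace_scale)
      then have "sgn v \<bullet> T (sgn v) \<le> lam" using x(2) by (simp add: lam_def)
      then have "(v \<bullet> T v) / (norm v)\<^sup>2 \<le> lam"
        using lin by (simp add: sgn_div_norm linear_cmul power2_eq_square divide_simps)
      then show ?thesis using False by (simp add: field_simps dot_square_norm)
    qed (use linear_0[OF lin] in simp)
    have eig: "T x = lam *\<^sub>R x"
    proof (rule ccontr)
      assume ne: "T x \<noteq> lam *\<^sub>R x"
      define z where "z = T x - lam *\<^sub>R x"
      define a where "a = z \<bullet> z"
      define q where "q = lam * a - z \<bullet> T z"
      have a: "a > 0" using ne by (simp add: a_def z_def)
      have zW: "z \<in> W" using xW less(2,3) by (auto simp: z_def intro!: subspace_diff subspace_scale)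
      have *: "0 \<le> - 2 * s * a + s\<^sup>2 * q" for s
      proof -
        have "x + s *\<^sub>R z \<in> W" using xW zW less(2) by (simp add: subspace_add subspace_scale)
        note max[OF this]
        moreover have "(x + s *\<^sub>R z) \<bullet> T (x + s *\<^sub>R z) = lam + 2 * s * (z \<bullet> T x) + s\<^sup>2 * (z \<bullet> T z)"
          using lin sa[of x z] by (simp add: linear_add linear_cmul inner_simps lam_def power2_eq_square inner_commute algebra_simps)
        moreover have "lam * ((x + s *\<^sub>R z) \<bullet> (x + s *\<^sub>R z)) = lam + 2 * s * (lam * (z \<bullet> x)) + s\<^sup>2 * (lam * a)"
          using nx by (simp add: inner_simps a_def power2_eq_square inner_commute algebra_simps)
        moreover have "z \<bullet> T x - lam * (z \<bullet> x) = a" by (simp add: a_def z_def inner_simps algebra_simps)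
        then have "z \<bullet> T x = a + lam * (z \<bullet> x)" by simp
        ultimately show ?thesis by (simp add: q_def algebra_simps)
      qed
      \<comment> \<open>For small \<open>s\<close> the linear term of the variation outweighs the quadratic one.\<close>
      define s where "s = a / (\<bar>q\<bar> + 1)"
      have s: "s > 0" using a by (simp add: s_def add_nonneg_pos)
      have "s * (\<bar>q\<bar> + 1) = a" by (simp add: s_def add_nonneg_pos less_imp_neq[symmetric])
      moreover have "s * q \<le> s * (\<bar>q\<bar> + 1)" using s by (intro mult_left_mono) auto
      ultimately have "s * q \<le> a" by simp
      then have "s * (s * q) \<le> s * a" using s by simp
      then have "- 2 * s * a + s\<^sup>2 * q \<le> - (s * a)" by (simp add: power2_eq_square algebra_simps)
      moreover have "s * a > 0" using s a by simp
      ultimately show False using *[of s] by linarith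
    qed
    define W' where "W' = {v \<in> W. x \<bullet> v = 0}"
    have sub': "subspace W'" using less(2) unfolding W'_def subspace_def by (auto simp: inner_simps)
    have "x \<notin> W'" "W' \<subseteq> W" using nx by (auto simp: W'_def)
    then have "W' \<subset> W" using xW by blast
    then have "dim W' < dim W"
      using sub' less(2) by (intro dim_psubset) (simp add: span_eq_iff[THEN iffD2])
    moreover have "T ` W' \<subseteq> W'"
    proof -
      have "x \<bullet> T v = 0" if "x \<bullet> v = 0" for v using sa[of x v] eig that by simp
      then show ?thesis using less(3) by (auto simp: W'_def)
    qed
    ultimately have ex: "\<exists>S. linear S \<and> (\<forall>v w. S v \<bullet> w = v \<bullet> S w) \<and> range S \<subseteq> W' \<and>
           (\<forall>v\<in>W'. S (S v) = T v \<and> sqrt c * (norm v)\<^sup>2 \<le> v \<bullet> S v)"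
      using less(1)[of W'] sub' by blast
    obtain S' where S': "linear S'" "\<And>v w. S' v \<bullet> w = v \<bullet> S' w" "\<And>v. S' v \<in> W'"
        "\<And>v. v \<in> W' \<Longrightarrow> S' (S' v) = T v" "\<And>v. v \<in> W' \<Longrightarrow> sqrt c * (norm v)\<^sup>2 \<le> v \<bullet> S' v"
      using ex by blast
    have xS': "x \<bullet> S' v = 0" for v using S'(3)[of v] by (simp add: W'_def)
    have S'x: "S' x = 0"
    proof -
      have "S' x \<bullet> S' x = x \<bullet> S' (S' x)" using S'(2) by simp
      then show ?thesis using xS' by simp
    qed
    define S where "S v = S' v + (sqrt lam * (x \<bullet> v)) *\<^sub>R x" for v
    have "linear S" unfolding S_def
      using S'(1) by (auto intro!: linearI simp: linear_add linear_cmul inner_simps algebra_simps)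
    moreover have "S v \<bullet> w = v \<bullet> S w" for v w
      using S'(2)[of v w] by (simp add: S_def inner_simps inner_commute algebra_simps)
    moreover have "range S \<subseteq> W"
      using S'(3) xW less(2) by (auto simp: S_def W'_def intro!: subspace_add subspace_scale)
    moreover have "S (S v) = T v \<and> sqrt c * (norm v)\<^sup>2 \<le> v \<bullet> S v" if v: "v \<in> W" for v
    proof
      define v' where "v' = v - (x \<bullet> v) *\<^sub>R x"
      have v': "v' \<in> W'" using v xW less(2) nx
        by (auto simp: v'_def W'_def inner_simps intro!: subspace_diff subspace_scale)
      have veq: "v = v' + (x \<bullet> v) *\<^sub>R x" by (simp add: v'_def)
      have S'v: "S' v = S' v'" using S'(1) S'x by (simp add: v'_def linear_diff linear_cmul)
      have "S (S v) = S' (S' v) + (sqrt lam * sqrt lam * (x \<bullet> v)) *\<^sub>R x"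
        using S'(1) S'x xS' nx by (simp add: S_def linear_add linear_cmul inner_simps)
      also have "\<dots> = T v' + (x \<bullet> v) *\<^sub>R T x"
        using lam0 S'(4)[OF v'] by (simp add: S'v eig)
      also have "\<dots> = T v" using linear_add[OF lin, of v' "(x \<bullet> v) *\<^sub>R x"] lin veq by (simp add: linear_cmul)
      finally show "S (S v) = T v" .
      have "v \<bullet> S v = v \<bullet> S' v' + sqrt lam * (x \<bullet> v)\<^sup>2"
        by (simp add: S_def S'v inner_simps power2_eq_square inner_commute)
      also have "v \<bullet> S' v' = v' \<bullet> S' v'" by (subst veq) (simp add: inner_simps xS')
      finally have 1: "v \<bullet> S v = v' \<bullet> S' v' + sqrt lam * (x \<bullet> v)\<^sup>2" .
      have "x \<bullet> v' = 0" using v' by (simp add: W'_def)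
      then have "(norm v)\<^sup>2 = (norm v')\<^sup>2 + (x \<bullet> v)\<^sup>2"
        unfolding power2_norm_eq_inner
        by (subst (1 2) veq) (simp add: inner_simps nx inner_commute power2_eq_square)
      moreover have "sqrt c * (x \<bullet> v)\<^sup>2 \<le> sqrt lam * (x \<bullet> v)\<^sup>2"
        using lam0 by (intro mult_right_mono) auto
      ultimately show "sqrt c * (norm v)\<^sup>2 \<le> v \<bullet> S v"
        using 1 S'(5)[OF v'] by (simp add: algebra_simps)
    qed
    ultimately show ?thesis by (intro exI[of _ S] conjI allI ballI) simp_all
  qed
qed

lemma selfadjoint_sqrt_exists:
  fixes T :: "'a::euclidean_space \<Rightarrow> 'a"
  assumes "linear T" "\<And>v w. T v \<bullet> w = v \<bullet> T w" "0 \<le> c" "\<And>v. c * (norm v)\<^sup>2 \<le> v \<bullet> T v"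
  obtains S where "linear S" "\<And>v w. S v \<bullet> w = v \<bullet> S w" "\<And>v. S (S v) = T v"
    "\<And>v. sqrt c * (norm v)\<^sup>2 \<le> v \<bullet> S v"
  using selfadjoint_sqrt_on_subspace[OF assms subspace_UNIV] by auto

text \<open>
  Both sides are the trace of \<open>S \<circ> D \<circ> D\<close>.
\<close>

lemma selfadjoint_trace_commute:
  fixes D S :: "'a::euclidean_space \<Rightarrow> 'a"
  assumes "\<And>v w. D v \<bullet> w = v \<bullet> D w" "\<And>v w. S v \<bullet> w = v \<bullet> S w"
  shows "(\<Sum>b\<in>Basis. D b \<bullet> D (S b)) = (\<Sum>b\<in>Basis. D b \<bullet> S (D b))"
proof -
  have "(\<Sum>b\<in>Basis. D b \<bullet> D (S b)) = (\<Sum>b\<in>Basis. \<Sum>c\<in>Basis. (D b \<bullet> c) * (D (S b) \<bullet> c))"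
    by (intro sum.cong refl euclidean_inner)
  also have "\<dots> = (\<Sum>c\<in>Basis. \<Sum>b\<in>Basis. (D c \<bullet> b) * (S (D c) \<bullet> b))"
  proof (subst sum.swap, intro sum.cong refl)
    fix b c
    show "(D b \<bullet> c) * (D (S b) \<bullet> c) = (D c \<bullet> b) * (S (D c) \<bullet> b)"
      using assms(1)[of b c] assms(1)[of "S b" c] assms(2)[of b "D c"] by (simp add: inner_commute)
  qed
  also have "\<dots> = (\<Sum>b\<in>Basis. D b \<bullet> S (D b))"
    by (intro sum.cong refl euclidean_inner[symmetric])
  finally show ?thesis .
qed

text \<open>
  With \<open>D = S1 - S2\<close> the difference of the squares is \<open>E = S1 \<circ> D + D \<circ> S2\<close>. Testing it against \<open>D\<close> in
  the trace inner product bounds \<open>2 * d * |D|\<^sup>2\<close> by \<open>\<langle>D, E\<rangle>\<close>, which is at most \<open>|D| * |E|\<close>.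
\<close>

lemma selfadjoint_sqrt_lipschitz:
  fixes S1 S2 :: "'a::euclidean_space \<Rightarrow> 'a"
  assumes "linear S1" "\<And>v w. S1 v \<bullet> w = v \<bullet> S1 w" "\<And>v. d * (norm v)\<^sup>2 \<le> v \<bullet> S1 v"
    and "linear S2" "\<And>v w. S2 v \<bullet> w = v \<bullet> S2 w" "\<And>v. d * (norm v)\<^sup>2 \<le> v \<bullet> S2 v" and d: "0 < d"
  shows "(\<Sum>b\<in>Basis. (norm (S1 b - S2 b))\<^sup>2) \<le> (\<Sum>b\<in>Basis. (norm (S1 (S1 b) - S2 (S2 b)))\<^sup>2) / (4 * d\<^sup>2)"
proof -
  define D where "D v = S1 v - S2 v" for v
  define E where "E v = S1 (S1 v) - S2 (S2 v)" for v
  have Dsa: "D v \<bullet> w = v \<bullet> D w" for v w by (simp add: D_def inner_simps assms)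
  have E: "E v = S1 (D v) + D (S2 v)" for v
    using assms by (simp add: E_def D_def linear_diff)
  have "2 * d * (\<Sum>b\<in>Basis. (norm (D b))\<^sup>2) = (\<Sum>b\<in>Basis. d * (norm (D b))\<^sup>2) + (\<Sum>b\<in>Basis. d * (norm (D b))\<^sup>2)"
    by (simp add: sum_distrib_left mult.assoc)
  also have "\<dots> \<le> (\<Sum>b\<in>Basis. D b \<bullet> S1 (D b)) + (\<Sum>b\<in>Basis. D b \<bullet> S2 (D b))"
    by (intro add_mono sum_mono assms)
  also have "\<dots> = (\<Sum>b\<in>Basis. D b \<bullet> E b)"
    using selfadjoint_trace_commute[of D S2, OF Dsa assms(5)]
    by (simp add: E inner_simps sum.distrib)
  also have "\<dots> \<le> (\<Sum>b\<in>Basis. d * (norm (D b))\<^sup>2 + (norm (E b))\<^sup>2 / (4 * d))"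
  proof (rule sum_mono)
    fix b
    have "0 \<le> (2 * d * norm (D b) - norm (E b))\<^sup>2 / (4 * d)" using d by simp
    also have "\<dots> = d * (norm (D b))\<^sup>2 + (norm (E b))\<^sup>2 / (4 * d) - norm (D b) * norm (E b)"
      using d by (simp add: power2_eq_square field_simps)
    finally show "D b \<bullet> E b \<le> d * (norm (D b))\<^sup>2 + (norm (E b))\<^sup>2 / (4 * d)"
      using norm_cauchy_schwarz[of "D b" "E b"] by simp
  qed
  finally have "d * (\<Sum>b\<in>Basis. (norm (D b))\<^sup>2) \<le> (\<Sum>b\<in>Basis. (norm (E b))\<^sup>2) / (4 * d)"
    by (simp add: sum.distrib sum_divide_distrib flip: sum_distrib_left)
  then have "(\<Sum>b\<in>Basis. (norm (D b))\<^sup>2) \<le> (\<Sum>b\<in>Basis. (norm (E b))\<^sup>2) / (4 * d) / d"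
    using d by (simp add: pos_le_divide_eq mult.commute)
  also have "\<dots> = (\<Sum>b\<in>Basis. (norm (E b))\<^sup>2) / (4 * d\<^sup>2)" by (simp add: power2_eq_square)
  finally show ?thesis by (simp add: D_def E_def)
qed

lemma has_real_derivative_line:
  fixes f :: "'a::real_normed_vector \<Rightarrow> real"
  assumes "(f has_derivative D) (at (q + a *\<^sub>R v))"
  shows "((\<lambda>a. f (q + a *\<^sub>R v)) has_real_derivative D v) (at a)"
proof -
  have "((\<lambda>a. q + a *\<^sub>R v) has_derivative (\<lambda>s. s *\<^sub>R v)) (at a)"
    by (auto intro!: derivative_eq_intros)
  from has_derivative_compose[OF this assms]
  have "((\<lambda>a. f (q + a *\<^sub>R v)) has_derivative (\<lambda>s. D (s *\<^sub>R v))) (at a)" .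
  moreover have "(\<lambda>s. D (s *\<^sub>R v)) = (*) (D v)"
    using linear_cmul[OF has_derivative_linear[OF assms]] by (auto simp: fun_eq_iff)
  ultimately show ?thesis by (simp add: has_field_derivative_def)
qed

lemma Ck_on_has_derivative_at:
  assumes "Ck_on (Suc k) S f" "x \<in> interior S"
  shows "(f has_derivative (\<lambda>v. dderiv_on S v f x)) (at x)"
  using Ck_on_SucD(1)[OF assms(1)] assms(2) at_within_interior interior_subset by (metis subsetD)

text \<open>
  Two applications of the mean value theorem, first along \<open>v\<close> and then along \<open>w\<close>. The left-hand side
  is symmetric in \<open>v\<close> and \<open>w\<close>, which yields the symmetry of second derivatives.
\<close>

lemma second_difference_mean_value:
  fixes f :: "'a::real_normed_vector \<Rightarrow> real"
  assumes C2: "Ck_on 2 U f" and U: "open U" "ball p r \<subseteq> U" and s: "0 < s" "s * (norm v + norm w) < r"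
  obtains q where "q \<in> ball p r"
    "f (p + s *\<^sub>R v + s *\<^sub>R w) - f (p + s *\<^sub>R v) - f (p + s *\<^sub>R w) + f p
       = s\<^sup>2 * dderiv_on U w (dderiv_on U v f) q"
proof -
  have near: "p + a *\<^sub>R v + b *\<^sub>R w \<in> ball p r" if "0 \<le> a" "a \<le> s" "0 \<le> b" "b \<le> s" for a b
  proof -
    have "norm (a *\<^sub>R v + b *\<^sub>R w) \<le> a * norm v + b * norm w"
      using that norm_triangle_ineq[of "a *\<^sub>R v" "b *\<^sub>R w"] by simp
    also have "\<dots> \<le> s * norm v + s * norm w" using that by (intro add_mono mult_right_mono) auto
    finally have "norm (a *\<^sub>R v + b *\<^sub>R w) < r" using s by (simp add: algebra_simps)
    moreover have "dist p (p + a *\<^sub>R v + b *\<^sub>R w) = norm (a *\<^sub>R v + b *\<^sub>R w)"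
      by (metis add.assoc add_diff_cancel_left' dist_commute dist_norm)
    ultimately show ?thesis by simp
  qed
  have inU: "p + a *\<^sub>R v + b *\<^sub>R w \<in> interior U" if "0 \<le> a" "a \<le> s" "0 \<le> b" "b \<le> s" for a b
    using near[OF that] U by (auto simp: interior_open)
  have C: "Ck_on (Suc (Suc 0)) U f" using C2 by (simp add: numeral_2_eq_2)
  define h where "h a = f (p + s *\<^sub>R w + a *\<^sub>R v) - f (p + a *\<^sub>R v)" for a
  have dh: "(h has_real_derivative dderiv_on U v f (p + s *\<^sub>R w + a *\<^sub>R v) - dderiv_on U v f (p + a *\<^sub>R v)) (at a)"
    if "0 \<le> a" "a \<le> s" for a
    unfolding h_def using inU[of a s] inU[of a 0] that s
    by (intro DERIV_diff has_real_derivative_line Ck_on_has_derivative_at[OF C]) (simp_all add: algebra_simps)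
  obtain a where a: "0 < a" "a < s"
      "h s - h 0 = s * (dderiv_on U v f (p + s *\<^sub>R w + a *\<^sub>R v) - dderiv_on U v f (p + a *\<^sub>R v))"
    using MVT2[OF s(1) dh] by auto
  have dk: "((\<lambda>b. dderiv_on U v f (p + a *\<^sub>R v + b *\<^sub>R w)) has_real_derivative
      dderiv_on U w (dderiv_on U v f) (p + a *\<^sub>R v + b *\<^sub>R w)) (at b)" if "0 \<le> b" "b \<le> s" for b
    using inU[of a b] that a by (intro has_real_derivative_line Ck_on_has_derivative_at[OF Ck_on_SucD(2)[OF C]]) auto
  obtain b where b: "0 < b" "b < s"
      "dderiv_on U v f (p + a *\<^sub>R v + s *\<^sub>R w) - dderiv_on U v f (p + a *\<^sub>R v + 0 *\<^sub>R w)
        = s * dderiv_on U w (dderiv_on U v f) (p + a *\<^sub>R v + b *\<^sub>R w)"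
    using MVT2[OF s(1) dk] by auto
  show ?thesis
  proof (rule that)
    show "p + a *\<^sub>R v + b *\<^sub>R w \<in> ball p r" using a b by (intro near) auto
    show "f (p + s *\<^sub>R v + s *\<^sub>R w) - f (p + s *\<^sub>R v) - f (p + s *\<^sub>R w) + f p
       = s\<^sup>2 * dderiv_on U w (dderiv_on U v f) (p + a *\<^sub>R v + b *\<^sub>R w)"
      using a(3) b(3) by (simp add: h_def algebra_simps power2_eq_square)
  qed
qed

lemma second_derivative_symmetric:
  fixes f :: "'a::real_normed_vector \<Rightarrow> real"
  assumes C2: "Ck_on 2 U f" and U: "open U" "p \<in> U"
  shows "dderiv_on U w (dderiv_on U v f) p = dderiv_on U v (dderiv_on U w f) p"
proof -
  have C: "Ck_on (Suc (Suc 0)) U f" using C2 by (simp add: numeral_2_eq_2)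
  let ?G = "\<lambda>v w. dderiv_on U w (dderiv_on U v f)"
  have cont: "continuous_on U (?G v w)" for v w
    using Ck_on_SucD(2)[OF Ck_on_SucD(2)[OF C]] by simp
  have near: "\<exists>d>0. \<forall>q\<in>ball p d. q \<in> U \<and> \<bar>?G v w q - ?G v w p\<bar> < e" if e: "e > 0" for v w e
  proof -
    have "\<forall>x\<in>U. \<forall>e>0. \<exists>d>0. \<forall>q\<in>U. dist q x < d \<longrightarrow> dist (?G v w q) (?G v w x) < e"
      using cont unfolding continuous_on_iff by blast
    then obtain d where d: "d > 0" "\<And>q. q \<in> U \<Longrightarrow> dist q p < d \<Longrightarrow> dist (?G v w q) (?G v w p) < e"
      using U(2) e by blast
    obtain r where r: "r > 0" "ball p r \<subseteq> U" using U by (meson open_contains_ball)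
    have "q \<in> U \<and> \<bar>?G v w q - ?G v w p\<bar> < e" if "q \<in> ball p (min d r)" for q
    proof -
      have "q \<in> ball p r" "dist q p < d" using that by (auto simp: dist_commute)
      then show ?thesis using d(2)[of q] r(2) by (auto simp: dist_real_def)
    qed
    then show ?thesis using d(1) r(1) by (intro exI[of _ "min d r"]) auto
  qed
  have "\<bar>?G v w p - ?G w v p\<bar> < e" if e: "e > 0" for e
  proof -
    obtain d1 where d1: "d1 > 0" "\<And>q. q \<in> ball p d1 \<Longrightarrow> q \<in> U \<and> \<bar>?G v w q - ?G v w p\<bar> < e / 2"
      using near[of "e/2", where v = v and w = w] e by auto
    obtain d2 where d2: "d2 > 0" "\<And>q. q \<in> ball p d2 \<Longrightarrow> q \<in> U \<and> \<bar>?G w v q - ?G w v p\<bar> < e / 2"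
      using near[of "e/2", where v = w and w = v] e by auto
    define r where "r = min d1 d2"
    define s where "s = r / (2 * (norm v + norm w + 1))"
    have r: "r > 0" "ball p r \<subseteq> U" using d1 d2 by (auto simp: r_def)
    have pos: "norm v + norm w + 1 > 0" by (simp add: add_nonneg_pos)
    have s: "s > 0" using r pos by (simp add: s_def)
    have "s * (norm v + norm w) \<le> s * (norm v + norm w + 1)" using s by (intro mult_left_mono) auto
    also have "\<dots> = r / 2" using pos by (simp add: s_def field_simps)
    finally have sr: "s * (norm v + norm w) < r" "s * (norm w + norm v) < r"
      using r by (auto simp: add.commute)
    obtain q1 where q1: "q1 \<in> ball p r"
      "f (p + s *\<^sub>R v + s *\<^sub>R w) - f (p + s *\<^sub>R v) - f (p + s *\<^sub>R w) + f p = s\<^sup>2 * ?G v w q1"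
      using second_difference_mean_value[OF C2 U(1) r(2) s sr(1)] by blast
    obtain q2 where q2: "q2 \<in> ball p r"
      "f (p + s *\<^sub>R w + s *\<^sub>R v) - f (p + s *\<^sub>R w) - f (p + s *\<^sub>R v) + f p = s\<^sup>2 * ?G w v q2"
      using second_difference_mean_value[OF C2 U(1) r(2) s sr(2)] by blast
    have comm: "p + s *\<^sub>R w + s *\<^sub>R v = p + s *\<^sub>R v + s *\<^sub>R w" by (simp add: algebra_simps)
    have "s\<^sup>2 * ?G v w q1 = s\<^sup>2 * ?G w v q2" using q1(2) q2(2)[unfolded comm] by linarith
    then have "?G v w q1 = ?G w v q2" using s by simp
    moreover have "q1 \<in> ball p d1" "q2 \<in> ball p d2" using q1(1) q2(1) by (auto simp: r_def)
    ultimately show ?thesis using d1(2)[of q1] d2(2)[of q2] by linarith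
  qed
  then have "\<not> \<bar>?G v w p - ?G w v p\<bar> > 0" by (metis less_irrefl)
  then show ?thesis by simp
qed


section \<open>Homogeneous functions and orthonormal frames\<close>

lemma dderiv_on_open_eq_UNIV:
  assumes "open U" "p \<in> U" shows "dderiv_on UNIV v f p = dderiv_on U v f p"
  by (simp add: dderiv_on_def at_within_open[OF assms(2,1)])

lemma D2_eq_dderiv_on:
  assumes "p \<noteq> 0"
  shows "D2 F p a b = dderiv_on (- {0}) (b, 0) (dderiv_on (- {0}) (a, 0) F) p"
proof -
  have U: "open (- {0::(real^'n) \<times> real})" by (simp add: open_Compl)
  have "D2 F p a b = dderiv_on (- {0}) (b, 0) (dderiv_on UNIV (a, 0) F) p"
    unfolding D2_def using assms by (intro dderiv_on_open_eq_UNIV U) auto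
  also have "\<dots> = dderiv_on (- {0}) (b, 0) (dderiv_on (- {0}) (a, 0) F) p"
    using assms by (intro dderiv_on_cong dderiv_on_open_eq_UNIV U) auto
  finally show ?thesis .
qed

text \<open>
  Differentiate \<open>f (c *\<^sub>R q) = g * f q\<close> with respect to \<open>q\<close>.
\<close>

lemma dderiv_on_homogeneous:
  fixes f :: "'a::real_normed_vector \<Rightarrow> real"
  assumes f: "f differentiable_on (- {0})" and h: "\<And>q. q \<noteq> 0 \<Longrightarrow> f (c *\<^sub>R q) = g * f q"
    and c: "0 < c" and p: "p \<noteq> 0"
  shows "c * dderiv_on (- {0}) v f (c *\<^sub>R p) = g * dderiv_on (- {0}) v f p"
proof -
  have U: "open (- {0::'a})" by (simp add: open_Compl)
  have at: "at q within - {0} = at q" if "q \<noteq> 0" for q :: 'a by (rule at_within_open[OF _ U]) (use that in simp)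
  have D: "(f has_derivative (\<lambda>v. dderiv_on (- {0}) v f q)) (at q)" if "q \<noteq> 0" for q
    using has_derivative_dderiv_on[OF f, of q] that at by simp
  have 1: "((\<lambda>q. f (c *\<^sub>R q)) has_derivative (\<lambda>v. dderiv_on (- {0}) (c *\<^sub>R v) f (c *\<^sub>R p))) (at p)"
    by (rule has_derivative_compose[where g = f and f = "\<lambda>q. c *\<^sub>R q"])
      (use D[of "c *\<^sub>R p"] c p in \<open>auto intro!: derivative_eq_intros\<close>)
  have 2: "((\<lambda>q. g * f q) has_derivative (\<lambda>v. g * dderiv_on (- {0}) v f p)) (at p)"
    using has_derivative_mult_right[OF D[OF p]] .
  have "((\<lambda>q. f (c *\<^sub>R q)) has_derivative (\<lambda>v. g * dderiv_on (- {0}) v f p)) (at p)"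
    by (rule has_derivative_transform_within_open[OF 2 U]) (use p h in auto)
  from has_derivative_unique[OF 1 this]
  have "dderiv_on (- {0}) (c *\<^sub>R v) f (c *\<^sub>R p) = g * dderiv_on (- {0}) v f p" by meson
  moreover have "dderiv_on (- {0}) (c *\<^sub>R v) f (c *\<^sub>R p) = c *\<^sub>R dderiv_on (- {0}) v f (c *\<^sub>R p)"
    using linear_cmul[OF has_derivative_linear[OF D[of "c *\<^sub>R p"]]] c p by auto
  ultimately show ?thesis by simp
qed

lemma normalize_lipschitz:
  fixes p q :: "'a::real_normed_vector"
  assumes "p \<noteq> 0" "q \<noteq> 0"
  shows "norm (sgn p - sgn q) \<le> 2 * norm (p - q) / norm p"
proof -
  have "norm p * norm (sgn p - sgn q) = norm (p - norm p *\<^sub>R sgn q)"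
  proof -
    have "norm p *\<^sub>R (sgn p - sgn q) = p - norm p *\<^sub>R sgn q"
      using assms by (simp add: scaleR_diff_right sgn_div_norm)
    then show ?thesis by (metis abs_norm_cancel norm_scaleR)
  qed
  also have "\<dots> \<le> norm (p - q) + norm (q - norm p *\<^sub>R sgn q)"
    using norm_triangle_ineq[of "p - q" "q - norm p *\<^sub>R sgn q"] by simp
  also have "q - norm p *\<^sub>R sgn q = (norm q - norm p) *\<^sub>R sgn q"
  proof -
    have "norm q *\<^sub>R sgn q = q" using assms by (simp add: sgn_div_norm)
    then show ?thesis by (simp add: scaleR_diff_left)
  qed
  also have "norm \<dots> \<le> norm (p - q)"
    using assms norm_triangle_ineq3[of q p] by (simp add: norm_sgn norm_minus_commute)
  finally show ?thesis using assms by (simp add: field_simps)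
qed

lemma bounded_on_sphere:
  fixes f :: "'a::euclidean_space \<Rightarrow> real"
  assumes "continuous_on (- {0}) f"
  obtains M where "0 \<le> M" "\<And>p. norm p = 1 \<Longrightarrow> \<bar>f p\<bar> \<le> M"
proof -
  have "compact (f ` sphere 0 1)"
    by (intro compact_continuous_image continuous_on_subset[OF assms]) auto
  then obtain M where "\<forall>y\<in>f ` sphere 0 1. norm y \<le> M" using compact_imp_bounded bounded_iff by blast
  then show ?thesis by (intro that[of "\<bar>M\<bar>"]) force+
qed

lemma homogeneous_0_bounded:
  fixes f :: "'a::euclidean_space \<Rightarrow> real"
  assumes "continuous_on (- {0}) f" "\<And>c p. 0 < c \<Longrightarrow> p \<noteq> 0 \<Longrightarrow> f (c *\<^sub>R p) = f p"
  obtains M where "0 \<le> M" "\<And>p. p \<noteq> 0 \<Longrightarrow> \<bar>f p\<bar> \<le> M"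
proof -
  obtain M where M: "0 \<le> M" "\<And>p. norm p = 1 \<Longrightarrow> \<bar>f p\<bar> \<le> M" using bounded_on_sphere[OF assms(1)] by blast
  show ?thesis
  proof (rule that[OF M(1)])
    fix p :: 'a assume p: "p \<noteq> 0"
    then have "f (sgn p) = f p" using assms(2)[of "inverse (norm p)" p] by (simp add: sgn_div_norm)
    then show "\<bar>f p\<bar> \<le> M" using M(2)[of "sgn p"] p by (simp add: norm_sgn)
  qed
qed

text \<open>
  The derivative of a function of degree zero has degree \<open>-1\<close>, so it is bounded by a multiple of
  \<open>1 / |p|\<close>, because it is bounded on the unit sphere. If \<open>q\<close> is closer to \<open>p\<close> than \<open>|p| / 2\<close>, the segment
  between them stays away from the origin and the mean value theorem applies. Otherwise the
  boundedness of \<open>f\<close> suffices.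
\<close>

lemma homogeneous_0_lipschitz:
  fixes f :: "'a::euclidean_space \<Rightarrow> real"
  assumes C1: "Ck_on 1 (- {0}) f" and h: "\<And>c p. 0 < c \<Longrightarrow> p \<noteq> 0 \<Longrightarrow> f (c *\<^sub>R p) = f p"
  obtains C where "0 \<le> C" "\<And>p q. p \<noteq> 0 \<Longrightarrow> q \<noteq> 0 \<Longrightarrow> \<bar>f p - f q\<bar> \<le> C * norm (p - q) / norm p"
proof -
  have C: "Ck_on (Suc 0) (- {0}) f" using C1 by simp
  have U: "open (- {0::'a})" by (simp add: open_Compl)
  have cont: "continuous_on (- {0}) (dderiv_on (- {0}) v f)" for v
    using Ck_on_SucD(2)[OF C] by simp
  obtain M where M: "0 \<le> M" "\<And>p. p \<noteq> 0 \<Longrightarrow> \<bar>f p\<bar> \<le> M"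
    using homogeneous_0_bounded[OF Ck_on_imp_continuous_on[OF C] h] by blast
  have "\<exists>M. 0 \<le> M \<and> (\<forall>p. norm p = 1 \<longrightarrow> \<bar>dderiv_on (- {0}) v f p\<bar> \<le> M)" for v
    using bounded_on_sphere[OF cont] by metis
  then obtain G where G: "\<And>v. 0 \<le> G v" "\<And>v p. norm p = 1 \<Longrightarrow> \<bar>dderiv_on (- {0}) v f p\<bar> \<le> G v"
    by metis
  define L where "L = (\<Sum>b\<in>Basis. G b)"
  have L0: "0 \<le> L" using G(1) by (auto simp: L_def intro: sum_nonneg)
  have der: "(f has_derivative (\<lambda>v. dderiv_on (- {0}) v f p)) (at p)" if "p \<noteq> 0" for p
    using Ck_on_has_derivative_at[OF C, of p] that U by (simp add: interior_open)
  have dbound: "\<bar>dderiv_on (- {0}) v f p\<bar> \<le> L / norm p * norm v" if p: "p \<noteq> 0" for p v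
  proof -
    have lin: "linear (\<lambda>v. dderiv_on (- {0}) v f p)" using has_derivative_linear[OF der[OF p]] .
    have "dderiv_on (- {0}) v f p = (\<Sum>b\<in>Basis. (v \<bullet> b) * dderiv_on (- {0}) b f p)"
      using Linear_Algebra.linear_componentwise[OF lin, of v 1] by simp
    then have "norm p * \<bar>dderiv_on (- {0}) v f p\<bar> \<le> norm p * (\<Sum>b\<in>Basis. \<bar>(v \<bullet> b) * dderiv_on (- {0}) b f p\<bar>)"
      by (auto intro!: mult_left_mono)
    also have "\<dots> = (\<Sum>b\<in>Basis. \<bar>v \<bullet> b\<bar> * (norm p * \<bar>dderiv_on (- {0}) b f p\<bar>))"
      by (simp add: sum_distrib_left abs_mult ac_simps)
    also have "\<dots> \<le> (\<Sum>b\<in>Basis. norm v * G b)"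
    proof (intro sum_mono mult_mono)
      fix b :: 'a assume b: "b \<in> Basis"
      show "\<bar>v \<bullet> b\<bar> \<le> norm v" using b by (simp add: Basis_le_norm)
      have "norm p * dderiv_on (- {0}) b f p = dderiv_on (- {0}) b f (sgn p)"
        using dderiv_on_homogeneous[of f "norm p" 1 "sgn p" b] C h p by (simp add: sgn_div_norm)
      then have "norm p * \<bar>dderiv_on (- {0}) b f p\<bar> = \<bar>dderiv_on (- {0}) b f (sgn p)\<bar>"
        by (metis abs_mult abs_norm_cancel)
      then show "norm p * \<bar>dderiv_on (- {0}) b f p\<bar> \<le> G b" using G(2)[of "sgn p" b] p by (simp add: norm_sgn)
    qed auto
    also have "\<dots> = L * norm v" by (simp add: L_def sum_distrib_left mult.commute)
    finally show ?thesis using p by (simp add: field_simps)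
  qed
  show ?thesis
  proof (rule that[of "2 * L + 4 * M"])
    show "0 \<le> 2 * L + 4 * M" using L0 M by simp
    fix p q :: 'a assume p: "p \<noteq> 0" and q: "q \<noteq> 0"
    show "\<bar>f p - f q\<bar> \<le> (2 * L + 4 * M) * norm (p - q) / norm p"
    proof (cases "norm (p - q) \<le> norm p / 2")
      case True
      have far: "norm p / 2 \<le> norm x" if "x \<in> closed_segment q p" for x
      proof -
        have "norm (p - x) \<le> norm (p - q)" using segment_bound(2)[OF that] by (simp add: norm_minus_commute)
        then show ?thesis using True norm_triangle_ineq2[of p "p - x"] by simp
      qed
      have "norm (f p - f q) \<le> (2 * L / norm p) * norm (p - q)"
      proof (rule differentiable_bound[OF convex_closed_segment[of q p]])
        fix x assume x: "x \<in> closed_segment q p"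
        have nx: "norm p / 2 \<le> norm x" "x \<noteq> 0" using far[OF x] p by auto
        show "(f has_derivative (\<lambda>v. dderiv_on (- {0}) v f x)) (at x within closed_segment q p)"
          using der[OF nx(2)] has_derivative_at_withinI by blast
        have "L / norm x \<le> L / (norm p / 2)" using nx p L0 by (intro divide_left_mono) auto
        then have "\<bar>dderiv_on (- {0}) v f x\<bar> \<le> (2 * L / norm p) * norm v" for v
          using order_trans[OF dbound[OF nx(2)] mult_right_mono[of "L / norm x" "2 * L / norm p" "norm v"]]
          by (simp add: mult.commute)
        then show "onorm (\<lambda>v. dderiv_on (- {0}) v f x) \<le> 2 * L / norm p"
          by (intro onorm_le) auto
      qed auto
      also have "\<dots> \<le> (2 * L + 4 * M) * norm (p - q) / norm p"
        using M by (simp add: divide_right_mono mult_right_mono)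
      finally show ?thesis by simp
    next
      case False
      then have "1 \<le> 2 * norm (p - q) / norm p" using p by (simp add: field_simps)
      then have "2 * M * 1 \<le> 2 * M * (2 * norm (p - q) / norm p)" using M by (intro mult_left_mono) auto
      also have "\<dots> \<le> (2 * L + 4 * M) * norm (p - q) / norm p"
        using L0 p by (simp add: field_simps)
      finally have "2 * M \<le> (2 * L + 4 * M) * norm (p - q) / norm p" by simp
      then show ?thesis using M(2)[OF p] M(2)[OF q] by linarith
    qed
  qed
qed

text \<open>
  Adapted bases and tangent frames prescribe the last vector. The additional prescribed vector \<open>a\<close> makes it
  possible to use the structure constants and the curvature bound in an arbitrary direction orthogonal
  to it; the case \<open>a = 0\<close> stands for no further prescription.
\<close>

lemma orthonormal_frame_extension:
  fixes p a :: "real^'n"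
  assumes p: "norm p = 1" and a: "a \<noteq> 0 \<Longrightarrow> norm a = 1 \<and> a \<bullet> p = 0"
  obtains \<phi> :: "nat \<Rightarrow> real^'n" where "orthonormal_frame CARD('n) \<phi>" "\<phi> CARD('n) = p"
    "a \<noteq> 0 \<Longrightarrow> \<phi> 1 = a \<and> 1 < CARD('n)"
proof -
  let ?n = "CARD('n)"
  define S where "S = insert p (if a = 0 then {} else {a})"
  have oS: "pairwise orthogonal S"
    using a by (auto simp: S_def pairwise_insert orthogonal_def inner_commute)
  obtain U where U: "U \<inter> insert 0 S = {}" "pairwise orthogonal (S \<union> U)"
      "span (S \<union> U) = span (S \<union> (UNIV :: (real^'n) set))"
    using orthogonal_extension_strong[OF oS] by blast
  define B where "B = S \<union> sgn ` U"
  have nS: "norm x = 1" if "x \<in> S" for x using that a p by (auto simp: S_def split: if_splits)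
  have n1: "norm x = 1" if "x \<in> B" for x
    using that nS U(1) by (auto simp: B_def norm_sgn)
  have oB: "pairwise orthogonal B"
  proof -
    have *: "sgn x = x" if "x \<in> S" for x using nS[OF that] by (simp add: sgn_div_norm)
    have "B = sgn ` (S \<union> U)" using * by (force simp: B_def image_Un)
    moreover have "pairwise orthogonal (sgn ` (S \<union> U))"
    proof (rule pairwiseI)
      fix v w assume "v \<in> sgn ` (S \<union> U)" "w \<in> sgn ` (S \<union> U)" "v \<noteq> w"
      then obtain x y where xy: "x \<in> S \<union> U" "y \<in> S \<union> U" "v = sgn x" "w = sgn y" "x \<noteq> y" by auto
      then have "x \<bullet> y = 0" using U(2) by (simp add: pairwise_def orthogonal_def)
      then show "orthogonal v w" by (simp add: xy orthogonal_def sgn_div_norm)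
    qed
    ultimately show ?thesis by simp
  qed
  have indep: "independent B" using oB n1 by (intro pairwise_orthogonal_independent) fastforce+
  have "span B = UNIV"
  proof -
    have "x \<in> span B" if "x \<in> S \<union> U" for x
    proof (cases "x \<in> S")
      case True then show ?thesis by (simp add: B_def span_base)
    next
      case False
      then have "x \<noteq> 0" "sgn x \<in> B" using that U(1) by (auto simp: B_def)
      then have "norm x *\<^sub>R sgn x \<in> span B" by (intro span_scale span_base)
      then show ?thesis using \<open>x \<noteq> 0\<close> by (simp add: sgn_div_norm)
    qed
    then have "span (S \<union> U) \<subseteq> span B" by (intro span_minimal) auto
    then show ?thesis using U(3) by auto
  qed
  then have cardB: "card B = ?n" using indep basis_card_eq_dim[of B UNIV] by simp
  have finB: "finite B" using indep by (rule independent_imp_finite)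
  have SB: "S \<subseteq> B" by (auto simp: B_def)
  have ap: "a \<noteq> p" if "a \<noteq> 0" using a[OF that] p by (auto simp: dot_square_norm)
  define k where "k = (if a = 0 then {?n} else {1, ?n})"
  have n2: "1 < ?n" if "a \<noteq> 0"
  proof -
    have "card S \<le> card B" using SB finB by (rule card_mono[rotated])
    then show ?thesis using that ap cardB by (simp add: S_def split: if_splits)
  qed
  have "card (B - S) = card ({1..?n} - k)"
  proof -
    have "card S = card k" using n2 ap by (auto simp: S_def k_def)
    moreover have "k \<subseteq> {1..?n}" by (auto simp: k_def Suc_le_eq)
    ultimately show ?thesis using SB finB cardB
      by (simp add: card_Diff_subset finite_subset)
  qed
  then obtain h where h: "bij_betw h ({1..?n} - k) (B - S)"
    using finB finite_same_card_bij[of "{1..?n} - k" "B - S"] by auto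
  define \<phi> where "\<phi> i = (if i = ?n then p else if i = 1 \<and> a \<noteq> 0 then a else h i)" for i
  have hB: "h i \<in> B - S" if "i \<in> {1..?n} - k" for i using h that by (auto simp: bij_betw_def)
  have hinj: "inj_on h ({1..?n} - k)" using h by (simp add: bij_betw_def)
  have \<phi>B: "\<phi> i \<in> B" if "i \<in> {1..?n}" for i
    using hB[of i] that SB by (auto simp: \<phi>_def k_def S_def split: if_splits)
  have "inj_on \<phi> {1..?n}"
  proof (rule inj_onI)
    fix i j assume ij: "i \<in> {1..?n}" "j \<in> {1..?n}" "\<phi> i = \<phi> j"
    have in_k: "\<phi> l \<in> S" if "l \<in> k" for l using that by (auto simp: \<phi>_def k_def S_def split: if_splits)
    have out_k: "\<phi> l = h l" if "l \<notin> k" for l using that by (auto simp: \<phi>_def k_def split: if_splits)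
    show "i = j"
    proof (cases "i \<in> k"; cases "j \<in> k")
      assume "i \<in> k" "j \<in> k"
      then show ?thesis using ij ap by (auto simp: \<phi>_def k_def split: if_splits)
    next
      assume "i \<in> k" "j \<notin> k"
      then show ?thesis using ij hB[of j] in_k out_k by force
    next
      assume "i \<notin> k" "j \<in> k"
      then show ?thesis using ij hB[of i] in_k out_k by force
    next
      assume "i \<notin> k" "j \<notin> k"
      then show ?thesis using ij out_k inj_onD[OF hinj, of i j] by auto
    qed
  qed
  then have "orthonormal_frame ?n \<phi>"
    using oB \<phi>B n1 unfolding orthonormal_frame_def pairwise_def orthogonal_def
    by (metis (no_types, lifting) inj_on_eq_iff norm_eq_1)
  then show ?thesis by (rule that) (use n2 in \<open>auto simp: \<phi>_def\<close>)
qed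


section \<open>The coefficient matrix of an anisotropy\<close>

text \<open>
  The Hessian of \<open>F\<close>, multiplied by \<open>|p|\<close> to make it homogeneous of degree zero in \<open>p\<close>, on all of
  \<open>\<real>\<^sup>n\<^sup>+\<^sup>1\<close>. On horizontal vectors it is \<open>tau\<close>.
\<close>

definition anisotropy_form :: "('a::real_inner \<Rightarrow> real) \<Rightarrow> 'a \<Rightarrow> 'a \<Rightarrow> 'a \<Rightarrow> real" where
  "anisotropy_form F p v w = norm p * dderiv_on (- {0}) w (dderiv_on (- {0}) v F) p"

text \<open>
  The last but one property is the differentiated Euler relation: first derivatives of \<open>F\<close> are constant on
  rays.
\<close>

lemma
  fixes F :: "'a::euclidean_space \<Rightarrow> real"
  assumes smooth: "smooth_on (- {0}) F" and hom: "\<And>c p. 0 \<le> c \<Longrightarrow> F (c *\<^sub>R p) = c * F p"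
  shows linear_anisotropy_form: "p \<noteq> 0 \<Longrightarrow> linear (anisotropy_form F p v)"
    and anisotropy_form_commute: "p \<noteq> 0 \<Longrightarrow> anisotropy_form F p v w = anisotropy_form F p w v"
    and anisotropy_form_scale: "0 < c \<Longrightarrow> p \<noteq> 0 \<Longrightarrow> anisotropy_form F (c *\<^sub>R p) v w = anisotropy_form F p v w"
    and anisotropy_form_radial: "p \<noteq> 0 \<Longrightarrow> anisotropy_form F p v p = 0"
    and C1_anisotropy_form: "Ck_on 1 (- {0}) (\<lambda>p. anisotropy_form F p v w)"
proof -
  let ?U = "- {0::'a}"
  have U: "open ?U" by (simp add: open_Compl)
  have cone: "cone_condition ?U" using U by (rule cone_condition_open)
  have C: "Ck_on (Suc (Suc (Suc 0))) ?U F" using smooth by (auto simp: smooth_on_def)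
  have int: "p \<in> interior ?U" if "p \<noteq> 0" for p :: 'a using that U by (simp add: interior_open)
  note C1 = Ck_on_SucD(2)[OF C] and C2 = Ck_on_SucD(2)[OF Ck_on_SucD(2)[OF C]]
  have D2: "(dderiv_on ?U v F has_derivative (\<lambda>w. dderiv_on ?U w (dderiv_on ?U v F) p)) (at p)"
    if "p \<noteq> 0" for p v using Ck_on_has_derivative_at[OF C1 int[OF that]] .
  show "linear (anisotropy_form F p v)" if p: "p \<noteq> 0" for p v
    using linear_compose_scale_right[OF has_derivative_linear[OF D2[OF p, of v]], of "norm p"]
    by (simp add: anisotropy_form_def[abs_def])
  show "anisotropy_form F p v w = anisotropy_form F p w v" if p: "p \<noteq> 0" for p v w
    using second_derivative_symmetric[of ?U F p w v] Ck_on_Suc_imp[OF C] U p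
    by (simp add: anisotropy_form_def numeral_2_eq_2)
  have dh: "dderiv_on ?U v F (c *\<^sub>R p) = dderiv_on ?U v F p" if "0 < c" "p \<noteq> 0" for c p v
    using dderiv_on_homogeneous[of F c c p v] C hom that by simp
  show "anisotropy_form F (c *\<^sub>R p) v w = anisotropy_form F p v w" if c: "0 < c" and p: "p \<noteq> 0" for c p v w
    using dderiv_on_homogeneous[of "dderiv_on ?U v F" c 1 p w] C1[of v] dh that
    by (simp add: anisotropy_form_def)
  show "anisotropy_form F p v p = 0" if p: "p \<noteq> 0" for p v
  proof -
    have 1: "((\<lambda>s. dderiv_on ?U v F (p + s *\<^sub>R p)) has_real_derivative dderiv_on ?U p (dderiv_on ?U v F) p) (at 0)"
      using D2[OF p] by (intro has_real_derivative_line) simp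
    have "((\<lambda>s. dderiv_on ?U v F (p + s *\<^sub>R p)) has_real_derivative 0) (at 0)"
    proof (rule has_field_derivative_transform_within_open[OF DERIV_const[of "dderiv_on ?U v F p"]])
      fix s :: real assume "s \<in> {-1<..}"
      then show "dderiv_on ?U v F p = dderiv_on ?U v F (p + s *\<^sub>R p)"
        using dh[of "1 + s" p v] p by (simp add: scaleR_add_left)
    qed auto
    then have "dderiv_on ?U p (dderiv_on ?U v F) p = 0" using DERIV_unique[OF 1] by simp
    then show ?thesis by (simp add: anisotropy_form_def)
  qed
  show "Ck_on 1 ?U (\<lambda>p. anisotropy_form F p v w)" for v w
  proof -
    have "Ck_on 1 ?U (\<lambda>p. (\<Sum>b\<in>Basis. (p \<bullet> b) * (p \<bullet> b)) powr (1 / 2))"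
      by (intro Ck_on_powr cone Ck_on_sum Ck_on_mult Ck_on_bounded_linear bounded_linear_inner_left)
        (auto simp flip: euclidean_inner)
    also have "(\<lambda>p. (\<Sum>b\<in>Basis. (p \<bullet> b) * (p \<bullet> b)) powr (1 / 2)) = (norm :: 'a \<Rightarrow> real)"
      by (simp add: norm_eq_sqrt_inner powr_half_sqrt fun_eq_iff flip: euclidean_inner)
    finally show ?thesis
      unfolding anisotropy_form_def using C2 by (intro Ck_on_mult cone) auto
  qed
qed

text \<open>
  The form completed by the projection onto the ray through \<open>p\<close>, which removes its kernel, is still
  homogeneous of degree zero and continuously differentiable.
\<close>

lemma completed_form_lipschitz:
  fixes F :: "'a::euclidean_space \<Rightarrow> real"
  assumes smooth: "smooth_on (- {0}) F" and hom: "\<And>c p. 0 \<le> c \<Longrightarrow> F (c *\<^sub>R p) = c * F p"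
  obtains C M where "0 \<le> C" "0 \<le> M"
    "\<And>p q. p \<noteq> 0 \<Longrightarrow> q \<noteq> 0 \<Longrightarrow>
       \<bar>(anisotropy_form F p v w + (sgn p \<bullet> v) * (sgn p \<bullet> w)) -
        (anisotropy_form F q v w + (sgn q \<bullet> v) * (sgn q \<bullet> w))\<bar> \<le> C * norm (p - q) / norm p"
    "\<And>p. p \<noteq> 0 \<Longrightarrow> \<bar>anisotropy_form F p v w + (sgn p \<bullet> v) * (sgn p \<bullet> w)\<bar> \<le> M"
proof -
  let ?U = "- {0::'a}"
  let ?H = "\<lambda>p. anisotropy_form F p v w + (sgn p \<bullet> v) * (sgn p \<bullet> w)"
  have U: "open ?U" by (simp add: open_Compl)
  have cone: "cone_condition ?U" using U by (rule cone_condition_open)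
  have "Ck_on 1 ?U (\<lambda>p. anisotropy_form F p v w +
      (\<Sum>b\<in>Basis. (p \<bullet> b) * (p \<bullet> b)) powr (- 1) * ((p \<bullet> v) * (p \<bullet> w)))"
    by (intro Ck_on_powr cone Ck_on_add Ck_on_sum Ck_on_mult Ck_on_bounded_linear bounded_linear_inner_left
        C1_anisotropy_form[OF assms]) (auto simp flip: euclidean_inner)
  moreover have "(\<Sum>b\<in>Basis. (p \<bullet> b) * (p \<bullet> b)) powr (- 1) * ((p \<bullet> v) * (p \<bullet> w))
      = (sgn p \<bullet> v) * (sgn p \<bullet> w)" for p
    by (simp add: sgn_div_norm powr_minus dot_square_norm power2_eq_square flip: euclidean_inner)
  ultimately have C1: "Ck_on 1 ?U ?H" by simp
  have h: "?H (c *\<^sub>R p) = ?H p" if "0 < c" "p \<noteq> 0" for c p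
    using that anisotropy_form_scale[OF assms that] by (simp add: sgn_scaleR)
  obtain C where C: "0 \<le> C" "\<And>p q. p \<noteq> 0 \<Longrightarrow> q \<noteq> 0 \<Longrightarrow> \<bar>?H p - ?H q\<bar> \<le> C * norm (p - q) / norm p"
    using homogeneous_0_lipschitz[OF C1 h] by blast
  obtain M where M: "0 \<le> M" "\<And>p. p \<noteq> 0 \<Longrightarrow> \<bar>?H p\<bar> \<le> M"
    using homogeneous_0_bounded[OF Ck_on_imp_continuous_on[OF C1] h] by blast
  show ?thesis by (rule that[OF C(1) M(1) C(2) M(2)])
qed

lemma tau_eq_anisotropy_form: "tau F p' a b = anisotropy_form F (p', -1) (a, 0) (b, 0)"
  by (simp add: tau_def anisotropy_form_def D2_eq_dderiv_on zero_prod_def)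

text \<open>
  Every unit vector orthogonal to \<open>p\<close> belongs to some adapted basis, so the bounds on the diagonal
  entries are bounds on the quadratic form.
\<close>

lemma tau_lower_bounds:
  fixes F :: "(real^'n) \<times> real \<Rightarrow> real"
  assumes tb: "tau_bounds F c\<^sub>1 c\<^sub>2 c\<^sub>3" and p: "p \<noteq> 0"
  shows "c\<^sub>1 / (norm (p, -1::real))\<^sup>2 \<le> tau F p (sgn p) (sgn p)"
    and "norm a = 1 \<Longrightarrow> a \<bullet> p = 0 \<Longrightarrow> c\<^sub>1 \<le> tau F p a a"
    and "norm a = 1 \<Longrightarrow> a \<bullet> p = 0 \<Longrightarrow> \<bar>tau F p a (sgn p)\<bar> \<le> c\<^sub>2 / (norm (p, -1::real))\<^sup>2"
proof -
  have sg: "(1 / norm p) *\<^sub>R p = sgn p" by (simp add: sgn_div_norm divide_inverse)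
  have n1: "norm (sgn p) = 1" using p by (simp add: norm_sgn)
  obtain \<phi> where \<phi>: "orthonormal_frame CARD('n) \<phi>" "\<phi> CARD('n) = sgn p"
    using orthonormal_frame_extension[OF n1, of 0] by blast
  show "c\<^sub>1 / (norm (p, -1::real))\<^sup>2 \<le> tau F p (sgn p) (sgn p)"
    using tb[unfolded tau_bounds_def, rule_format, of p \<phi>] p \<phi>
    by (auto simp: Let_def adapted_basis_def sg)
  show "c\<^sub>1 \<le> tau F p a a" "\<bar>tau F p a (sgn p)\<bar> \<le> c\<^sub>2 / (norm (p, -1::real))\<^sup>2"
    if a: "norm a = 1" "a \<bullet> p = 0"
  proof -
    have "norm a = 1 \<and> a \<bullet> sgn p = 0" using a by (simp add: sgn_div_norm)
    then obtain \<psi> where \<psi>: "orthonormal_frame CARD('n) \<psi>" "\<psi> CARD('n) = sgn p"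
        "\<psi> 1 = a" "1 < CARD('n)"
      using orthonormal_frame_extension[OF n1, of a] a(1) by (metis norm_zero zero_neq_one)
    have "1 \<in> {1..CARD('n) - 1}" using \<psi>(4) by auto
    then show "c\<^sub>1 \<le> tau F p a a" "\<bar>tau F p a (sgn p)\<bar> \<le> c\<^sub>2 / (norm (p, -1::real))\<^sup>2"
      using tb[unfolded tau_bounds_def, rule_format, of p \<psi>] p \<psi>
      by (auto simp: Let_def adapted_basis_def sg)
  qed
qed

text \<open>
  Subtracting the multiple of \<open>(p, -1)\<close> with the same last coordinate turns \<open>v\<close> into a horizontal vector
  \<open>\<xi>\<close> without changing the form. If \<open>\<xi>\<close> is split into a part \<open>a\<close> orthogonal to \<open>p\<close> and a multiple \<open>t\<close> of
  the unit vector along \<open>p\<close>, the part of \<open>v\<close> orthogonal to \<open>(p, -1)\<close> has squared length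
  \<open>|a|\<^sup>2 + t\<^sup>2 / |(p, -1)|\<^sup>2\<close>. The diagonal bounds control exactly this quantity, and the mixed term is absorbed
  because \<open>2 * c\<^sub>2 \<le> c\<^sub>1\<close>.
\<close>

lemma completed_form_coercive:
  fixes F :: "(real^'n) \<times> real \<Rightarrow> real"
  assumes adm: "admissible_anisotropy F" and tb: "tau_bounds F c\<^sub>1 c\<^sub>2 c\<^sub>3"
    and c: "0 < c\<^sub>1" "0 < c\<^sub>2" "2 * c\<^sub>2 \<le> c\<^sub>1" and p: "p \<noteq> 0"
  shows "min (c\<^sub>1 / 2) 1 * (norm v)\<^sup>2 \<le> anisotropy_form F (p, -1) v v + (sgn (p, -1::real) \<bullet> v)\<^sup>2"
proof -
  define P where "P = norm (p, -1::real)"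
  have P2: "P\<^sup>2 = (norm p)\<^sup>2 + 1" by (simp add: P_def norm_Pair)
  have P1: "1 \<le> P" using P2 by (smt (verit) P_def norm_ge_zero one_power2 power2_le_imp_le zero_le_power2)
  have F: "smooth_on (- {0}) F" "\<And>c p. 0 \<le> c \<Longrightarrow> F (c *\<^sub>R p) = c * F p"
    using adm by (auto simp: admissible_anisotropy_def)
  have p0: "(p, -1::real) \<noteq> 0" by (simp add: zero_prod_def)
  let ?B = "anisotropy_form F (p, -1)"
  note lin = linear_anisotropy_form[OF F p0] and com = anisotropy_form_commute[OF F p0]
    and rad = anisotropy_form_radial[OF F p0]
  define \<xi> where "\<xi> = fst v + snd v *\<^sub>R p"
  have v: "v = (\<xi>, 0) - snd v *\<^sub>R (p, -1)" by (simp add: \<xi>_def prod_eq_iff)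
  have Bv: "?B w v = ?B w (\<xi>, 0)" for w
    by (subst v) (simp add: linear_diff[OF lin] linear_cmul[OF lin] rad del: scaleR_Pair)
  have BB: "?B v v = tau F p \<xi> \<xi>"
    using Bv[of v] com[of v "(\<xi>, 0)"] Bv[of "(\<xi>, 0)"] by (simp add: tau_eq_anisotropy_form)
  define t where "t = \<xi> \<bullet> sgn p"
  define a where "a = \<xi> - t *\<^sub>R sgn p"
  have e1: "sgn p \<bullet> sgn p = 1" using p by (simp add: dot_square_norm norm_sgn)
  have ae: "a \<bullet> sgn p = 0" by (simp add: a_def t_def inner_simps e1)
  have pe: "p = norm p *\<^sub>R sgn p" using p by (simp add: sgn_div_norm)
  have ap: "a \<bullet> p = 0" by (subst pe) (simp add: ae)
  have \<xi>: "\<xi> = a + t *\<^sub>R sgn p" by (simp add: a_def)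
  have tlin: "linear (tau F p x)" for x
    using linear_compose[of "\<lambda>y. (y, 0::real)" "?B (x, 0)"] lin[of "(x, 0)"]
    by (simp add: tau_eq_anisotropy_form[abs_def] o_def linear_iff)
  have tcom: "tau F p x y = tau F p y x" for x y using com by (simp add: tau_eq_anisotropy_form)
  have texp: "tau F p \<xi> \<xi> = tau F p a a + 2 * t * tau F p a (sgn p) + t\<^sup>2 * tau F p (sgn p) (sgn p)"
  proof -
    have "tau F p x \<xi> = tau F p x a + t * tau F p x (sgn p)" for x
      unfolding \<xi> by (simp add: linear_add[OF tlin] linear_cmul[OF tlin])
    then show ?thesis
      using tcom[of \<xi> a] tcom[of \<xi> "sgn p"] tcom[of a "sgn p"] by (simp add: power2_eq_square algebra_simps)
  qed
  have taa: "c\<^sub>1 * (norm a)\<^sup>2 \<le> tau F p a a \<and> \<bar>tau F p a (sgn p)\<bar> \<le> norm a * c\<^sub>2 / P\<^sup>2"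
  proof (cases "a = 0")
    case True
    then show ?thesis using linear_0[OF tlin] tcom[of 0 "sgn p"] by simp
  next
    case False
    have a: "a = norm a *\<^sub>R sgn a" using False by (simp add: sgn_div_norm)
    have sa: "norm (sgn a) = 1" "sgn a \<bullet> p = 0" using False ap by (auto simp: norm_sgn) (simp add: sgn_div_norm)
    have tx: "tau F p x a = norm a * tau F p x (sgn a)" for x
      by (subst a) (simp only: linear_cmul[OF tlin] real_scaleR_def)
    have "tau F p a a = (norm a)\<^sup>2 * tau F p (sgn a) (sgn a)"
      using tx[of a] tx[of "sgn a"] tcom[of a "sgn a"] by (simp add: power2_eq_square)
    moreover have "tau F p a (sgn p) = norm a * tau F p (sgn a) (sgn p)"
      using tx[of "sgn p"] tcom by metis
    moreover have "(norm a)\<^sup>2 * c\<^sub>1 \<le> (norm a)\<^sup>2 * tau F p (sgn a) (sgn a)"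
      using tau_lower_bounds(2)[OF tb p sa] by (intro mult_left_mono) auto
    moreover have "norm a * \<bar>tau F p (sgn a) (sgn p)\<bar> \<le> norm a * (c\<^sub>2 / P\<^sup>2)"
      using tau_lower_bounds(3)[OF tb p sa] by (intro mult_left_mono) (auto simp: P_def)
    ultimately show ?thesis by (simp add: abs_mult mult.commute)
  qed
  define y where "y = \<bar>t\<bar> / P"
  have yP: "y\<^sup>2 = t\<^sup>2 / P\<^sup>2" by (simp add: y_def power_divide)
  \<comment> \<open>One factor \<open>1 / P\<close> of the mixed bound turns \<open>t\<close> into \<open>y\<close>, and the other one is at most \<open>1\<close>.\<close>
  have cross: "\<bar>2 * t * tau F p a (sgn p)\<bar> \<le> c\<^sub>1 * (norm a * y)"
  proof -
    have "\<bar>2 * t * tau F p a (sgn p)\<bar> \<le> 2 * \<bar>t\<bar> * (norm a * c\<^sub>2 / P\<^sup>2)"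
      using mult_left_mono[OF conjunct2[OF taa], of "2 * \<bar>t\<bar>"] by (simp add: abs_mult)
    also have "\<dots> = (2 * c\<^sub>2) * (norm a * y) * (1 / P)" by (simp add: y_def power2_eq_square)
    also have "\<dots> \<le> c\<^sub>1 * (norm a * y) * 1"
      using c P1 by (intro mult_mono) (auto simp: y_def intro!: mult_right_mono)
    finally show ?thesis by simp
  qed
  have tt: "c\<^sub>1 * y\<^sup>2 \<le> t\<^sup>2 * tau F p (sgn p) (sgn p)"
    using mult_left_mono[OF tau_lower_bounds(1)[OF tb p], of "t\<^sup>2"] by (simp add: yP P_def mult.commute)
  have "norm a * y \<le> ((norm a)\<^sup>2 + y\<^sup>2) / 2"
    using sum_squares_bound[of "norm a" y] by simp
  then have "c\<^sub>1 * (norm a * y) \<le> c\<^sub>1 * (((norm a)\<^sup>2 + y\<^sup>2) / 2)" using c by simp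
  moreover have "c\<^sub>1 * (((norm a)\<^sup>2 + y\<^sup>2) / 2) = c\<^sub>1 * (norm a)\<^sup>2 + c\<^sub>1 * y\<^sup>2 - c\<^sub>1 / 2 * ((norm a)\<^sup>2 + y\<^sup>2)"
    by (simp add: algebra_simps)
  ultimately have lower: "c\<^sub>1 / 2 * ((norm a)\<^sup>2 + y\<^sup>2) \<le> ?B v v"
    using taa tt cross unfolding BB texp by linarith
  have nv: "(norm v)\<^sup>2 = (norm a)\<^sup>2 + y\<^sup>2 + (sgn (p, -1::real) \<bullet> v)\<^sup>2"
  proof -
    define m where "m = norm p"
    define s where "s = snd v"
    have xp: "\<xi> \<bullet> p = t * m"
    proof -
      have "\<xi> \<bullet> p = \<xi> \<bullet> (norm p *\<^sub>R sgn p)" using pe by simp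
      then show ?thesis by (simp add: t_def m_def)
    qed
    have n\<xi>: "\<xi> \<bullet> \<xi> = (norm a)\<^sup>2 + t\<^sup>2"
      unfolding \<xi> power2_norm_eq_inner using ae e1
      by (simp add: inner_simps inner_commute power2_eq_square)
    have pv: "(p, -1::real) \<bullet> v = t * m - s * P\<^sup>2"
      by (subst v) (simp add: inner_diff_right s_def xp inner_commute P2 dot_square_norm m_def algebra_simps)
    have v2: "v = (\<xi> - s *\<^sub>R p, s)" by (simp add: s_def \<xi>_def)
    have "(norm v)\<^sup>2 = (\<xi> - s *\<^sub>R p) \<bullet> (\<xi> - s *\<^sub>R p) + s * s"
      unfolding power2_norm_eq_inner by (subst (1 2) v2) (simp only: inner_Pair inner_real_def)
    also have "\<dots> = \<xi> \<bullet> \<xi> - 2 * s * (\<xi> \<bullet> p) + s\<^sup>2 * P\<^sup>2"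
      by (simp add: inner_diff_left inner_diff_right inner_commute P2 power2_norm_eq_inner power2_eq_square[of s] algebra_simps)
    finally have "(norm v)\<^sup>2 = \<xi> \<bullet> \<xi> - 2 * s * (\<xi> \<bullet> p) + s\<^sup>2 * P\<^sup>2" .
    moreover have "(sgn (p, -1::real) \<bullet> v)\<^sup>2 = (t * m - s * P\<^sup>2)\<^sup>2 / P\<^sup>2"
      by (simp add: sgn_div_norm inner_scaleR_left pv P_def[symmetric] power_mult_distrib divide_inverse power_inverse del: scaleR_Pair inner_Pair)
    moreover have "(t * m - s * P\<^sup>2)\<^sup>2 / P\<^sup>2 = t\<^sup>2 - y\<^sup>2 - 2 * s * (t * m) + s\<^sup>2 * P\<^sup>2"
    proof -
      have "P \<noteq> 0" using P1 by auto
      have "(t * m - s * P\<^sup>2)\<^sup>2 = t\<^sup>2 * m\<^sup>2 - 2 * s * (t * m) * P\<^sup>2 + s\<^sup>2 * P\<^sup>2 * P\<^sup>2"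
        by (simp add: power2_eq_square algebra_simps)
      also have "t\<^sup>2 * m\<^sup>2 = t\<^sup>2 * P\<^sup>2 - t\<^sup>2" by (simp add: P2 m_def algebra_simps)
      finally show ?thesis using \<open>P \<noteq> 0\<close> by (simp add: yP divide_simps)
    qed
    ultimately show ?thesis by (simp add: n\<xi> xp)
  qed
  have "min (c\<^sub>1 / 2) 1 * ((norm a)\<^sup>2 + y\<^sup>2) \<le> c\<^sub>1 / 2 * ((norm a)\<^sup>2 + y\<^sup>2)"
    by (intro mult_right_mono) auto
  moreover have "min (c\<^sub>1 / 2) 1 * (sgn (p, -1::real) \<bullet> v)\<^sup>2 \<le> 1 * (sgn (p, -1::real) \<bullet> v)\<^sup>2"
    by (intro mult_right_mono) auto
  ultimately show ?thesis using lower unfolding nv by (simp add: distrib_left)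
qed

text \<open>
  Let \<open>S\<close> be the square root of the completed form at \<open>(p, -1)\<close>. The form itself is obtained by projecting
  along \<open>e\<close>, the direction of \<open>(p, -1)\<close>, so \<open>\<sigma> p b\<close> is the horizontal part of the projection of \<open>S b\<close>. Projection and square root
  are Lipschitz in \<open>p\<close> with constants of order \<open>1 / |p|\<close>.
\<close>

lemma anisotropy_factorization:
  fixes F :: "(real^'n) \<times> real \<Rightarrow> real"
  assumes adm: "admissible_anisotropy F" and tb: "tau_bounds F c\<^sub>1 c\<^sub>2 c\<^sub>3"
    and c: "0 < c\<^sub>1" "0 < c\<^sub>2" "2 * c\<^sub>2 \<le> c\<^sub>1"
  obtains \<sigma> :: "real^'n \<Rightarrow> (real^'n) \<times> real \<Rightarrow> real^'n" and K \<Lambda> where "0 \<le> K" "0 \<le> \<Lambda>"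
    "\<And>p a a'. p \<noteq> 0 \<Longrightarrow> tau F p a a' = (\<Sum>b\<in>Basis. (\<sigma> p b \<bullet> a) * (\<sigma> p b \<bullet> a'))"
    "\<And>p q b. p \<noteq> 0 \<Longrightarrow> q \<noteq> 0 \<Longrightarrow> b \<in> Basis \<Longrightarrow> norm (\<sigma> p b - \<sigma> q b) \<le> K * norm (p - q) / norm p"
    "\<And>p b. p \<noteq> 0 \<Longrightarrow> b \<in> Basis \<Longrightarrow> norm (\<sigma> p b) \<le> \<Lambda>"
proof -
  have F: "smooth_on (- {0}) F" "\<And>c p. 0 \<le> c \<Longrightarrow> F (c *\<^sub>R p) = c * F p"
    using adm by (auto simp: admissible_anisotropy_def)
  define up where "up p = (p, -1::real)" for p :: "real^'n"
  have up0: "up p \<noteq> 0" for p by (simp add: up_def zero_prod_def)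
  define H where "H p v w = anisotropy_form F p v w + (sgn p \<bullet> v) * (sgn p \<bullet> w)" for p v w
  have "\<exists>C M. 0 \<le> C \<and> 0 \<le> M \<and>
      (\<forall>p q. p \<noteq> 0 \<longrightarrow> q \<noteq> 0 \<longrightarrow> \<bar>H p v w - H q v w\<bar> \<le> C * norm (p - q) / norm p) \<and>
      (\<forall>p. p \<noteq> 0 \<longrightarrow> \<bar>H p v w\<bar> \<le> M)" for v w
    unfolding H_def by (rule completed_form_lipschitz[OF F, of v w]) blast+
  then obtain C M where CM: "\<And>v w. 0 \<le> C v w" "\<And>v w. 0 \<le> M v w"
      "\<And>v w p q. p \<noteq> 0 \<Longrightarrow> q \<noteq> 0 \<Longrightarrow> \<bar>H p v w - H q v w\<bar> \<le> C v w * norm (p - q) / norm p"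
      "\<And>v w p. p \<noteq> 0 \<Longrightarrow> \<bar>H p v w\<bar> \<le> M v w"
    by metis
  define Ct where "Ct = (\<Sum>v\<in>Basis. \<Sum>w\<in>Basis. C v w)"
  define Mt where "Mt = (\<Sum>v\<in>Basis. M v v)"
  have Ct0: "0 \<le> Ct" and Mt0: "0 \<le> Mt" using CM by (auto simp: Ct_def Mt_def intro!: sum_nonneg)
  define T where "T p v = (\<Sum>w\<in>Basis. H p v w *\<^sub>R w)" for p v
  have linH: "linear (H (up p) v)" for p v
    using linear_anisotropy_form[OF F up0, of p v]
    by (simp add: H_def[abs_def] linear_iff inner_simps algebra_simps)
  have comH: "H (up p) v w = H (up p) w v" for p v w
    using anisotropy_form_commute[OF F up0] by (simp add: H_def mult.commute)
  have T: "T (up p) v \<bullet> w = H (up p) v w" for p v w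
    using Linear_Algebra.linear_componentwise[OF linH, of p v w 1]
    by (simp add: T_def inner_sum_right inner_commute[of _ w] mult.commute)
  have linT: "linear (T (up p))" for p
  proof (rule linearI)
    show "T (up p) (v + w) = T (up p) v + T (up p) w" for v w
      using comH[of p "v + w"] comH[of p v] comH[of p w]
      by (simp add: T_def linear_add[OF linH] scaleR_add_left sum.distrib)
    show "T (up p) (r *\<^sub>R v) = r *\<^sub>R T (up p) v" for r v
      using comH[of p "r *\<^sub>R v"] comH[of p v]
      by (simp add: T_def linear_cmul[OF linH] scaleR_sum_right)
  qed
  define c0 where "c0 = min (c\<^sub>1 / 2) 1"
  define d where "d = sqrt c0"
  have c0: "0 < c0" using c by (simp add: c0_def)
  have d: "0 < d" using c0 by (simp add: d_def)
  have coerc: "c0 * (norm v)\<^sup>2 \<le> v \<bullet> T (up p) v" if "p \<noteq> 0" for p v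
    using completed_form_coercive[OF adm tb c that, of v] T[of p v v]
    by (simp add: c0_def H_def up_def inner_commute power2_eq_square)
  have "\<exists>S. p \<noteq> 0 \<longrightarrow> linear S \<and> (\<forall>v w. S v \<bullet> w = v \<bullet> S w) \<and> (\<forall>v. S (S v) = T (up p) v) \<and>
      (\<forall>v. d * (norm v)\<^sup>2 \<le> v \<bullet> S v)" for p
  proof (cases "p = 0")
    case False
    have sa: "T (up p) v \<bullet> w = v \<bullet> T (up p) w" for v w
      using T[of p v w] T[of p w v] comH[of p v w] by (simp add: inner_commute)
    obtain S where "linear S" "\<And>v w. S v \<bullet> w = v \<bullet> S w" "\<And>v. S (S v) = T (up p) v"
        "\<And>v. sqrt c0 * (norm v)\<^sup>2 \<le> v \<bullet> S v"
      using selfadjoint_sqrt_exists[OF linT sa _ coerc[OF False]] c0 by (metis less_imp_le)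
    then show ?thesis by (auto simp: d_def)
  qed auto
  then obtain S where S: "\<And>p. p \<noteq> 0 \<Longrightarrow> linear (S p)" "\<And>p v w. p \<noteq> 0 \<Longrightarrow> S p v \<bullet> w = v \<bullet> S p w"
      "\<And>p v. p \<noteq> 0 \<Longrightarrow> S p (S p v) = T (up p) v" "\<And>p v. p \<noteq> 0 \<Longrightarrow> d * (norm v)\<^sup>2 \<le> v \<bullet> S p v"
    by metis
  define e where "e p = sgn (up p)" for p
  have ne: "norm (e p) = 1" and ee: "e p \<bullet> e p = 1" for p
    using up0 by (auto simp: e_def norm_sgn dot_square_norm)
  define R where "R p b = S p b - (e p \<bullet> S p b) *\<^sub>R e p" for p b
  define \<sigma> where "\<sigma> p b = fst (R p b)" for p b
  define K1 where "K1 = sqrt (real DIM((real^'n) \<times> real)) * Ct / (2 * d)"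
  have K10: "0 \<le> K1" using d Ct0 by (simp add: K1_def)
  have Sn: "norm (S p b) \<le> sqrt Mt" if p: "p \<noteq> 0" and b: "b \<in> Basis" for p b
  proof -
    have "(norm (S p b))\<^sup>2 = b \<bullet> T (up p) b"
      using S(2)[OF p, of b "S p b"] S(3)[OF p] by (simp add: power2_norm_eq_inner)
    also have "\<dots> = H (up p) b b" using T by (simp add: inner_commute)
    also have "\<dots> \<le> M b b" using CM(4)[OF up0] abs_le_D1 by blast
    also have "\<dots> \<le> Mt" unfolding Mt_def using CM(2) b by (intro member_le_sum) auto
    finally show ?thesis by (simp add: real_le_rsqrt)
  qed
  have fac: "anisotropy_form F (up p) v w = (\<Sum>b\<in>Basis. (R p b \<bullet> v) * (R p b \<bullet> w))" if p: "p \<noteq> 0" for p v w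
  proof -
    let ?B = "anisotropy_form F (up p)"
    define Q where "Q v = v - (e p \<bullet> v) *\<^sub>R e p" for v
    have Rb: "R p b \<bullet> v = b \<bullet> S p (Q v)" for b v
      using S(2)[OF p] linear_diff[OF S(1)[OF p]] linear_cmul[OF S(1)[OF p]]
      by (simp add: R_def Q_def inner_simps inner_commute)
    note lin = linear_anisotropy_form[OF F up0] and com = anisotropy_form_commute[OF F up0]
      and rad = anisotropy_form_radial[OF F up0]
    \<comment> \<open>\<open>Q\<close> projects along \<open>e p\<close>, which the form annihilates.\<close>
    have BQ: "?B x (Q y) = ?B x y" for x y
      by (simp add: Q_def e_def sgn_div_norm linear_diff[OF lin] linear_cmul[OF lin] rad)
    have eQ: "e p \<bullet> Q v = 0" for v by (simp add: Q_def inner_simps ee)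
    have "(\<Sum>b\<in>Basis. (R p b \<bullet> v) * (R p b \<bullet> w)) = S p (Q v) \<bullet> S p (Q w)"
      unfolding Rb euclidean_inner[of "S p (Q v)" "S p (Q w)"] by (simp add: inner_commute)
    also have "\<dots> = Q v \<bullet> T (up p) (Q w)" using S(2)[OF p] S(3)[OF p] by simp
    also have "\<dots> = H (up p) (Q w) (Q v)" using T by (simp add: inner_commute)
    also have "\<dots> = ?B (Q w) (Q v)" using eQ by (simp add: H_def e_def)
    also have "\<dots> = ?B v w" using BQ com by metis
    finally show ?thesis by simp
  qed
  show ?thesis
  proof (rule that[of "2 * K1 + 4 * sqrt Mt" "2 * sqrt Mt" \<sigma>])
    show "0 \<le> 2 * K1 + 4 * sqrt Mt" "0 \<le> 2 * sqrt Mt" using K10 Mt0 by auto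
    show "tau F p a a' = (\<Sum>b\<in>Basis. (\<sigma> p b \<bullet> a) * (\<sigma> p b \<bullet> a'))" if p: "p \<noteq> 0" for p a a'
    proof -
      have "R p b \<bullet> (x, 0) = \<sigma> p b \<bullet> x" for b x by (cases "R p b") (simp add: \<sigma>_def)
      then show ?thesis
        using fac[OF p, of "(a, 0)" "(a', 0)"] by (simp add: tau_eq_anisotropy_form up_def)
    qed
    show "norm (\<sigma> p b) \<le> 2 * sqrt Mt" if p: "p \<noteq> 0" and b: "b \<in> Basis" for p b
    proof -
      have "norm (R p b) \<le> norm (S p b) + norm ((e p \<bullet> S p b) *\<^sub>R e p)" unfolding R_def by (rule norm_triangle_ineq4)
      also have "\<dots> \<le> norm (S p b) + norm (S p b)"
        using Cauchy_Schwarz_ineq2[of "e p" "S p b"] by (simp add: ne)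
      finally show ?thesis using Sn[OF p b] norm_fst_le[of "fst (R p b)" "snd (R p b)"] by (simp add: \<sigma>_def)
    qed
    show "norm (\<sigma> p b - \<sigma> q b) \<le> (2 * K1 + 4 * sqrt Mt) * norm (p - q) / norm p"
      if p: "p \<noteq> 0" and q: "q \<noteq> 0" and b: "b \<in> Basis" for p q b
    proof -
      define D where "D = norm (p - q) / norm p"
      have D0: "0 \<le> D" by (simp add: D_def)
      have np: "norm p \<le> norm (up p)" using norm_fst_le[of p] by (simp add: up_def)
      have "norm (up p - up q) = norm (p - q)" by (simp add: up_def norm_Pair)
      then have upD: "norm (up p - up q) / norm (up p) \<le> D"
        unfolding D_def using p np up0[of p] by (simp add: frac_le)
      have eD: "norm (e p - e q) \<le> 2 * D"
        using normalize_lipschitz[OF up0 up0, of p q] upD by (simp add: e_def)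
      have TD: "norm (T (up p) b - T (up q) b) \<le> Ct * D" if b: "b \<in> Basis" for b
      proof -
        have "T (up p) b - T (up q) b = (\<Sum>w\<in>Basis. (H (up p) b w - H (up q) b w) *\<^sub>R w)"
          by (simp add: T_def scaleR_diff_left sum_subtractf)
        also have "norm \<dots> \<le> (\<Sum>w\<in>Basis. \<bar>H (up p) b w - H (up q) b w\<bar>)"
          by (rule order_trans[OF norm_sum]) simp
        also have "\<dots> \<le> (\<Sum>w\<in>Basis. C b w * D)"
        proof (rule sum_mono)
          fix w
          have "\<bar>H (up p) b w - H (up q) b w\<bar> \<le> C b w * (norm (up p - up q) / norm (up p))"
            using CM(3)[OF up0 up0] by simp
          also have "\<dots> \<le> C b w * D" using upD CM(1) by (rule mult_left_mono)
          finally show "\<bar>H (up p) b w - H (up q) b w\<bar> \<le> C b w * D" .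
        qed
        also have "\<dots> = (\<Sum>w\<in>Basis. C b w) * D" by (simp add: sum_distrib_right)
        also have "(\<Sum>w\<in>Basis. C b w) \<le> Ct" unfolding Ct_def
          using b CM(1) by (intro member_le_sum[of b Basis "\<lambda>b. \<Sum>w\<in>Basis. C b w"]) (auto intro: sum_nonneg)
        finally show ?thesis using D0 by (simp add: mult_right_mono)
      qed
      have SD: "norm (S p b - S q b) \<le> K1 * D"
      proof (rule power2_le_imp_le)
        have "(norm (S p b - S q b))\<^sup>2 \<le> (\<Sum>b\<in>Basis. (norm (S p b - S q b))\<^sup>2)"
          using b by (intro member_le_sum) auto
        also have "\<dots> \<le> (\<Sum>b\<in>Basis. (norm (S p (S p b) - S q (S q b)))\<^sup>2) / (4 * d\<^sup>2)"
          using S p q d by (intro selfadjoint_sqrt_lipschitz) auto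
        also have "(\<Sum>b\<in>Basis. (norm (S p (S p b) - S q (S q b)))\<^sup>2) \<le> (\<Sum>b::(real^'n) \<times> real\<in>Basis. (Ct * D)\<^sup>2)"
          using TD S(3) p q by (intro sum_mono power_mono) auto
        also have "(\<Sum>b::(real^'n) \<times> real\<in>Basis. (Ct * D)\<^sup>2) / (4 * d\<^sup>2) = (K1 * D)\<^sup>2"
          by (simp add: K1_def power_mult_distrib power_divide)
        finally show "(norm (S p b - S q b))\<^sup>2 \<le> (K1 * D)\<^sup>2" by (simp add: divide_right_mono)
      qed (use K10 D0 in simp)
      have "R p b - R q b = (S p b - S q b) - ((e p \<bullet> (S p b - S q b)) *\<^sub>R e p
          + ((e p - e q) \<bullet> S q b) *\<^sub>R e p + (e q \<bullet> S q b) *\<^sub>R (e p - e q))"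
        by (simp add: R_def inner_diff_left inner_diff_right scaleR_diff_left scaleR_diff_right)
      also have "norm \<dots> \<le> norm (S p b - S q b) + (norm ((e p \<bullet> (S p b - S q b)) *\<^sub>R e p)
          + norm (((e p - e q) \<bullet> S q b) *\<^sub>R e p) + norm ((e q \<bullet> S q b) *\<^sub>R (e p - e q)))"
        by (intro order_trans[OF norm_triangle_ineq4] add_mono order_refl order_trans[OF norm_triangle_ineq])
      also have "\<dots> \<le> norm (S p b - S q b) + (norm (S p b - S q b)
          + norm (e p - e q) * norm (S q b) + norm (S q b) * norm (e p - e q))"
        using Cauchy_Schwarz_ineq2[of "e p" "S p b - S q b"] Cauchy_Schwarz_ineq2[of "e p - e q" "S q b"]
          Cauchy_Schwarz_ineq2[of "e q" "S q b"]
        by (intro add_mono order_refl) (simp_all add: ne mult_right_mono)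
      also have "\<dots> \<le> 2 * (K1 * D) + 2 * (2 * D * sqrt Mt)"
      proof -
        have "norm (e p - e q) * norm (S q b) \<le> 2 * D * sqrt Mt"
          using mult_mono[OF eD Sn[OF q b]] D0 by simp
        then show ?thesis using SD by (simp only: mult.commute[of "norm (S q b)"])
      qed
      also have "\<dots> = (2 * K1 + 4 * sqrt Mt) * norm (p - q) / norm p"
        by (simp add: D_def algebra_simps add_divide_distrib)
      finally have "norm (R p b - R q b) \<le> (2 * K1 + 4 * sqrt Mt) * norm (p - q) / norm p" .
      moreover have "norm (fst (R p b - R q b)) \<le> norm (R p b - R q b)"
        by (metis norm_fst_le prod.collapse)
      ultimately show ?thesis by (simp add: \<sigma>_def)
    qed
  qed
qed


section \<open>Inward normals\<close>

lemma linear_dderiv_on: "f differentiable (at x within S) \<Longrightarrow> linear (\<lambda>v. dderiv_on S v f x)"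
  unfolding dderiv_on_def using linear_frechet_derivative by (metis (no_types, lifting) linear_iff)

lemma dderiv_on_eq_grad_on:
  assumes "f differentiable (at x within S)"
  shows "dderiv_on S v f x = grad_on S f x \<bullet> v"
proof -
  have "v = (\<Sum>i\<in>UNIV. (v $ i) *\<^sub>R axis i 1)"
    by (simp add: vec_eq_iff axis_def if_distrib cong: if_cong)
  then have "dderiv_on S v f x = (\<Sum>i\<in>UNIV. (v $ i) * dderiv_on S (axis i 1) f x)"
    using linear_sum[OF linear_dderiv_on[OF assms], of "\<lambda>i. (v $ i) *\<^sub>R axis i 1" UNIV]
      linear_cmul[OF linear_dderiv_on[OF assms]] by simp
  then show ?thesis by (simp add: grad_on_def inner_vec_def mult.commute)
qed

lemma Ck_on_2_taylor:
  fixes f :: "'a::real_normed_vector \<Rightarrow> real"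
  assumes C2: "Ck_on 2 U f" and U: "open U" "closed_segment x y \<subseteq> U"
  obtains z where "z \<in> closed_segment x y"
    "f y = f x + dderiv_on U (y - x) f x + dderiv_on U (y - x) (dderiv_on U (y - x) f) z / 2"
proof -
  let ?v = "y - x"
  have C: "Ck_on (Suc (Suc 0)) U f" using C2 by (simp add: numeral_2_eq_2)
  have seg: "x + t *\<^sub>R ?v \<in> closed_segment x y" if "0 \<le> t" "t \<le> 1" for t
    using that by (auto simp: in_segment algebra_simps)
  then have int: "x + t *\<^sub>R ?v \<in> interior U" if "0 \<le> t" "t \<le> 1" for t
    using that U by (auto simp: interior_open)
  define h where "h m t = (if m = (0::nat) then f (x + t *\<^sub>R ?v) else if m = 1 then dderiv_on U ?v f (x + t *\<^sub>R ?v)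
      else dderiv_on U ?v (dderiv_on U ?v f) (x + t *\<^sub>R ?v))" for m t
  have h0: "h 0 = (\<lambda>t. f (x + t *\<^sub>R ?v))" and h1: "h 1 = (\<lambda>t. dderiv_on U ?v f (x + t *\<^sub>R ?v))"
    and h2: "h 2 = (\<lambda>t. dderiv_on U ?v (dderiv_on U ?v f) (x + t *\<^sub>R ?v))"
    by (auto simp: h_def)
  have "\<forall>m t. m < 2 \<and> 0 \<le> t \<and> t \<le> 1 \<longrightarrow> (h m has_real_derivative h (Suc m) t) (at t)"
  proof (intro allI impI)
    fix m :: nat and t :: real assume a: "m < 2 \<and> 0 \<le> t \<and> t \<le> 1"
    then consider "m = 0" | "m = 1" by linarith
    then show "(h m has_real_derivative h (Suc m) t) (at t)"
    proof cases
      case 1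
      show ?thesis
        unfolding 1 h0 One_nat_def[symmetric] h1 using a int
        by (intro has_real_derivative_line Ck_on_has_derivative_at[OF C]) auto
    next
      case 2
      show ?thesis
        unfolding 2 h1 Suc_1 h2 using a int
        by (intro has_real_derivative_line Ck_on_has_derivative_at[OF Ck_on_SucD(2)[OF C]]) auto
    qed
  qed
  then obtain t where t: "0 < t" "t < 1" "h 0 1 = (\<Sum>m<2. h m 0 / fact m * 1 ^ m) + h 2 t / fact 2 * 1 ^ 2"
    using Maclaurin[of 1 2 h "h 0"] by auto
  show ?thesis
  proof (rule that)
    show "x + t *\<^sub>R ?v \<in> closed_segment x y" using seg t by simp
    show "f y = f x + dderiv_on U ?v f x + dderiv_on U ?v (dderiv_on U ?v f) (x + t *\<^sub>R ?v) / 2"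
      using t(3) by (simp add: h_def lessThan_nat_numeral numeral_2_eq_2)
  qed
qed

text \<open>
  The second derivative along \<open>v\<close> in coordinates, which shows that it is jointly continuous in the base point and
  in \<open>v\<close>.
\<close>

lemma second_dderiv_on_expand:
  fixes f :: "'a::euclidean_space \<Rightarrow> real"
  assumes C2: "Ck_on 2 U f" and U: "open U" "z \<in> U"
  shows "dderiv_on U v (dderiv_on U v f) z =
    (\<Sum>a\<in>Basis. \<Sum>b\<in>Basis. (v \<bullet> a) * (v \<bullet> b) * dderiv_on U b (dderiv_on U a f) z)"
proof -
  have C: "Ck_on (Suc (Suc 0)) U f" using C2 by (simp add: numeral_2_eq_2)
  have lin: "linear (\<lambda>v. dderiv_on U v (dderiv_on U w f) z)" for w
    using Ck_on_has_derivative_at[OF Ck_on_SucD(2)[OF C], of z w] U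
    by (simp add: interior_open has_derivative_linear)
  have exp: "dderiv_on U v (dderiv_on U w f) z = (\<Sum>b\<in>Basis. (v \<bullet> b) * dderiv_on U b (dderiv_on U w f) z)" for w
    using Linear_Algebra.linear_componentwise[OF lin[of w], of v 1] by simp
  have "dderiv_on U v (dderiv_on U v f) z = (\<Sum>b\<in>Basis. (v \<bullet> b) * dderiv_on U v (dderiv_on U b f) z)"
    unfolding exp[of v] by (intro sum.cong refl arg_cong2[of _ _ _ _ "(*)"] second_derivative_symmetric[OF C2 U])
  also have "\<dots> = (\<Sum>a\<in>Basis. (v \<bullet> a) * (\<Sum>b\<in>Basis. (v \<bullet> b) * dderiv_on U b (dderiv_on U a f) z))"
    by (simp only: exp)
  finally show ?thesis by (simp add: sum_distrib_left mult.assoc)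
qed

lemma local_defining_function_facts:
  fixes \<Omega> :: "(real^'n) set"
  assumes ldf: "local_defining_function \<Omega> U \<rho>" and x: "x \<in> U"
  shows "(\<rho> has_derivative (\<lambda>v. grad_on U \<rho> x \<bullet> v)) (at x)"
    and "x \<in> closure \<Omega> \<Longrightarrow> 0 \<le> \<rho> x"
    and "open \<Omega> \<Longrightarrow> x \<in> frontier \<Omega> \<Longrightarrow> \<rho> x = 0"
proof -
  have U: "open U" and C: "Ck_on (Suc 0) U \<rho>" and eq: "\<Omega> \<inter> U = {y\<in>U. 0 < \<rho> y}"
    using ldf by (auto simp: local_defining_function_def smooth_on_def)
  show "(\<rho> has_derivative (\<lambda>v. grad_on U \<rho> x \<bullet> v)) (at x)"
    using Ck_on_has_derivative_at[OF C, of x] U x Ck_on_SucD(1)[OF C x]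
    by (simp add: interior_open dderiv_on_eq_grad_on differentiableI)
  show nonneg: "0 \<le> \<rho> x" if cl: "x \<in> closure \<Omega>"
  proof (rule ccontr)
    assume neg: "\<not> 0 \<le> \<rho> x"
    have "open (U \<inter> \<rho> -` {..<0})"
      using continuous_on_open_vimage[OF U] Ck_on_imp_continuous_on[OF C] by (metis Int_commute open_lessThan)
    then obtain y where "y \<in> \<Omega>" "y \<in> U" "\<rho> y < 0"
      using cl neg x open_Int_closure_eq_empty[of "U \<inter> \<rho> -` {..<0}" \<Omega>] by auto
    moreover from this have "y \<in> {y \<in> U. 0 < \<rho> y}" using eq by blast
    ultimately show False by simp
  qed
  show "\<rho> x = 0" if "open \<Omega>" "x \<in> frontier \<Omega>"
    using that nonneg x eq by (force simp: frontier_def interior_open)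
qed

lemma local_defining_function_directions:
  fixes \<Omega> :: "(real^'n) set"
  assumes ldf: "local_defining_function \<Omega> U \<rho>" and x: "x \<in> U" "open \<Omega>" "x \<in> frontier \<Omega>"
  shows "0 < grad_on U \<rho> x \<bullet> v \<Longrightarrow> \<exists>d>0. \<forall>s. 0 < s \<and> s < d \<longrightarrow> x + s *\<^sub>R v \<in> \<Omega>"
    and "grad_on U \<rho> x \<bullet> v < 0 \<Longrightarrow> \<exists>d>0. \<forall>s. 0 < s \<and> s < d \<longrightarrow> x + s *\<^sub>R v \<notin> closure \<Omega>"
proof -
  have U: "open U" and eq: "\<Omega> \<inter> U = {y\<in>U. 0 < \<rho> y}"
    using ldf by (auto simp: local_defining_function_def)
  note facts = local_defining_function_facts[OF ldf]
  have zero: "\<rho> x = 0" using facts(3) x by simp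
  have der: "((\<lambda>s. \<rho> (x + s *\<^sub>R v)) has_real_derivative grad_on U \<rho> x \<bullet> v) (at 0)"
    using facts(1)[OF x(1)] by (intro has_real_derivative_line) simp
  obtain r where r: "r > 0" "ball x r \<subseteq> U" using U x by (meson open_contains_ball)
  define d0 where "d0 = r / (norm v + 1)"
  have d0: "d0 > 0" using r by (simp add: d0_def add_nonneg_pos)
  have near: "x + s *\<^sub>R v \<in> U" if "0 < s" "s < d0" for s
  proof -
    have "s * norm v \<le> s * (norm v + 1)" using that by (intro mult_left_mono) auto
    also have "\<dots> < d0 * (norm v + 1)" using that by (intro mult_strict_right_mono) (auto simp: add_nonneg_pos)
    also have "\<dots> = r" using add_nonneg_pos[OF norm_ge_zero[of v] zero_less_one] by (simp add: d0_def)
    finally show ?thesis using that r by (intro subsetD[OF r(2)]) (simp add: dist_norm)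
  qed
  show "\<exists>d>0. \<forall>s. 0 < s \<and> s < d \<longrightarrow> x + s *\<^sub>R v \<in> \<Omega>" if pos: "0 < grad_on U \<rho> x \<bullet> v"
  proof -
    obtain d where "d > 0" "\<And>h. 0 < h \<Longrightarrow> h < d \<Longrightarrow> 0 < \<rho> (x + h *\<^sub>R v)"
      using DERIV_pos_inc_right[OF der pos] zero by auto
    then show ?thesis using near d0 eq by (intro exI[of _ "min d d0"]) auto
  qed
  show "\<exists>d>0. \<forall>s. 0 < s \<and> s < d \<longrightarrow> x + s *\<^sub>R v \<notin> closure \<Omega>" if neg: "grad_on U \<rho> x \<bullet> v < 0"
  proof -
    obtain d where "d > 0" "\<And>h. 0 < h \<Longrightarrow> h < d \<Longrightarrow> \<rho> (x + h *\<^sub>R v) < 0"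
      using DERIV_neg_dec_right[OF der neg] zero by auto
    moreover have "0 \<le> \<rho> (x + s *\<^sub>R v)" if "0 < s" "s < d0" "x + s *\<^sub>R v \<in> closure \<Omega>" for s
      using facts(2)[OF near] that by simp
    ultimately show ?thesis using d0 by (intro exI[of _ "min d d0"]) force
  qed
qed

text \<open>
  If two defining functions had different normalized gradients \<open>a\<close> and \<open>b\<close> at \<open>x\<close>, the direction \<open>a - b\<close> would point
  into \<open>\<Omega>\<close> for one of them and out of \<open>\<Omega>\<close> for the other.
\<close>

lemma inward_normal_eq:
  fixes \<Omega> :: "(real^'n) set"
  assumes ldf: "local_defining_function \<Omega> U \<rho>" and x: "x \<in> U" "open \<Omega>" "x \<in> frontier \<Omega>"
  shows "inward_normal \<Omega> x = sgn (grad_on U \<rho> x)"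
  unfolding inward_normal_def
proof (rule the_equality)
  show "\<exists>V \<rho>'. x \<in> V \<and> local_defining_function \<Omega> V \<rho>' \<and> sgn (grad_on U \<rho> x) = sgn (grad_on V \<rho>' x)"
    using ldf x by blast
  fix \<nu> assume "\<exists>V \<rho>'. x \<in> V \<and> local_defining_function \<Omega> V \<rho>' \<and> \<nu> = sgn (grad_on V \<rho>' x)"
  then obtain V \<rho>' where V: "x \<in> V" "local_defining_function \<Omega> V \<rho>'" "\<nu> = sgn (grad_on V \<rho>' x)" by blast
  define a b where "a = grad_on U \<rho> x" and "b = grad_on V \<rho>' x"
  have ab: "a \<noteq> 0" "b \<noteq> 0"
    using ldf V x by (auto simp: local_defining_function_def a_def b_def)
  show "\<nu> = sgn (grad_on U \<rho> x)"
  proof (rule ccontr)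
    assume "\<nu> \<noteq> sgn (grad_on U \<rho> x)"
    then have ne: "sgn a \<noteq> sgn b" using V by (auto simp: a_def b_def)
    define v where "v = sgn a - sgn b"
    have unit: "sgn a \<bullet> sgn a = 1" "sgn b \<bullet> sgn b = 1" using ab by (auto simp: dot_square_norm norm_sgn)
    have "0 < v \<bullet> v" using ne by (simp add: v_def)
    then have lt: "sgn a \<bullet> sgn b < 1" using unit by (simp add: v_def inner_simps inner_commute)
    have "a = norm a *\<^sub>R sgn a" "b = norm b *\<^sub>R sgn b" using ab by (auto simp: sgn_div_norm)
    then have "a \<bullet> v = norm a * (sgn a \<bullet> v)" "b \<bullet> v = norm b * (sgn b \<bullet> v)" by (metis inner_scaleR_left)+
    moreover have "sgn a \<bullet> v > 0" "sgn b \<bullet> v < 0"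
      using lt unit by (auto simp: v_def inner_simps inner_commute)
    ultimately have "0 < a \<bullet> v" "b \<bullet> v < 0" using ab by (auto simp: mult_pos_neg)
    then obtain d1 d2 where d: "d1 > 0" "d2 > 0" "\<And>s. 0 < s \<Longrightarrow> s < d1 \<Longrightarrow> x + s *\<^sub>R v \<in> \<Omega>"
        "\<And>s. 0 < s \<Longrightarrow> s < d2 \<Longrightarrow> x + s *\<^sub>R v \<notin> closure \<Omega>"
      using local_defining_function_directions(1)[OF ldf x, of v]
        local_defining_function_directions(2)[OF V(2,1) x(2,3), of v] unfolding a_def b_def by blast
    define s where "s = min d1 d2 / 2"
    have "x + s *\<^sub>R v \<in> \<Omega>" "x + s *\<^sub>R v \<notin> closure \<Omega>" using d by (auto simp: s_def)
    then show False using closure_subset by blast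
  qed
qed

lemma strictly_convex_imp_convex:
  assumes "open \<Omega>" "strictly_convex \<Omega>" shows "convex \<Omega>"
  unfolding convex_contains_open_segment
proof (intro ballI)
  fix x y assume "x \<in> \<Omega>" "y \<in> \<Omega>"
  then show "open_segment x y \<subseteq> \<Omega>"
    using assms closure_subset unfolding strictly_convex_def interior_open[OF assms(1)] by (cases "x = y") auto
qed

lemma norm_inward_normal:
  fixes \<Omega> :: "(real^'n) set"
  assumes "open \<Omega>" "smooth_boundary \<Omega>" "x \<in> frontier \<Omega>"
  shows "norm (inward_normal \<Omega> x) = 1"
proof -
  obtain U \<rho> where "x \<in> U" and U: "local_defining_function \<Omega> U \<rho>"
    using assms by (auto simp: smooth_boundary_def)
  then show ?thesis
    using inward_normal_eq[OF U _ assms(1,3)] by (auto simp: norm_sgn local_defining_function_def)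
qed

lemma inward_normal_directions:
  fixes \<Omega> :: "(real^'n) set"
  assumes "open \<Omega>" "smooth_boundary \<Omega>" "x \<in> frontier \<Omega>"
  shows "0 < inward_normal \<Omega> x \<bullet> v \<Longrightarrow> \<exists>d>0. \<forall>s. 0 < s \<and> s < d \<longrightarrow> x + s *\<^sub>R v \<in> \<Omega>"
    and "inward_normal \<Omega> x \<bullet> v < 0 \<Longrightarrow> \<exists>d>0. \<forall>s. 0 < s \<and> s < d \<longrightarrow> x + s *\<^sub>R v \<notin> closure \<Omega>"
proof -
  obtain U \<rho> where x: "x \<in> U" and U: "local_defining_function \<Omega> U \<rho>"
    using assms by (auto simp: smooth_boundary_def)
  define g where "g = grad_on U \<rho> x"
  have "g \<noteq> 0" using U x by (auto simp: g_def local_defining_function_def)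
  moreover from this have "g \<bullet> v = norm g * (sgn g \<bullet> v)" by (simp add: sgn_div_norm)
  moreover have "inward_normal \<Omega> x = sgn g"
    unfolding g_def using inward_normal_eq[OF U x assms(1,3)] .
  ultimately have "0 < inward_normal \<Omega> x \<bullet> v \<Longrightarrow> 0 < g \<bullet> v" "inward_normal \<Omega> x \<bullet> v < 0 \<Longrightarrow> g \<bullet> v < 0"
    by (auto simp: mult_pos_neg)
  then show "0 < inward_normal \<Omega> x \<bullet> v \<Longrightarrow> \<exists>d>0. \<forall>s. 0 < s \<and> s < d \<longrightarrow> x + s *\<^sub>R v \<in> \<Omega>"
    "inward_normal \<Omega> x \<bullet> v < 0 \<Longrightarrow> \<exists>d>0. \<forall>s. 0 < s \<and> s < d \<longrightarrow> x + s *\<^sub>R v \<notin> closure \<Omega>"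
    using local_defining_function_directions[OF U x assms(1,3), of v] by (auto simp: g_def)
qed

text \<open>
  Directions that leave \<open>\<Omega>\<close> are excluded by convexity, which gives the weak inequality for all points.
  It becomes strict since the midpoint of \<open>x\<close> and \<open>y\<close> is interior and can be moved a little
  against the normal.
\<close>

lemma strictly_convex_inner_normal_pos:
  fixes \<Omega> :: "(real^'n) set"
  assumes \<Omega>: "open \<Omega>" "smooth_boundary \<Omega>" "strictly_convex \<Omega>"
    and x: "x \<in> frontier \<Omega>" and y: "y \<in> closure \<Omega>" "y \<noteq> x"
  shows "0 < inward_normal \<Omega> x \<bullet> (y - x)"
proof -
  have x': "x \<in> closure \<Omega>" using x by (simp add: frontier_def)
  have nonneg: "0 \<le> inward_normal \<Omega> x \<bullet> (y - x)" if y: "y \<in> closure \<Omega>" for y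
  proof (rule ccontr)
    assume "\<not> 0 \<le> inward_normal \<Omega> x \<bullet> (y - x)"
    then obtain d where d: "d > 0" "\<And>s. 0 < s \<Longrightarrow> s < d \<Longrightarrow> x + s *\<^sub>R (y - x) \<notin> closure \<Omega>"
      using inward_normal_directions(2)[OF \<Omega>(1,2) x, of "y - x"] by auto
    define s where "s = min (d / 2) 1"
    have s: "0 < s" "s < d" "s \<le> 1" using d(1) by (auto simp: s_def)
    have "(1 - s) *\<^sub>R x + s *\<^sub>R y \<in> closure \<Omega>"
      using convex_closure[OF strictly_convex_imp_convex[OF \<Omega>(1,3)]] x' y s by (simp add: convexD)
    then show False using d(2)[OF s(1,2)] by (simp add: algebra_simps)
  qed
  define z where "z = midpoint x y"
  have "z \<in> open_segment x y" using y by (simp add: z_def midpoint_in_open_segment)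
  moreover have "open_segment x y \<subseteq> \<Omega>"
    using bspec[OF bspec[OF \<Omega>(3)[unfolded strictly_convex_def] x'] y(1)] y(2) by (simp add: interior_open[OF \<Omega>(1)])
  ultimately have "z \<in> \<Omega>" by blast
  then obtain e where e: "e > 0" "ball z e \<subseteq> \<Omega>" using \<Omega>(1) by (meson open_contains_ball)
  define N where "N = inward_normal \<Omega> x"
  have N: "norm N = 1" using norm_inward_normal[OF \<Omega>(1,2) x] by (simp add: N_def)
  have "z - (e / 2) *\<^sub>R N \<in> ball z e" using e N by (simp add: dist_norm)
  then have "z - (e / 2) *\<^sub>R N \<in> closure \<Omega>" using e closure_subset by blast
  then have "0 \<le> N \<bullet> (z - (e / 2) *\<^sub>R N - x)" using nonneg by (simp add: N_def)
  moreover have "N \<bullet> (z - (e / 2) *\<^sub>R N - x) = N \<bullet> (y - x) / 2 - e / 2"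
    using N by (simp add: z_def midpoint_def inner_simps dot_square_norm field_simps)
  ultimately show ?thesis using e by (simp add: N_def)
qed


section \<open>Curvature and uniform convexity\<close>

text \<open>
  For tangential \<open>v\<close> the segment from \<open>x + s (v - e N)\<close> to \<open>x + s (v + e N)\<close> leads from outside into \<open>\<Omega>\<close>
  when \<open>s\<close> is small, so it meets the boundary. Thus \<open>v\<close> is a limit of directions towards boundary points.
\<close>

lemma frontier_tangent_derivative_unique:
  fixes \<Omega> :: "(real^'n) set" and f :: "real^'n \<Rightarrow> 'b::real_normed_vector"
  assumes \<Omega>: "open \<Omega>" "smooth_boundary \<Omega>" and x: "x \<in> frontier \<Omega>"
    and D: "(f has_derivative Da) (at x within frontier \<Omega>)" "(f has_derivative Db) (at x within frontier \<Omega>)"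
    and v: "inward_normal \<Omega> x \<bullet> v = 0"
  shows "Da v = Db v"
proof -
  define N where "N = inward_normal \<Omega> x"
  have N: "norm N = 1" "N \<bullet> N = 1" "N \<bullet> v = 0"
    using norm_inward_normal[OF \<Omega> x] v by (auto simp: N_def dot_square_norm)
  define D where "D h = Da h - Db h" for h
  have D0: "((\<lambda>y. 0) has_derivative D) (at x within frontier \<Omega>)"
    using has_derivative_diff[OF D] by (simp add: D_def[abs_def])
  then have lin: "linear D" by (rule has_derivative_linear)
  define K where "K = norm v + 1 + norm (D N)"
  have "norm (D v) \<le> e * K" if e: "0 < e" "e < 1" for e
  proof -
    obtain d where d: "0 < d" "\<And>y. y \<in> frontier \<Omega> \<Longrightarrow> norm (y - x) < d \<Longrightarrow> norm (D (y - x)) \<le> e * norm (y - x)"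
      using D0 e(1) unfolding has_derivative_within_alt by (auto simp: norm_minus_commute)
    obtain d1 where d1: "d1 > 0" "\<And>s. 0 < s \<Longrightarrow> s < d1 \<Longrightarrow> x + s *\<^sub>R (v + e *\<^sub>R N) \<in> \<Omega>"
      using inward_normal_directions(1)[OF \<Omega> x, of "v + e *\<^sub>R N"] N e by (auto simp: N_def inner_simps)
    obtain d2 where d2: "d2 > 0" "\<And>s. 0 < s \<Longrightarrow> s < d2 \<Longrightarrow> x + s *\<^sub>R (v - e *\<^sub>R N) \<notin> closure \<Omega>"
      using inward_normal_directions(2)[OF \<Omega> x, of "v - e *\<^sub>R N"] N e by (auto simp: N_def inner_simps)
    have nv: "norm v + 1 > 0" by (simp add: add_nonneg_pos)
    obtain q where q: "q = d / (norm v + 1)" "q > 0" using divide_pos_pos[OF d(1) nv] by blast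
    define s where "s = min (min d1 d2) q / 2"
    have s: "0 < s" "s < d1" "s < d2" "s < d / (norm v + 1)"
      unfolding q(1)[symmetric] using q(2) d1(1) d2(1) by (auto simp: s_def)
    let ?a = "x + s *\<^sub>R (v - e *\<^sub>R N)" and ?b = "x + s *\<^sub>R (v + e *\<^sub>R N)"
    have "?a \<notin> \<Omega>" using d2(2)[OF s(1,3)] closure_subset by blast
    then have "closed_segment ?a ?b \<inter> frontier \<Omega> \<noteq> {}"
      using d1(2)[OF s(1,2)] by (intro connected_Int_frontier) auto
    then obtain u where u: "0 \<le> u" "u \<le> 1" "(1 - u) *\<^sub>R ?a + u *\<^sub>R ?b \<in> frontier \<Omega>"
      by (auto simp: in_segment)
    define t where "t = (2 * u - 1) * e"
    have t: "\<bar>t\<bar> \<le> e" using u e by (auto simp: t_def abs_mult mult_left_le_one_le)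
    have yeq: "(1 - u) *\<^sub>R ?a + u *\<^sub>R ?b = x + s *\<^sub>R (v + t *\<^sub>R N)"
      by (simp add: t_def vec_eq_iff algebra_simps)
    have nvt: "norm (v + t *\<^sub>R N) \<le> norm v + 1"
      using norm_triangle_ineq[of v "t *\<^sub>R N"] t N e by simp
    have "s * norm (v + t *\<^sub>R N) \<le> s * (norm v + 1)" using s nvt by (intro mult_left_mono) auto
    also have "\<dots> < d" using s(4) nv by (simp add: pos_less_divide_eq)
    finally have "norm (D (s *\<^sub>R (v + t *\<^sub>R N))) \<le> e * norm (s *\<^sub>R (v + t *\<^sub>R N))"
      using d(2)[of "x + s *\<^sub>R (v + t *\<^sub>R N)"] u(3) s(1) unfolding yeq by simp
    then have "norm (D v + t *\<^sub>R D N) \<le> e * norm (v + t *\<^sub>R N)"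
      using s(1) by (simp add: linear_cmul[OF lin] linear_add[OF lin])
    also have "\<dots> \<le> e * (norm v + 1)" using nvt e by (intro mult_left_mono) auto
    finally have "norm (D v + t *\<^sub>R D N) \<le> e * (norm v + 1)" .
    moreover have "norm (t *\<^sub>R D N) \<le> e * norm (D N)" using t by (simp add: mult_right_mono)
    moreover have "norm (D v) \<le> norm (D v + t *\<^sub>R D N) + norm (t *\<^sub>R D N)"
      using norm_triangle_ineq4[of "D v + t *\<^sub>R D N" "t *\<^sub>R D N"] by simp
    ultimately show ?thesis by (simp add: K_def algebra_simps)
  qed
  moreover have K: "K > 0" using norm_ge_zero[of v] norm_ge_zero[of "D N"] unfolding K_def by linarith
  ultimately have "norm (D v) \<le> e" if "0 < e" for e
  proof -
    define e' where "e' = min (1/2) (e / K)"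
    have "0 < e'" "e' < 1" using K that by (auto simp: e'_def)
    moreover have "e' \<le> e / K" by (simp add: e'_def)
    then have "e' * K \<le> e" using K by (simp add: pos_le_divide_eq)
    ultimately show ?thesis using \<open>\<And>e. 0 < e \<Longrightarrow> e < 1 \<Longrightarrow> norm (D v) \<le> e * K\<close>[of e'] by simp
  qed
  then have "norm (D v) \<le> 0" by (rule field_le_epsilon) simp
  then show ?thesis by (simp add: D_def)
qed

text \<open>
  Near \<open>x\<close> the normal is the normalized gradient \<open>G\<close> of \<open>\<rho>\<close>, whose derivative in a tangential direction \<open>v\<close> has the
  \<open>v\<close>-component \<open>D\<^sup>2\<rho> v v / |G|\<close>, because the derivative of the normalizing factor multiplies
  \<open>G \<bullet> v = 0\<close>. A frame that starts with \<open>v\<close> turns the curvature bound into a bound on this number.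
\<close>

lemma curvature_bounds_second_derivative:
  fixes \<Omega> :: "(real^'n) set"
  assumes \<Omega>: "open \<Omega>" "smooth_boundary \<Omega>" and curv: "curvature_ge \<Omega> k\<^sub>0"
    and ldf: "local_defining_function \<Omega> U \<rho>" and x: "x \<in> U" "x \<in> frontier \<Omega>"
    and v: "inward_normal \<Omega> x \<bullet> v = 0"
  shows "dderiv_on U v (dderiv_on U v \<rho>) x \<le> - k\<^sub>0 * norm (grad_on U \<rho> x) * (norm v)\<^sup>2"
proof -
  have U: "open U" and C: "Ck_on (Suc (Suc 0)) U \<rho>" and G0: "grad_on U \<rho> x \<noteq> 0"
    using ldf x by (auto simp: local_defining_function_def smooth_on_def)
  define G where "G = grad_on U \<rho>"
  define g where "g = norm (G x)"
  have g: "g > 0" using G0 by (simp add: g_def G_def)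
  have Gw: "dderiv_on U w \<rho> y = G y \<bullet> w" if "y \<in> U" for y w
    unfolding G_def using Ck_on_SucD(1)[OF C that] by (intro dderiv_on_eq_grad_on) (rule differentiableI)
  have dG: "((\<lambda>y. G y \<bullet> w) has_derivative (\<lambda>h. dderiv_on U h (dderiv_on U w \<rho>) x)) (at x)" for w
    by (rule has_derivative_transform_within_open[OF Ck_on_has_derivative_at[OF Ck_on_SucD(2)[OF C]] U x(1)])
      (use U x Gw in \<open>auto simp: interior_open\<close>)
  then have "G differentiable (at x)"
    unfolding differentiable_componentwise_within[of G x UNIV] using differentiableI by blast
  then obtain G' where G': "(G has_derivative G') (at x)" by (auto simp: differentiable_def)
  have G'w: "G' h \<bullet> w = dderiv_on U h (dderiv_on U w \<rho>) x" for h w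
    using has_derivative_unique[OF has_derivative_inner_left[OF G'] dG] by meson
  have G'lin: "linear G'" using G' by (rule has_derivative_linear)
  have "(\<lambda>y. inverse (norm (G y))) differentiable (at x)"
    by (rule differentiable_inverse[OF differentiable_compose[OF differentiable_norm_at differentiableI[OF G']]])
      (use G0 in \<open>simp_all add: G_def\<close>)
  then obtain q where q: "((\<lambda>y. inverse (norm (G y))) has_derivative q) (at x)" by (auto simp: differentiable_def)
  define Da where "Da h = inverse (norm (G x)) *\<^sub>R G' h + q h *\<^sub>R G x" for h
  have "((\<lambda>y. sgn (G y)) has_derivative Da) (at x)"
    using has_derivative_scaleR[OF q G'] by (simp add: sgn_div_norm Da_def[abs_def])
  then have s: "((\<lambda>y. sgn (G y)) has_derivative Da) (at x within frontier \<Omega>)"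
    by (rule has_derivative_at_withinI)
  obtain r where r: "r > 0" "ball x r \<subseteq> U" using U x by (meson open_contains_ball)
  have Da: "(inward_normal \<Omega> has_derivative Da) (at x within frontier \<Omega>)"
  proof (rule has_derivative_transform_within[OF s r(1) x(2)])
    fix y assume "y \<in> frontier \<Omega>" "dist y x < r"
    then show "sgn (G y) = inward_normal \<Omega> y"
      using inward_normal_eq[OF ldf _ \<Omega>(1), of y] r(2) by (auto simp: G_def dist_commute)
  qed
  define Db where "Db = frechet_derivative (inward_normal \<Omega>) (at x within frontier \<Omega>)"
  have Db: "(inward_normal \<Omega> has_derivative Db) (at x within frontier \<Omega>)"
    unfolding Db_def using differentiableI[OF Da] by (simp only: frechet_derivative_works)
  have Neq: "inward_normal \<Omega> x = sgn (G x)" using inward_normal_eq[OF ldf x(1) \<Omega>(1) x(2)] by (simp add: G_def)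
  have unit: "G' v \<bullet> v \<le> - k\<^sub>0 * g" if v: "inward_normal \<Omega> x \<bullet> v = 0" "norm v = 1" for v
  proof -
    have "v \<noteq> 0" "norm v = 1 \<and> v \<bullet> inward_normal \<Omega> x = 0" using v by (auto simp: inner_commute)
    then obtain e where e: "orthonormal_frame CARD('n) e" "e CARD('n) = inward_normal \<Omega> x" "e 1 = v" "1 < CARD('n)"
      using orthonormal_frame_extension[OF norm_inward_normal[OF \<Omega> x(2)], of v] by metis
    have ei: "e i \<bullet> inward_normal \<Omega> x = 0" if "i \<in> {1..CARD('n) - 1}" for i
    proof -
      have "i \<in> {1..CARD('n)}" "CARD('n) \<in> {1..CARD('n)}" "i \<noteq> CARD('n)" using that e(4) by auto
      then show ?thesis using e(1) unfolding orthonormal_frame_def e(2)[symmetric] by simp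
    qed
    have "tangent_frame \<Omega> x e"
      using e(1) ei by (auto simp: tangent_frame_def orthonormal_frame_def)
    then have "k\<^sub>0 * (\<Sum>i=1..CARD('n) - 1. (if i = 1 then 1 else 0 :: real)\<^sup>2)
        \<le> (\<Sum>i=1..CARD('n) - 1. \<Sum>j=1..CARD('n) - 1. curvature_matrix \<Omega> x e i j * (if i = 1 then 1 else 0) * (if j = 1 then 1 else 0))"
      by (rule curv[unfolded curvature_ge_def, rule_format, OF x(2)])
    moreover have "1 \<in> {1..CARD('n) - 1}" using e(4) by auto
    ultimately have "k\<^sub>0 \<le> curvature_matrix \<Omega> x e 1 1"
      by (simp add: if_distrib[of "\<lambda>x. x\<^sup>2"] if_distrib[of "\<lambda>x. _ * x"] sum.delta cong: if_cong)
    then have "Db v \<bullet> v \<le> - k\<^sub>0" by (simp add: curvature_matrix_def Db_def e(3)[simplified])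
    moreover have "Da v = Db v" by (rule frontier_tangent_derivative_unique[OF \<Omega> x(2) Da Db v(1)])
    moreover have "G x \<bullet> v = 0" using v(1) g by (auto simp: Neq sgn_div_norm g_def)
    then have "Da v \<bullet> v = inverse g * (G' v \<bullet> v)" by (simp add: Da_def g_def inner_simps)
    ultimately have "inverse g * (G' v \<bullet> v) \<le> - k\<^sub>0" by simp
    then have "(G' v \<bullet> v) / g \<le> - k\<^sub>0" by (simp add: divide_inverse mult.commute)
    then show ?thesis using g by (simp add: pos_divide_le_eq)
  qed
  have "G' v \<bullet> v \<le> - k\<^sub>0 * g * (norm v)\<^sup>2"
  proof (cases "v = 0")
    case False
    have "v = norm v *\<^sub>R sgn v" using False by (simp add: sgn_div_norm)
    then have "G' v \<bullet> v = (norm v)\<^sup>2 * (G' (sgn v) \<bullet> sgn v)"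
      by (metis (no_types, lifting) G'lin inner_scaleR_left inner_scaleR_right linear_cmul mult.assoc power2_eq_square)
    moreover have "inward_normal \<Omega> x \<bullet> sgn v = 0" using v by (simp add: sgn_div_norm)
    then have "G' (sgn v) \<bullet> sgn v \<le> - k\<^sub>0 * g" using unit False by (simp add: norm_sgn)
    ultimately show ?thesis using mult_left_mono[of "G' (sgn v) \<bullet> sgn v" "- k\<^sub>0 * g" "(norm v)\<^sup>2"] by (simp add: mult.commute)
  qed (simp add: linear_0[OF G'lin])
  then show ?thesis by (simp add: G'w g_def G_def)
qed

text \<open>
  Otherwise there are boundary points \<open>a k\<close> and points \<open>b k\<close> with
  \<open>N (a k) \<bullet> (b k - a k) \<le> |b k - a k|\<^sup>2 / k\<close>; let them converge along a subsequence. Different limits contradict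
  strict convexity. If the limits coincide, the directions \<open>c k\<close> from \<open>a k\<close> to \<open>b k\<close> have a tangential limit \<open>v0\<close>.
  As a defining function vanishes at \<open>a k\<close> and is nonnegative at \<open>b k\<close>, Taylor's formula makes its
  second derivative along \<open>v0\<close> nonnegative, against the curvature bound.
\<close>

lemma uniformly_convex_at_boundary:
  fixes \<Omega> :: "(real^'n) set"
  assumes \<Omega>: "open \<Omega>" "bounded \<Omega>" "smooth_boundary \<Omega>" "strictly_convex \<Omega>"
    and curv: "0 < k\<^sub>0" "curvature_ge \<Omega> k\<^sub>0"
  obtains \<kappa> where "0 < \<kappa>"
    "\<And>x y. x \<in> frontier \<Omega> \<Longrightarrow> y \<in> closure \<Omega> \<Longrightarrow> \<kappa> * (norm (y - x))\<^sup>2 \<le> inward_normal \<Omega> x \<bullet> (y - x)"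
proof (rule ccontr)
  assume no: "\<not> thesis"
  let ?N = "inward_normal \<Omega>"
  have "\<exists>x y. x \<in> frontier \<Omega> \<and> y \<in> closure \<Omega> \<and> ?N x \<bullet> (y - x) < inverse (real (Suc k)) * (norm (y - x))\<^sup>2" for k
    using no that[of "inverse (real (Suc k))"] by (meson inverse_positive_iff_positive not_le of_nat_0_less_iff zero_less_Suc)
  then obtain X Y where XY: "\<And>k. X k \<in> frontier \<Omega>" "\<And>k. Y k \<in> closure \<Omega>"
      "\<And>k. ?N (X k) \<bullet> (Y k - X k) < inverse (real (Suc k)) * (norm (Y k - X k))\<^sup>2"
    by metis
  have ne: "Y k \<noteq> X k" for k using XY(3)[of k] by auto
  let ?K = "frontier \<Omega> \<times> closure \<Omega> \<times> sphere (0 :: real^'n) 1"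
  have "compact ?K" using \<Omega>(2) by (intro compact_Times compact_frontier_bounded) (auto simp: compact_closure)
  moreover have "(X k, Y k, sgn (Y k - X k)) \<in> ?K" for k using XY ne by (auto simp: norm_sgn)
  ultimately obtain l r where l: "l \<in> ?K" and r: "strict_mono (r :: nat \<Rightarrow> nat)"
      and lim: "((\<lambda>k. (X k, Y k, sgn (Y k - X k))) \<circ> r) \<longlonglongrightarrow> l"
    unfolding compact_def by meson
  obtain x0 y0 v0 where l_eq: "l = (x0, y0, v0)" by (cases l)
  have x0: "x0 \<in> frontier \<Omega>" and y0: "y0 \<in> closure \<Omega>" and v0: "norm v0 = 1" using l l_eq by auto
  define a b c where "a k = X (r k)" and "b k = Y (r k)" and "c k = sgn (b k - a k)" for k
  have a: "a \<longlonglongrightarrow> x0" and b: "b \<longlonglongrightarrow> y0" and c: "c \<longlonglongrightarrow> v0"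
    using tendsto_fst[OF lim] tendsto_fst[OF tendsto_snd[OF lim]] tendsto_snd[OF tendsto_snd[OF lim]]
    by (simp_all add: l_eq o_def a_def[abs_def] b_def[abs_def] c_def[abs_def])
  have af: "a k \<in> frontier \<Omega>" and bf: "b k \<in> closure \<Omega>" and ab: "b k \<noteq> a k" for k
    using XY ne by (auto simp: a_def b_def)
  have small: "?N (a k) \<bullet> (b k - a k) \<le> inverse (real (Suc k)) * (norm (b k - a k))\<^sup>2" for k
  proof -
    have "inverse (real (Suc (r k))) \<le> inverse (real (Suc k))"
      using seq_suble[OF r, of k] by (intro le_imp_inverse_le) auto
    then have "inverse (real (Suc (r k))) * (norm (b k - a k))\<^sup>2 \<le> inverse (real (Suc k)) * (norm (b k - a k))\<^sup>2"
      by (rule mult_right_mono) simp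
    then show ?thesis using XY(3)[of "r k"] by (simp add: a_def b_def)
  qed
  have pos: "0 < ?N (a k) \<bullet> (b k - a k)" for k
    using strictly_convex_inner_normal_pos[OF \<Omega>(1,3,4) af bf ab] .
  obtain U \<rho> where xU: "x0 \<in> U" and ldf: "local_defining_function \<Omega> U \<rho>"
    using \<Omega>(3) x0 by (auto simp: smooth_boundary_def)
  have U: "open U" and C2: "Ck_on 2 U \<rho>" and G0: "\<And>y. y \<in> U \<Longrightarrow> grad_on U \<rho> y \<noteq> 0"
    using ldf by (auto simp: local_defining_function_def smooth_on_def)
  have C: "Ck_on (Suc (Suc 0)) U \<rho>" using C2 by (simp add: numeral_2_eq_2)
  define G where "G = grad_on U \<rho>"
  have "continuous_on U G" unfolding G_def grad_on_def
    using Ck_on_imp_continuous_on[OF Ck_on_SucD(2)[OF C]] by (intro continuous_on_vec_lambda) auto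
  then have "isCont G x0" using U xU by (simp add: continuous_on_eq_continuous_at)
  then have Ga: "(\<lambda>k. G (a k)) \<longlonglongrightarrow> G x0" using a by (rule isCont_tendsto_compose)
  have aU: "\<forall>\<^sub>F k in sequentially. a k \<in> U" using a U xU by (rule topological_tendstoD)
  have N_eq: "?N y = sgn (G y)" if "y \<in> U" "y \<in> frontier \<Omega>" for y
    using inward_normal_eq[OF ldf that(1) \<Omega>(1) that(2)] by (simp add: G_def)
  have "(\<lambda>k. sgn (G (a k))) \<longlonglongrightarrow> sgn (G x0)" using Ga G0[OF xU] by (intro tendsto_sgn) (auto simp: G_def)
  then have Na: "(\<lambda>k. ?N (a k)) \<longlonglongrightarrow> ?N x0"
    unfolding N_eq[OF xU x0]
    by (rule Lim_transform_eventually) (use aU in \<open>auto elim!: eventually_mono simp: N_eq af\<close>)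
  have inv0: "(\<lambda>k. inverse (real (Suc k))) \<longlonglongrightarrow> 0" by (rule LIMSEQ_inverse_real_of_nat)
  show False
  proof (cases "x0 = y0")
    case False
    have "(\<lambda>k. ?N (a k) \<bullet> (b k - a k)) \<longlonglongrightarrow> ?N x0 \<bullet> (y0 - x0)" by (intro tendsto_intros Na a b)
    moreover have "(\<lambda>k. inverse (real (Suc k)) * (norm (b k - a k))\<^sup>2) \<longlonglongrightarrow> 0 * (norm (y0 - x0))\<^sup>2"
      by (intro tendsto_intros inv0 a b)
    ultimately have "?N x0 \<bullet> (y0 - x0) \<le> 0 * (norm (y0 - x0))\<^sup>2"
      by (rule LIMSEQ_le) (use small in auto)
    then show False using strictly_convex_inner_normal_pos[OF \<Omega>(1,3,4) x0 y0] False by auto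
  next
    case True
    define w where "w k = norm (b k - a k)" for k
    have w: "w k > 0" for k using ab by (simp add: w_def)
    have bc: "b k - a k = w k *\<^sub>R c k" for k using ab by (simp add: w_def c_def sgn_div_norm)
    have w0: "w \<longlonglongrightarrow> 0" unfolding w_def[abs_def] using tendsto_norm[OF tendsto_diff[OF b a]] True by simp
    have "(\<lambda>k. ?N (a k) \<bullet> c k) \<longlonglongrightarrow> 0"
    proof (rule tendsto_sandwich[OF _ _ tendsto_const])
      have "0 \<le> ?N (a k) \<bullet> c k \<and> ?N (a k) \<bullet> c k \<le> inverse (real (Suc k)) * w k" for k
        using pos[of k] small[of k] w[of k] unfolding bc by (simp add: zero_less_mult_iff power2_eq_square)
          (simp add: w_def[symmetric] bc[symmetric] c_def norm_sgn ab field_simps)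
      then show "\<forall>\<^sub>F k in sequentially. 0 \<le> ?N (a k) \<bullet> c k"
        "\<forall>\<^sub>F k in sequentially. ?N (a k) \<bullet> c k \<le> inverse (real (Suc k)) * w k" by auto
      show "(\<lambda>k. inverse (real (Suc k)) * w k) \<longlonglongrightarrow> 0" using tendsto_mult[OF inv0 w0] by simp
    qed
    then have tangent: "?N x0 \<bullet> v0 = 0" using LIMSEQ_unique[OF tendsto_inner[OF Na c]] by blast
    let ?H = "\<lambda>v z. dderiv_on U v (dderiv_on U v \<rho>) z"
    obtain e where e: "e > 0" "ball x0 e \<subseteq> U" using U xU by (meson open_contains_ball)
    \<comment> \<open>\<open>z\<close> will be an intermediate point of Taylor's formula between \<open>a k\<close> and \<open>b k\<close>.\<close>
    define P where "P k z \<longleftrightarrow> z \<in> closed_segment (a k) (b k) \<and> - 2 * norm (G (a k)) * inverse (real (Suc k)) \<le> ?H (c k) z" for k z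
    have ex: "\<exists>z. P k z" if near: "a k \<in> ball x0 e" "b k \<in> ball x0 e" for k
    proof -
      have seg: "closed_segment (a k) (b k) \<subseteq> U" using near e closed_segment_subset[OF _ _ convex_ball] by blast
      obtain z where z: "z \<in> closed_segment (a k) (b k)"
          "\<rho> (b k) = \<rho> (a k) + dderiv_on U (b k - a k) \<rho> (a k) + ?H (b k - a k) z / 2"
        using Ck_on_2_taylor[OF C2 U seg] by blast
      have inU: "a k \<in> U" "b k \<in> U" "z \<in> U" using near e seg z by auto
      have "\<rho> (a k) = 0" "0 \<le> \<rho> (b k)"
        using local_defining_function_facts[OF ldf] \<Omega>(1) af bf inU by auto
      moreover have "dderiv_on U (b k - a k) \<rho> (a k) = G (a k) \<bullet> (b k - a k)"
        unfolding G_def using Ck_on_SucD(1)[OF C inU(1)] by (intro dderiv_on_eq_grad_on) (rule differentiableI)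
      moreover have "G (a k) \<bullet> (b k - a k) = norm (G (a k)) * (?N (a k) \<bullet> (b k - a k))"
        using G0[OF inU(1)] by (simp add: N_eq[OF inU(1) af] sgn_div_norm G_def)
      moreover have "norm (G (a k)) * (?N (a k) \<bullet> (b k - a k)) \<le> norm (G (a k)) * (inverse (real (Suc k)) * (w k)\<^sup>2)"
        using small[of k] by (intro mult_left_mono) (auto simp: w_def)
      moreover have "?H (b k - a k) z = (w k)\<^sup>2 * ?H (c k) z"
        unfolding bc second_dderiv_on_expand[OF C2 U inU(3)]
        by (simp add: sum_distrib_left power2_eq_square mult.assoc mult.left_commute)
      ultimately have "0 \<le> norm (G (a k)) * (inverse (real (Suc k)) * (w k)\<^sup>2) + (w k)\<^sup>2 * ?H (c k) z / 2"
        using z(2) by linarith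
      then have "0 \<le> (w k)\<^sup>2 * (norm (G (a k)) * inverse (real (Suc k)) + ?H (c k) z / 2)"
        by (simp add: algebra_simps)
      then have "0 \<le> norm (G (a k)) * inverse (real (Suc k)) + ?H (c k) z / 2"
        using w[of k] by (simp add: zero_le_mult_iff)
      then show ?thesis using z(1) unfolding P_def by (intro exI[of _ z]) auto
    qed
    have "\<forall>\<^sub>F k in sequentially. a k \<in> ball x0 e" "\<forall>\<^sub>F k in sequentially. b k \<in> ball x0 e"
      using topological_tendstoD[OF a open_ball] topological_tendstoD[OF b open_ball] e True by force+
    then have "\<forall>\<^sub>F k in sequentially. \<exists>z. P k z" by eventually_elim (rule ex)
    then have ev: "\<forall>\<^sub>F k in sequentially. P k (SOME z. P k z)" by (rule eventually_mono) (rule someI_ex)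
    define Z where "Z k = (SOME z. P k z)" for k
    have ZP: "\<forall>\<^sub>F k in sequentially. P k (Z k)" using ev by (simp add: Z_def)
    have "(\<lambda>k. Z k - a k) \<longlonglongrightarrow> 0"
    proof (rule Lim_null_comparison[OF _ w0])
      show "\<forall>\<^sub>F k in sequentially. norm (Z k - a k) \<le> w k"
        using ZP by (rule eventually_mono) (use segment_bound(1) in \<open>auto simp: P_def w_def norm_minus_commute\<close>)
    qed
    then have Z: "Z \<longlonglongrightarrow> x0" using tendsto_add[OF _ a] by force
    have HZ: "(\<lambda>k. dderiv_on U s (dderiv_on U t \<rho>) (Z k)) \<longlonglongrightarrow> dderiv_on U s (dderiv_on U t \<rho>) x0" for s t
    proof (rule isCont_tendsto_compose[OF _ Z])
      show "isCont (dderiv_on U s (dderiv_on U t \<rho>)) x0"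
        using Ck_on_imp_continuous_on[OF Ck_on_SucD(2)[OF Ck_on_SucD(2)[OF C]]] U xU
        by (simp add: continuous_on_eq_continuous_at)
    qed
    have "(\<lambda>k. ?H (c k) (Z k)) \<longlonglongrightarrow> ?H v0 x0"
    proof (rule tendsto_cong[THEN iffD1])
      show "(\<lambda>k. \<Sum>s\<in>Basis. \<Sum>t\<in>Basis. (c k \<bullet> s) * (c k \<bullet> t) * dderiv_on U t (dderiv_on U s \<rho>) (Z k)) \<longlonglongrightarrow> ?H v0 x0"
        unfolding second_dderiv_on_expand[OF C2 U xU] by (intro tendsto_intros c HZ)
      have "\<forall>\<^sub>F k in sequentially. Z k \<in> U" using Z U xU by (rule topological_tendstoD)
      then show "\<forall>\<^sub>F k in sequentially. (\<Sum>s\<in>Basis. \<Sum>t\<in>Basis. (c k \<bullet> s) * (c k \<bullet> t) * dderiv_on U t (dderiv_on U s \<rho>) (Z k)) = ?H (c k) (Z k)"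
        by (rule eventually_mono) (simp add: second_dderiv_on_expand[OF C2 U])
    qed
    moreover have "(\<lambda>k. - 2 * norm (G (a k)) * inverse (real (Suc k))) \<longlonglongrightarrow> - 2 * norm (G x0) * 0"
      by (intro tendsto_intros Ga inv0)
    ultimately have "- 2 * norm (G x0) * 0 \<le> ?H v0 x0"
      by (rule tendsto_le[OF sequentially_bot _ _ ]) (use ZP in \<open>auto elim!: eventually_mono simp: P_def\<close>)
    moreover have "?H v0 x0 \<le> - k\<^sub>0 * norm (G x0) * (norm v0)\<^sup>2"
      unfolding G_def by (rule curvature_bounds_second_derivative[OF \<Omega>(1,3) curv(2) ldf xU x0 tangent])
    moreover have "k\<^sub>0 * norm (G x0) > 0" using curv(1) G0[OF xU] by (simp add: G_def)
    ultimately show False using v0 by simp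
  qed
qed


section \<open>Extending the Neumann datum\<close>

lemma sum_Basis_squares: "(\<Sum>b\<in>Basis. (v \<bullet> b) * (v \<bullet> b)) = (norm v)\<^sup>2"
  by (simp add: power2_norm_eq_inner flip: euclidean_inner)

text \<open>
  The fourth power is the least one for which this cut-off function is of class \<open>C\<^sup>3\<close>.
\<close>

definition bump :: "'a::euclidean_space \<Rightarrow> real \<Rightarrow> 'a \<Rightarrow> real" where
  "bump c s y = max 0 (s\<^sup>2 - (norm (y - c))\<^sup>2) ^ 4"

lemma Ck_on_bump: "cone_condition S \<Longrightarrow> Ck_on 3 S (bump c s)"
proof -
  assume S: "cone_condition S"
  have "Ck_on 3 S (\<lambda>y. s\<^sup>2 + (- 1) * (\<Sum>b\<in>Basis. (y \<bullet> b + - (c \<bullet> b)) * (y \<bullet> b + - (c \<bullet> b))))"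
    by (intro Ck_on_add Ck_on_mult Ck_on_sum Ck_on_const Ck_on_bounded_linear bounded_linear_inner_left S)
  from Ck_on_pos_part_power[OF S this]
  have "Ck_on 3 S (\<lambda>y. max 0 (s\<^sup>2 + (- 1) * (\<Sum>b\<in>Basis. (y \<bullet> b + - (c \<bullet> b)) * (y \<bullet> b + - (c \<bullet> b)))) ^ (3 + 1))" .
  moreover have "(\<Sum>b\<in>Basis. (y \<bullet> b + - (c \<bullet> b)) * (y \<bullet> b + - (c \<bullet> b))) = (norm (y - c))\<^sup>2" for y
    using sum_Basis_squares[of "y - c"] by (simp add: inner_diff_left)
  ultimately show ?thesis by (simp add: bump_def[abs_def])
qed

lemma bump_nonneg: "0 \<le> bump c s y" and bump_pos: "y \<in> ball c s \<Longrightarrow> 0 < bump c s y"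
  and bump_outside: "0 \<le> s \<Longrightarrow> y \<notin> ball c s \<Longrightarrow> bump c s y = 0"
proof -
  show "0 \<le> bump c s y" by (simp add: bump_def)
  show "0 < bump c s y" if "y \<in> ball c s"
  proof -
    have "norm (y - c) < s" using that by (simp add: dist_norm norm_minus_commute)
    then have "(norm (y - c))\<^sup>2 < s\<^sup>2" by (intro power_strict_mono) auto
    then show ?thesis by (simp add: bump_def)
  qed
  show "bump c s y = 0" if "0 \<le> s" "y \<notin> ball c s"
  proof -
    have "s \<le> norm (y - c)" using that by (simp add: dist_norm norm_minus_commute)
    then have "s\<^sup>2 \<le> (norm (y - c))\<^sup>2" using that by (intro power_mono) auto
    then show ?thesis by (simp add: bump_def)
  qed
qed

text \<open>
  Near a boundary point \<open>\<rho> / |D\<rho>|\<close> vanishes on the boundary and has the inward normal as gradient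
  there. Multiplying it by a bump function supported in the domain of \<open>\<rho>\<close> makes it global. Around an interior
  point the bump function does not reach the boundary, and \<open>h = 0\<close> will do.
\<close>

lemma local_normal_function:
  fixes \<Omega> :: "(real^'n) set"
  assumes \<Omega>: "open \<Omega>" "smooth_boundary \<Omega>" "cone_condition (closure \<Omega>)" and x: "x \<in> closure \<Omega>"
  obtains s h where "0 < s" "Ck_on 3 (closure \<Omega>) h" "\<And>y. y \<in> frontier \<Omega> \<Longrightarrow> h y = 0"
    "\<And>y. y \<in> frontier \<Omega> \<Longrightarrow>
       (h has_derivative (\<lambda>v. bump x s y * (inward_normal \<Omega> y \<bullet> v))) (at y within closure \<Omega>)"
proof (cases "x \<in> \<Omega>")
  case True
  then obtain s where s: "s > 0" "ball x s \<subseteq> \<Omega>" using \<Omega>(1) by (meson open_contains_ball)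
  have "bump x s y = 0" if "y \<in> frontier \<Omega>" for y
    using that s \<Omega>(1) by (intro bump_outside) (auto simp: frontier_def interior_open)
  then show ?thesis by (intro that[of s "\<lambda>y. 0"]) (use s \<Omega> in \<open>auto intro: Ck_on_const\<close>)
next
  case False
  let ?K = "closure \<Omega>"
  have "x \<in> frontier \<Omega>" using False x \<Omega>(1) by (simp add: frontier_def interior_open)
  then obtain U \<rho> where xU: "x \<in> U" and ldf: "local_defining_function \<Omega> U \<rho>"
    using \<Omega>(2) by (auto simp: smooth_boundary_def)
  have U: "open U" and smooth: "\<And>k. Ck_on k U \<rho>" and G0: "\<And>y. y \<in> U \<Longrightarrow> grad_on U \<rho> y \<noteq> 0"
    using ldf by (auto simp: local_defining_function_def smooth_on_def)
  obtain s where s: "s > 0" "cball x s \<subseteq> U" using U xU by (meson open_contains_cball)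
  define q where "q y = norm (grad_on U \<rho> y) powr (- 1)" for y
  have coneU: "cone_condition U" by (rule cone_condition_open[OF U])
  have qU: "Ck_on 3 U q"
  proof -
    have C: "Ck_on 3 U (\<lambda>y. (\<Sum>i\<in>UNIV. dderiv_on U (axis i 1) \<rho> y * dderiv_on U (axis i 1) \<rho> y) powr (- 1 / 2))"
    proof (intro Ck_on_powr Ck_on_sum Ck_on_mult coneU Ck_on_SucD(2) smooth)
      fix y assume "y \<in> U"
      then have "0 < (norm (grad_on U \<rho> y))\<^sup>2" using G0 by simp
      then show "0 < (\<Sum>i\<in>UNIV. dderiv_on U (axis i 1) \<rho> y * dderiv_on U (axis i 1) \<rho> y)"
        by (simp add: power2_norm_eq_inner inner_vec_def grad_on_def)
    qed
    have eq: "(\<Sum>i\<in>UNIV. dderiv_on U (axis i 1) \<rho> y * dderiv_on U (axis i 1) \<rho> y) powr (- 1 / 2) = q y" if "y \<in> U" for y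
    proof -
      have "(\<Sum>i\<in>UNIV. dderiv_on U (axis i 1) \<rho> y * dderiv_on U (axis i 1) \<rho> y) = (norm (grad_on U \<rho> y))\<^sup>2"
        by (simp add: power2_norm_eq_inner inner_vec_def grad_on_def)
      also have "\<dots> = norm (grad_on U \<rho> y) powr 2" using G0[OF that] by simp
      finally show ?thesis unfolding q_def by (simp only: powr_powr) simp
    qed
    show ?thesis by (rule Ck_on_cong[THEN iffD1, OF eq C])
  qed
  define h where "h y = \<rho> y * (q y * bump x s y)" for y
  have hU: "Ck_on 3 U h" unfolding h_def[abs_def] by (intro Ck_on_mult coneU smooth qU Ck_on_bump)
  have out: "h y = 0" if "y \<notin> cball x s" for y using that s by (simp add: h_def bump_outside)
  show ?thesis
  proof (rule that[OF s(1)])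
    show "Ck_on 3 ?K h"
    proof (rule Ck_on_local[OF \<Omega>(3)])
      fix y assume "y \<in> ?K"
      show "\<exists>V. open V \<and> y \<in> V \<and> Ck_on 3 (?K \<inter> V) h"
      proof (cases "y \<in> U")
        case True
        have "Ck_on 3 (?K \<inter> U) h"
          by (rule Ck_on_subset[OF cone_condition_Int_open[OF \<Omega>(3) U] _ hU]) simp
        then show ?thesis using U True by blast
      next
        case False
        let ?V = "- cball x s"
        have V: "open ?V" by (simp add: open_Compl)
        have "Ck_on 3 (?K \<inter> ?V) (\<lambda>y. 0) \<longleftrightarrow> Ck_on 3 (?K \<inter> ?V) h" by (rule Ck_on_cong) (simp add: out)
        then have "Ck_on 3 (?K \<inter> ?V) h" using Ck_on_const cone_condition_Int_open[OF \<Omega>(3) V] by blast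
        then show ?thesis using V False s by blast
      qed
    qed
    show "h y = 0" if y: "y \<in> frontier \<Omega>" for y
    proof (cases "y \<in> U")
      case True
      then show ?thesis using local_defining_function_facts(3)[OF ldf True \<Omega>(1) y] by (simp add: h_def)
    next
      case False
      then show ?thesis using s(2) by (intro out) blast
    qed
    show "(h has_derivative (\<lambda>v. bump x s y * (inward_normal \<Omega> y \<bullet> v))) (at y within ?K)"
      if y: "y \<in> frontier \<Omega>" for y
    proof (cases "y \<in> U")
      case True
      have int: "y \<in> interior U" using True U by (simp add: interior_open)
      have z: "\<rho> y = 0" by (rule local_defining_function_facts(3)[OF ldf True \<Omega>(1) y])
      have "Ck_on (Suc 2) U (\<lambda>y. q y * bump x s y)"
        using Ck_on_mult[OF coneU qU Ck_on_bump[OF coneU]] by (simp add: numeral_3_eq_3 numeral_2_eq_2)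
      note has_derivative_mult[OF local_defining_function_facts(1)[OF ldf True] Ck_on_has_derivative_at[OF this int]]
      moreover have "\<rho> y * d + (grad_on U \<rho> y \<bullet> v) * (q y * bump x s y) = bump x s y * (inward_normal \<Omega> y \<bullet> v)" for d v
        unfolding inward_normal_eq[OF ldf True \<Omega>(1) y]
        using G0[OF True] by (simp add: z q_def sgn_div_norm powr_minus)
      ultimately have "(h has_derivative (\<lambda>v. bump x s y * (inward_normal \<Omega> y \<bullet> v))) (at y)"
        by (simp add: h_def[abs_def])
      then show ?thesis by (rule has_derivative_at_withinI)
    next
      case False
      then have yV: "y \<in> - cball x s" using s by blast
      then have "y \<notin> ball x s" using ball_subset_cball by blast
      then have "bump x s y = 0" using s by (simp add: bump_outside)
      moreover have "(h has_derivative (\<lambda>v. 0)) (at y)"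
        by (rule has_derivative_transform_within_open[OF has_derivative_const[of 0] _ yV])
          (auto simp: out open_Compl)
      ultimately show ?thesis by (simp add: has_derivative_at_withinI)
    qed
  qed
qed

text \<open>
  Let \<open>H\<close> and \<open>B\<close> be the sums of the local normal functions and of their bump functions over a finite
  cover. On the boundary \<open>H = 0\<close> and \<open>DH = B * N\<close>, hence \<open>g = H * \<phi> / B\<close> has gradient \<open>\<phi> * N\<close> there.
\<close>

lemma neumann_extension:
  fixes \<Omega> :: "(real^'n) set"
  assumes \<Omega>: "open \<Omega>" "bounded \<Omega>" "smooth_boundary \<Omega>" "cone_condition (closure \<Omega>)"
    and \<phi>: "Ck_on 3 (closure \<Omega>) \<phi>"
  obtains g where "Ck_on 3 (closure \<Omega>) g"
    "\<And>x v. x \<in> frontier \<Omega> \<Longrightarrow> dderiv_on (closure \<Omega>) v g x = \<phi> x * (inward_normal \<Omega> x \<bullet> v)"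
proof -
  let ?K = "closure \<Omega>"
  define P where "P x s h \<longleftrightarrow> 0 < s \<and> Ck_on 3 ?K h \<and> (\<forall>y\<in>frontier \<Omega>. h y = 0 \<and>
      (h has_derivative (\<lambda>v. bump x s y * (inward_normal \<Omega> y \<bullet> v))) (at y within ?K))" for x s h
  have "\<exists>s h. P x s h" if "x \<in> ?K" for x
  proof (rule local_normal_function[OF \<Omega>(1,3,4) that])
    fix s h assume "0 < s" "Ck_on 3 ?K h" "\<And>y. y \<in> frontier \<Omega> \<Longrightarrow> h y = 0"
      "\<And>y. y \<in> frontier \<Omega> \<Longrightarrow>
        (h has_derivative (\<lambda>v. bump x s y * (inward_normal \<Omega> y \<bullet> v))) (at y within ?K)"
    then show ?thesis by (intro exI[of _ s] exI[of _ h]) (simp add: P_def)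
  qed
  then obtain s h where P: "\<And>x. x \<in> ?K \<Longrightarrow> P x (s x) (h x)" by metis
  have sh: "\<And>x. x \<in> ?K \<Longrightarrow> 0 < s x" "\<And>x. x \<in> ?K \<Longrightarrow> Ck_on 3 ?K (h x)"
      "\<And>x y. x \<in> ?K \<Longrightarrow> y \<in> frontier \<Omega> \<Longrightarrow> h x y = 0"
      "\<And>x y. x \<in> ?K \<Longrightarrow> y \<in> frontier \<Omega> \<Longrightarrow>
        (h x has_derivative (\<lambda>v. bump x (s x) y * (inward_normal \<Omega> y \<bullet> v))) (at y within ?K)"
    using P by (auto simp only: P_def)
  have "compact ?K" using \<Omega>(2) by (simp add: compact_closure)
  moreover have "?K \<subseteq> (\<Union>x\<in>?K. ball x (s x))" using sh(1) by force
  ultimately obtain X where X: "X \<subseteq> ?K" "finite X" "?K \<subseteq> (\<Union>x\<in>X. ball x (s x))"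
    using compactE_image[of ?K ?K "\<lambda>x. ball x (s x)"] by (metis open_ball)
  define B where "B y = (\<Sum>x\<in>X. bump x (s x) y)" for y
  define H where "H y = (\<Sum>x\<in>X. h x y)" for y
  have Bpos: "0 < B y" if y: "y \<in> ?K" for y
  proof -
    obtain x where x: "x \<in> X" "y \<in> ball x (s x)" using X(3) y by auto
    then have "0 < bump x (s x) y" by (simp add: bump_pos)
    also have "\<dots> \<le> B y" unfolding B_def using x X bump_nonneg by (intro member_le_sum) auto
    finally show ?thesis .
  qed
  have BC: "Ck_on 3 ?K B" unfolding B_def[abs_def] by (intro Ck_on_sum Ck_on_bump \<Omega>)
  have HC: "Ck_on 3 ?K H" unfolding H_def[abs_def] using X sh(2) by (intro Ck_on_sum \<Omega>) auto
  define g where "g y = H y * (\<phi> y * B y powr (- 1))" for y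
  have PC: "Ck_on 3 ?K (\<lambda>y. \<phi> y * B y powr (- 1))" using \<phi> BC Bpos by (intro Ck_on_mult Ck_on_powr \<Omega>)
  show ?thesis
  proof (rule that)
    show "Ck_on 3 ?K g" unfolding g_def[abs_def] by (rule Ck_on_mult[OF \<Omega>(4) HC PC])
    fix y v assume y: "y \<in> frontier \<Omega>"
    have yK: "y \<in> ?K" using y by (simp add: frontier_def)
    have "(H has_derivative (\<lambda>v. \<Sum>x\<in>X. bump x (s x) y * (inward_normal \<Omega> y \<bullet> v))) (at y within ?K)"
      unfolding H_def[abs_def] using sh(4) X y by (intro has_derivative_sum) auto
    then have HD: "(H has_derivative (\<lambda>v. B y * (inward_normal \<Omega> y \<bullet> v))) (at y within ?K)"
      by (simp add: B_def sum_distrib_right)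
    have H0: "H y = 0" unfolding H_def using sh(3) X y by (intro sum.neutral) auto
    have "Ck_on (Suc 2) ?K (\<lambda>y. \<phi> y * B y powr (- 1))" using PC by (simp add: numeral_3_eq_3 numeral_2_eq_2)
    from has_derivative_mult[OF HD Ck_on_SucD(1)[OF this yK]]
    have "(g has_derivative (\<lambda>v. B y * (inward_normal \<Omega> y \<bullet> v) * (\<phi> y * B y powr (- 1)))) (at y within ?K)"
      by (simp add: g_def[abs_def] H0)
    from dderiv_on_eqI[OF \<Omega>(4) yK this]
    show "dderiv_on ?K v g y = \<phi> y * (inward_normal \<Omega> y \<bullet> v)"
      using Bpos[OF yK] by (simp add: powr_minus field_simps)
  qed
qed


section \<open>The two-point maximum principle\<close>

lemma second_derivative_local_max_le_0:
  fixes f :: "real \<Rightarrow> real"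
  assumes d: "0 < d" and f: "\<And>s. \<bar>s\<bar> < d \<Longrightarrow> (f has_real_derivative f' s) (at s)"
    and f': "(f' has_real_derivative f2) (at 0)" and max: "\<And>s. \<bar>s\<bar> < d \<Longrightarrow> f s \<le> f 0"
  shows "f' 0 = 0" "f2 \<le> 0"
proof -
  show f'0: "f' 0 = 0" by (rule DERIV_local_max[OF f d]) (use d max in auto)
  show "f2 \<le> 0"
  proof (rule ccontr)
    assume "\<not> f2 \<le> 0"
    then obtain e where e: "e > 0" "\<And>h. 0 < h \<Longrightarrow> h < e \<Longrightarrow> 0 < f' h"
      using DERIV_pos_inc_right[OF f'] f'0 by auto
    define s where "s = min d e / 2"
    have s: "0 < s" "s < d" "s < e" using d e by (auto simp: s_def)
    have der: "(f has_real_derivative f' t) (at t)" if "0 \<le> t" "t \<le> s" for t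
      using that s by (intro f) auto
    obtain z where "0 < z" "z < s" "f s - f 0 = (s - 0) * f' z"
      using MVT2[OF s(1) der] by auto
    moreover from this have "0 < s * f' z" using e(2)[of z] s by simp
    ultimately have "f s > f 0" by simp
    then show False using max[of s] s by simp
  qed
qed

lemma one_sided_derivative_at_max_le_0:
  fixes f :: "real \<Rightarrow> real"
  assumes "0 < d" "(f has_real_derivative D) (at 0 within {0..d})" "\<And>s. s \<in> {0..d} \<Longrightarrow> f s \<le> f 0"
  shows "D \<le> 0"
proof (rule ccontr)
  assume "\<not> D \<le> 0"
  then obtain q where q: "q > 0" "\<And>h. 0 < h \<Longrightarrow> 0 + h \<in> {0..d} \<Longrightarrow> h < q \<Longrightarrow> f 0 < f (0 + h)"
    using has_real_derivative_pos_inc_right[OF assms(2)] by auto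
  have "f 0 < f (min d q / 2)" using q(2)[of "min d q / 2"] q(1) assms(1) by auto
  moreover have "f (min d q / 2) \<le> f 0" using assms(1) q(1) by (intro assms(3)) auto
  ultimately show False by simp
qed

text \<open>
  When \<open>x\<close> and \<open>y\<close> move in parallel, their distance is constant and the modulus is, for \<open>\<alpha> > 0\<close>, strictly concave through its
  dependence on the midpoint. This concavity is the only source of negativity in the interior estimate.
\<close>

definition two_point_modulus :: "real \<Rightarrow> real \<Rightarrow> 'a::real_inner \<Rightarrow> 'a \<Rightarrow> real" where
  "two_point_modulus \<alpha> L x y = L * norm (x - y) * (1 - \<alpha> * (norm (midpoint x y))\<^sup>2)"

text \<open>
  The first and second derivative of the modulus when \<open>x\<close> moves along \<open>\<xi>\<close> and \<open>y\<close> along \<open>\<zeta>\<close>, the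
  second one up to a nonnegative term: it contains the full squared length of \<open>\<xi> - \<zeta>\<close> where the exact derivative
  has that of its part orthogonal to \<open>x - y\<close>.
\<close>

definition modulus_d1 :: "real \<Rightarrow> real \<Rightarrow> 'a::real_inner \<Rightarrow> 'a \<Rightarrow> 'a \<Rightarrow> 'a \<Rightarrow> real" where
  "modulus_d1 \<alpha> L x y \<xi> \<zeta> = L * ((sgn (x - y) \<bullet> (\<xi> - \<zeta>)) * (1 - \<alpha> * (norm (midpoint x y))\<^sup>2)
     - \<alpha> * norm (x - y) * (midpoint x y \<bullet> (\<xi> + \<zeta>)))"

definition modulus_d2 :: "real \<Rightarrow> real \<Rightarrow> 'a::real_inner \<Rightarrow> 'a \<Rightarrow> 'a \<Rightarrow> 'a \<Rightarrow> real" where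
  "modulus_d2 \<alpha> L x y \<xi> \<zeta> = L * ((norm (\<xi> - \<zeta>))\<^sup>2 / norm (x - y) * (1 - \<alpha> * (norm (midpoint x y))\<^sup>2)
     - 2 * \<alpha> * (sgn (x - y) \<bullet> (\<xi> - \<zeta>)) * (midpoint x y \<bullet> (\<xi> + \<zeta>)) - \<alpha> / 2 * norm (x - y) * (norm (\<xi> + \<zeta>))\<^sup>2)"

text \<open>
  A polynomial upper bound, exact at \<open>s = 0\<close>, for the modulus along a pair of lines. At a maximum it may
  replace the modulus itself, which avoids differentiating the norm.
\<close>

definition modulus_majorant :: "real \<Rightarrow> real \<Rightarrow> 'a::real_inner \<Rightarrow> 'a \<Rightarrow> 'a \<Rightarrow> 'a \<Rightarrow> real \<Rightarrow> real" where
  "modulus_majorant \<alpha> L x y \<xi> \<zeta> s =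
     L * (norm (x - y) + s * (sgn (x - y) \<bullet> (\<xi> - \<zeta>)) + s\<^sup>2 * ((norm (\<xi> - \<zeta>))\<^sup>2 / (2 * norm (x - y)))) *
     (1 - \<alpha> * ((norm (midpoint x y))\<^sup>2 + s * (midpoint x y \<bullet> (\<xi> + \<zeta>)) + s\<^sup>2 * ((norm (\<xi> + \<zeta>))\<^sup>2 / 4)))"

lemma modulus_majorant_0: "modulus_majorant \<alpha> L x y \<xi> \<zeta> 0 = two_point_modulus \<alpha> L x y"
  by (simp add: modulus_majorant_def two_point_modulus_def)

text \<open>
  With \<open>r = |v|\<close> and \<open>n\<close> the left-hand side, this is \<open>2 * r * n \<le> n\<^sup>2 + r\<^sup>2\<close> with \<open>n\<^sup>2\<close> expanded.
\<close>

lemma norm_add_scaleR_le: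
  fixes v d :: "'a::real_inner"
  assumes "v \<noteq> 0"
  shows "norm (v + s *\<^sub>R d) \<le> norm v + s * (sgn v \<bullet> d) + s\<^sup>2 * ((norm d)\<^sup>2 / (2 * norm v))"
proof -
  define r where "r = norm v"
  have r: "r > 0" using assms by (simp add: r_def)
  have vd: "v \<bullet> d = r * (sgn v \<bullet> d)" using assms by (simp add: r_def sgn_div_norm)
  have sq: "(norm (v + s *\<^sub>R d))\<^sup>2 = r\<^sup>2 + 2 * s * (r * (sgn v \<bullet> d)) + s\<^sup>2 * (norm d)\<^sup>2"
    unfolding power2_norm_eq_inner r_def using vd[unfolded r_def]
    by (simp add: inner_simps inner_commute power2_eq_square algebra_simps)
  define n where "n = norm (v + s *\<^sub>R d)"
  have "2 * r * n \<le> n\<^sup>2 + r\<^sup>2" using sum_squares_bound[of r n] by (simp add: add.commute)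
  also have "\<dots> = 2 * r * (r + s * (sgn v \<bullet> d) + s\<^sup>2 * ((norm d)\<^sup>2 / (2 * r)))"
    using r unfolding n_def sq by (simp add: field_simps power2_eq_square)
  finally show ?thesis using r by (simp add: n_def r_def)
qed

lemma two_point_modulus_le_majorant:
  assumes "x \<noteq> y" "0 \<le> L" "\<alpha> * (norm (midpoint (x + s *\<^sub>R \<xi>) (y + s *\<^sub>R \<zeta>)))\<^sup>2 \<le> 1"
  shows "two_point_modulus \<alpha> L (x + s *\<^sub>R \<xi>) (y + s *\<^sub>R \<zeta>) \<le> modulus_majorant \<alpha> L x y \<xi> \<zeta> s"
proof -
  have eq: "(x + s *\<^sub>R \<xi>) - (y + s *\<^sub>R \<zeta>) = (x - y) + s *\<^sub>R (\<xi> - \<zeta>)" by (simp add: algebra_simps)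
  have 1: "norm ((x + s *\<^sub>R \<xi>) - (y + s *\<^sub>R \<zeta>)) \<le> norm (x - y) + s * (sgn (x - y) \<bullet> (\<xi> - \<zeta>))
      + s\<^sup>2 * ((norm (\<xi> - \<zeta>))\<^sup>2 / (2 * norm (x - y)))"
    unfolding eq using norm_add_scaleR_le[of "x - y" s "\<xi> - \<zeta>"] assms(1) by simp
  have meq: "midpoint (x + s *\<^sub>R \<xi>) (y + s *\<^sub>R \<zeta>) = midpoint x y + (s / 2) *\<^sub>R (\<xi> + \<zeta>)"
    by (simp add: midpoint_def algebra_simps scaleR_add_right)
  have 2: "(norm (midpoint (x + s *\<^sub>R \<xi>) (y + s *\<^sub>R \<zeta>)))\<^sup>2 =
      (norm (midpoint x y))\<^sup>2 + s * (midpoint x y \<bullet> (\<xi> + \<zeta>)) + s\<^sup>2 * ((norm (\<xi> + \<zeta>))\<^sup>2 / 4)"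
    unfolding meq power2_norm_eq_inner
    by (simp add: inner_add_left inner_add_right inner_commute power2_eq_square field_simps)
  show ?thesis
    unfolding two_point_modulus_def modulus_majorant_def 2[symmetric]
    using 1 assms(2,3) by (intro mult_right_mono mult_left_mono) auto
qed

definition modulus_majorant_slope :: "real \<Rightarrow> real \<Rightarrow> 'a::real_inner \<Rightarrow> 'a \<Rightarrow> 'a \<Rightarrow> 'a \<Rightarrow> real \<Rightarrow> real" where
  "modulus_majorant_slope \<alpha> L x y \<xi> \<zeta> s =
     L * ((sgn (x - y) \<bullet> (\<xi> - \<zeta>)) + 2 * s * ((norm (\<xi> - \<zeta>))\<^sup>2 / (2 * norm (x - y)))) *
     (1 - \<alpha> * ((norm (midpoint x y))\<^sup>2 + s * (midpoint x y \<bullet> (\<xi> + \<zeta>)) + s\<^sup>2 * ((norm (\<xi> + \<zeta>))\<^sup>2 / 4)))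
     - L * (norm (x - y) + s * (sgn (x - y) \<bullet> (\<xi> - \<zeta>)) + s\<^sup>2 * ((norm (\<xi> - \<zeta>))\<^sup>2 / (2 * norm (x - y)))) *
     (\<alpha> * ((midpoint x y \<bullet> (\<xi> + \<zeta>)) + 2 * s * ((norm (\<xi> + \<zeta>))\<^sup>2 / 4)))"

lemma modulus_majorant_slope_0: "modulus_majorant_slope \<alpha> L x y \<xi> \<zeta> 0 = modulus_d1 \<alpha> L x y \<xi> \<zeta>"
  by (simp add: modulus_majorant_slope_def modulus_d1_def algebra_simps)

lemma DERIV_modulus_majorant:
  "(modulus_majorant \<alpha> L x y \<xi> \<zeta> has_real_derivative modulus_majorant_slope \<alpha> L x y \<xi> \<zeta> s) (at s within S)"
  unfolding modulus_majorant_def[abs_def]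
  by (rule derivative_eq_intros refl)+ (simp add: modulus_majorant_slope_def algebra_simps)

lemma DERIV_modulus_majorant_slope:
  assumes "x \<noteq> y"
  shows "(modulus_majorant_slope \<alpha> L x y \<xi> \<zeta> has_real_derivative modulus_d2 \<alpha> L x y \<xi> \<zeta>) (at 0)"
  unfolding modulus_majorant_slope_def[abs_def]
  by (rule derivative_eq_intros refl)+ (use assms in \<open>simp add: modulus_d2_def field_simps\<close>)

lemma modulus_d1_swap: "modulus_d1 \<alpha> L x y 0 v = modulus_d1 \<alpha> L y x v 0"
proof -
  have "sgn (x - y) = - sgn (y - x)" by (metis minus_diff_eq sgn_minus)
  then show ?thesis by (simp add: modulus_d1_def midpoint_sym norm_minus_commute)
qed

text \<open>
  The functions \<open>w x t - w y t\<close> and the modulus are compared at a maximum point \<open>(X, Y, \<tau>)\<close> of their difference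
  minus \<open>\<epsilon> * t\<close>. The hypothesis \<open>boundary\<close> excludes that \<open>X\<close> or \<open>Y\<close> lies on the boundary, and
  the hypothesis \<open>interior\<close> contradicts the sign of the time derivative; the small multiple of \<open>t\<close> makes the
  weak inequality there sufficient.
\<close>

lemma two_point_maximum_principle:
  fixes \<Omega> :: "(real^'n) set" and w w\<^sub>t :: "real^'n \<Rightarrow> real \<Rightarrow> real"
  assumes \<Omega>: "open \<Omega>" "bounded \<Omega>" "smooth_boundary \<Omega>"
    and \<alpha>: "\<And>x. x \<in> closure \<Omega> \<Longrightarrow> norm x \<le> R" "0 \<le> \<alpha>" "\<alpha> * R\<^sup>2 \<le> 1" and L: "0 \<le> L"
    and cont: "continuous_on (closure \<Omega> \<times> {0..T}) (\<lambda>(x, t). w x t)"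
    and C2: "\<And>t. t \<in> {0..T} \<Longrightarrow> Ck_on 2 (closure \<Omega>) (\<lambda>x. w x t)"
    and time: "\<And>x t. x \<in> \<Omega> \<Longrightarrow> t \<in> {0..T} \<Longrightarrow> (w x has_real_derivative w\<^sub>t x t) (at t within {0..T})"
    and init: "\<And>x y. x \<in> closure \<Omega> \<Longrightarrow> y \<in> closure \<Omega> \<Longrightarrow> w x 0 - w y 0 \<le> two_point_modulus \<alpha> L x y"
    and boundary: "\<And>x y t. x \<in> frontier \<Omega> \<Longrightarrow> y \<in> closure \<Omega> \<Longrightarrow> y \<noteq> x \<Longrightarrow> t \<in> {0..T} \<Longrightarrow>
        \<bar>dderiv_on (closure \<Omega>) (inward_normal \<Omega> x) (\<lambda>x. w x t) x\<bar> < - modulus_d1 \<alpha> L x y (inward_normal \<Omega> x) 0"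
    and interior: "\<And>x y t. x \<in> \<Omega> \<Longrightarrow> y \<in> \<Omega> \<Longrightarrow> x \<noteq> y \<Longrightarrow> t \<in> {0..T} \<Longrightarrow>
        (\<And>v. dderiv_on (closure \<Omega>) v (\<lambda>x. w x t) x = modulus_d1 \<alpha> L x y v 0) \<Longrightarrow>
        (\<And>v. dderiv_on (closure \<Omega>) v (\<lambda>x. w x t) y = - modulus_d1 \<alpha> L x y 0 v) \<Longrightarrow>
        (\<And>\<xi> \<zeta>. dderiv_on (closure \<Omega>) \<xi> (dderiv_on (closure \<Omega>) \<xi> (\<lambda>x. w x t)) x
            - dderiv_on (closure \<Omega>) \<zeta> (dderiv_on (closure \<Omega>) \<zeta> (\<lambda>x. w x t)) y \<le> modulus_d2 \<alpha> L x y \<xi> \<zeta>) \<Longrightarrow>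
        w\<^sub>t x t \<le> w\<^sub>t y t"
    and xyt: "x \<in> closure \<Omega>" "y \<in> closure \<Omega>" "t \<in> {0..T}"
  shows "w x t - w y t \<le> two_point_modulus \<alpha> L x y"
proof (rule field_le_epsilon)
  fix e :: real assume e: "e > 0"
  let ?K = "closure \<Omega>"
  \<comment> \<open>Chosen such that \<open>\<epsilon> * t\<close> stays below \<open>e\<close> up to time \<open>T\<close>.\<close>
  define \<epsilon> where "\<epsilon> = e / (T + 1)"
  have T: "0 \<le> T" using xyt by simp
  have \<epsilon>: "\<epsilon> > 0" using e T by (simp add: \<epsilon>_def)
  define Z where "Z x y t = w x t - w y t - two_point_modulus \<alpha> L x y - \<epsilon> * t" for x y t
  have comp: "compact (?K \<times> ?K \<times> {0..T})"
    using \<Omega>(2) by (intro compact_Times) (auto simp: compact_closure)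
  have contx: "continuous_on (?K \<times> ?K \<times> {0..T}) (\<lambda>p. w (fst p) (snd (snd p)))"
    using continuous_on_compose2[OF cont, of "?K \<times> ?K \<times> {0..T}" "\<lambda>p. (fst p, snd (snd p))"]
    by (force intro!: continuous_intros)
  have conty: "continuous_on (?K \<times> ?K \<times> {0..T}) (\<lambda>p. w (fst (snd p)) (snd (snd p)))"
  proof -
    have c: "continuous_on (?K \<times> ?K \<times> {0..T}) (\<lambda>p. (fst (snd p), snd (snd p)))" by (intro continuous_intros)
    have s: "(\<lambda>p. (fst (snd p), snd (snd p))) ` (?K \<times> ?K \<times> {0..T}) \<subseteq> ?K \<times> {0..T}" by auto
    show ?thesis using continuous_on_compose2[OF cont c s] by (simp only: prod.case)
  qed
  have dom_ne: "?K \<times> ?K \<times> {0..T} \<noteq> {}" using xyt by blast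
  have "continuous_on (?K \<times> ?K \<times> {0..T}) (\<lambda>p. Z (fst p) (fst (snd p)) (snd (snd p)))"
    unfolding Z_def two_point_modulus_def midpoint_def by (intro continuous_intros contx conty)
  then obtain p where p: "p \<in> ?K \<times> ?K \<times> {0..T}"
      "\<And>q. q \<in> ?K \<times> ?K \<times> {0..T} \<Longrightarrow> Z (fst q) (fst (snd q)) (snd (snd q)) \<le> Z (fst p) (fst (snd p)) (snd (snd p))"
    using continuous_attains_sup[OF comp dom_ne] by blast
  obtain X Y \<tau> where peq: "p = (X, Y, \<tau>)" by (cases p)
  have XY: "X \<in> ?K" "Y \<in> ?K" "\<tau> \<in> {0..T}" using p(1) peq by auto
  have max: "Z x y t \<le> Z X Y \<tau>" if "x \<in> ?K" "y \<in> ?K" "t \<in> {0..T}" for x y t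
    using p(2)[of "(x, y, t)"] that peq by simp
  have "Z X Y \<tau> \<le> 0"
  proof (rule ccontr)
    assume pos: "\<not> Z X Y \<tau> \<le> 0"
    have \<tau>: "0 < \<tau>" "\<tau> \<le> T" using init[OF XY(1,2)] pos XY(3) by (cases "\<tau> = 0"; auto simp: Z_def)+
    \<comment> \<open>On the diagonal the difference is at most \<open>0\<close>.\<close>
    have ne: "X \<noteq> Y" using pos \<tau> \<epsilon> by (auto simp: Z_def two_point_modulus_def)
    have mid: "\<alpha> * (norm (midpoint x y))\<^sup>2 \<le> 1" if "x \<in> ?K" "y \<in> ?K" for x y
    proof -
      have "norm (midpoint x y) \<le> (norm x + norm y) / 2"
        using norm_triangle_ineq[of x y] by (simp add: midpoint_def)
      also have "\<dots> \<le> R" using \<alpha>(1)[OF that(1)] \<alpha>(1)[OF that(2)] by simp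
      finally have "(norm (midpoint x y))\<^sup>2 \<le> R\<^sup>2" by (intro power_mono) auto
      then have "\<alpha> * (norm (midpoint x y))\<^sup>2 \<le> \<alpha> * R\<^sup>2" using \<alpha>(2) by (rule mult_left_mono)
      then show ?thesis using \<alpha>(3) by linarith
    qed
    have maj: "w (X + s *\<^sub>R \<xi>) \<tau> - w (Y + s *\<^sub>R \<zeta>) \<tau> - modulus_majorant \<alpha> L X Y \<xi> \<zeta> s
        \<le> w X \<tau> - w Y \<tau> - modulus_majorant \<alpha> L X Y \<xi> \<zeta> 0"
      if "X + s *\<^sub>R \<xi> \<in> ?K" "Y + s *\<^sub>R \<zeta> \<in> ?K" for \<xi> \<zeta> s
      using max[OF that XY(3)] two_point_modulus_le_majorant[OF ne L mid[OF that]]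
      unfolding Z_def modulus_majorant_0 by linarith
    have C: "Ck_on (Suc (Suc 0)) ?K (\<lambda>x. w x \<tau>)" using C2[OF XY(3)] by (simp add: numeral_2_eq_2)
    let ?w = "\<lambda>x. w x \<tau>"
    have inward: "\<exists>d>0. \<forall>s\<in>{0..d}. x + s *\<^sub>R inward_normal \<Omega> x \<in> ?K" if x: "x \<in> frontier \<Omega>" for x
    proof -
      have "0 < inward_normal \<Omega> x \<bullet> inward_normal \<Omega> x"
        using norm_inward_normal[OF \<Omega>(1,3) x] by (simp add: dot_square_norm)
      then obtain d where d: "d > 0" "\<And>s. 0 < s \<Longrightarrow> s < d \<Longrightarrow> x + s *\<^sub>R inward_normal \<Omega> x \<in> \<Omega>"
        using inward_normal_directions(1)[OF \<Omega>(1,3) x] by blast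
      have "x + s *\<^sub>R inward_normal \<Omega> x \<in> ?K" if "s \<in> {0..d/2}" for s
      proof (cases "s = 0")
        case True then show ?thesis using x by (simp add: frontier_def)
      next
        case False
        then have "x + s *\<^sub>R inward_normal \<Omega> x \<in> \<Omega>" using that d(1) by (intro d(2)) auto
        then show ?thesis using closure_subset by blast
      qed
      then show ?thesis using d(1) by (intro exI[of _ "d/2"]) auto
    qed
    have X: "X \<in> \<Omega>"
    proof (rule ccontr)
      assume "X \<notin> \<Omega>"
      then have Xf: "X \<in> frontier \<Omega>" using XY(1) \<Omega>(1) by (simp add: frontier_def interior_open)
      define N where "N = inward_normal \<Omega> X"
      obtain d where d: "d > 0" "\<And>s. s \<in> {0..d} \<Longrightarrow> X + s *\<^sub>R N \<in> ?K" using inward[OF Xf] by (auto simp: N_def)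
      define f where "f s = w (X + s *\<^sub>R N) \<tau> - w Y \<tau> - modulus_majorant \<alpha> L X Y N 0 s" for s
      have "(f has_real_derivative (dderiv_on ?K N ?w X - 0) - modulus_d1 \<alpha> L X Y N 0) (at 0 within {0..d})"
        unfolding f_def
        by (intro DERIV_diff DERIV_const DERIV_modulus_majorant[of _ _ _ _ _ _ 0, unfolded modulus_majorant_slope_0]
            has_real_derivative_along_segment[OF Ck_on_SucD(1)[OF C XY(1)]] d(2))
      moreover have "dderiv_on ?K N ?w X - 0 - modulus_d1 \<alpha> L X Y N 0 > 0"
        using boundary[OF Xf XY(2) _ XY(3)] ne by (auto simp: N_def)
      moreover have "f s \<le> f 0" if "s \<in> {0..d}" for s using maj[of s N 0] d(2)[OF that] XY(2) by (simp add: f_def)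
      ultimately show False using one_sided_derivative_at_max_le_0[OF d(1), of f] by fastforce
    qed
    have Y: "Y \<in> \<Omega>"
    proof (rule ccontr)
      assume "Y \<notin> \<Omega>"
      then have Yf: "Y \<in> frontier \<Omega>" using XY(2) \<Omega>(1) by (simp add: frontier_def interior_open)
      define N where "N = inward_normal \<Omega> Y"
      obtain d where d: "d > 0" "\<And>s. s \<in> {0..d} \<Longrightarrow> Y + s *\<^sub>R N \<in> ?K" using inward[OF Yf] by (auto simp: N_def)
      define f where "f s = w X \<tau> - w (Y + s *\<^sub>R N) \<tau> - modulus_majorant \<alpha> L X Y 0 N s" for s
      have "(f has_real_derivative (0 - dderiv_on ?K N ?w Y) - modulus_d1 \<alpha> L X Y 0 N) (at 0 within {0..d})"
        unfolding f_def
        by (intro DERIV_diff DERIV_const DERIV_modulus_majorant[of _ _ _ _ _ _ 0, unfolded modulus_majorant_slope_0]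
            has_real_derivative_along_segment[OF Ck_on_SucD(1)[OF C XY(2)]] d(2))
      moreover have "0 - dderiv_on ?K N ?w Y - modulus_d1 \<alpha> L X Y 0 N > 0"
        using boundary[OF Yf XY(1) ne XY(3)] by (auto simp: N_def modulus_d1_swap)
      moreover have "f s \<le> f 0" if "s \<in> {0..d}" for s using maj[of s 0 N] d(2)[OF that] XY(1) by (simp add: f_def)
      ultimately show False using one_sided_derivative_at_max_le_0[OF d(1), of f] by fastforce
    qed
    have intK: "\<And>x. x \<in> \<Omega> \<Longrightarrow> x \<in> interior ?K" using \<Omega>(1) by (meson closure_subset interior_maximal subsetD)
    have spatial: "dderiv_on ?K \<xi> ?w X - dderiv_on ?K \<zeta> ?w Y - modulus_d1 \<alpha> L X Y \<xi> \<zeta> = 0"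
      "dderiv_on ?K \<xi> (dderiv_on ?K \<xi> ?w) X - dderiv_on ?K \<zeta> (dderiv_on ?K \<zeta> ?w) Y - modulus_d2 \<alpha> L X Y \<xi> \<zeta> \<le> 0" for \<xi> \<zeta>
    proof -
      obtain r1 where r1: "r1 > 0" "ball X r1 \<subseteq> \<Omega>" using \<Omega>(1) X by (meson open_contains_ball)
      obtain r2 where r2: "r2 > 0" "ball Y r2 \<subseteq> \<Omega>" using \<Omega>(1) Y by (meson open_contains_ball)
      define d where "d = min r1 r2 / (norm \<xi> + norm \<zeta> + 1)"
      have den: "norm \<xi> + norm \<zeta> + 1 > 0" by (simp add: add_nonneg_pos)
      have d: "d > 0" using r1 r2 den by (simp add: d_def)
      have inO: "X + s *\<^sub>R \<xi> \<in> \<Omega> \<and> Y + s *\<^sub>R \<zeta> \<in> \<Omega>" if s: "\<bar>s\<bar> < d" for s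
      proof -
        have lt: "\<bar>s\<bar> * (norm \<xi> + norm \<zeta> + 1) < min r1 r2" using s den by (simp add: d_def pos_less_divide_eq)
        have "\<bar>s\<bar> * norm \<xi> \<le> \<bar>s\<bar> * (norm \<xi> + norm \<zeta> + 1)" "\<bar>s\<bar> * norm \<zeta> \<le> \<bar>s\<bar> * (norm \<xi> + norm \<zeta> + 1)"
          by (intro mult_left_mono; simp add: add_increasing2)+
        then have "X + s *\<^sub>R \<xi> \<in> ball X r1" "Y + s *\<^sub>R \<zeta> \<in> ball Y r2" using lt by (auto simp: dist_norm)
        then show ?thesis using r1 r2 by blast
      qed
      define f where "f s = ?w (X + s *\<^sub>R \<xi>) - ?w (Y + s *\<^sub>R \<zeta>) - modulus_majorant \<alpha> L X Y \<xi> \<zeta> s" for s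
      define f' where "f' s = dderiv_on ?K \<xi> ?w (X + s *\<^sub>R \<xi>) - dderiv_on ?K \<zeta> ?w (Y + s *\<^sub>R \<zeta>) - modulus_majorant_slope \<alpha> L X Y \<xi> \<zeta> s" for s
      have fd: "(f has_real_derivative f' s) (at s)" if "\<bar>s\<bar> < d" for s
        unfolding f_def f'_def using inO[OF that] intK
        by (intro DERIV_diff DERIV_modulus_majorant has_real_derivative_line[where f = ?w] Ck_on_has_derivative_at[OF C]) auto
      have fd2: "(f' has_real_derivative dderiv_on ?K \<xi> (dderiv_on ?K \<xi> ?w) X - dderiv_on ?K \<zeta> (dderiv_on ?K \<zeta> ?w) Y
          - modulus_d2 \<alpha> L X Y \<xi> \<zeta>) (at 0)"
        unfolding f'_def using intK[OF X] intK[OF Y]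
        by (intro DERIV_diff DERIV_modulus_majorant_slope ne has_real_derivative_line Ck_on_has_derivative_at[OF Ck_on_SucD(2)[OF C], THEN has_derivative_eq_rhs]) auto
      have fmax: "f s \<le> f 0" if "\<bar>s\<bar> < d" for s
        using maj[of s \<xi> \<zeta>] inO[OF that] closure_subset[of \<Omega>] by (auto simp: f_def)
      note sd = second_derivative_local_max_le_0[OF d fd fd2 fmax]
      show "dderiv_on ?K \<xi> (dderiv_on ?K \<xi> ?w) X - dderiv_on ?K \<zeta> (dderiv_on ?K \<zeta> ?w) Y - modulus_d2 \<alpha> L X Y \<xi> \<zeta> \<le> 0"
        using sd(2) .
      show "dderiv_on ?K \<xi> ?w X - dderiv_on ?K \<zeta> ?w Y - modulus_d1 \<alpha> L X Y \<xi> \<zeta> = 0"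
        using sd(1) by (simp add: f'_def modulus_majorant_slope_0)
    qed
    have zero: "dderiv_on ?K 0 ?w z = 0" if "z \<in> \<Omega>" for z
      using linear_0[OF has_derivative_linear[OF Ck_on_has_derivative_at[OF C intK[OF that]]]] .
    have le: "w\<^sub>t X \<tau> \<le> w\<^sub>t Y \<tau>"
    proof (rule interior[OF X Y ne XY(3)])
      show "dderiv_on ?K v ?w X = modulus_d1 \<alpha> L X Y v 0" for v using spatial(1)[of v 0] zero[OF Y] by simp
      show "dderiv_on ?K v ?w Y = - modulus_d1 \<alpha> L X Y 0 v" for v using spatial(1)[of 0 v] zero[OF X] by simp
      show "dderiv_on ?K \<xi> (dderiv_on ?K \<xi> ?w) X - dderiv_on ?K \<zeta> (dderiv_on ?K \<zeta> ?w) Y \<le> modulus_d2 \<alpha> L X Y \<xi> \<zeta>" for \<xi> \<zeta>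
        using spatial(2)[of \<xi> \<zeta>] by simp
    qed
    define h where "h s = w X s - w Y s - \<epsilon> * s" for s
    have "(h has_real_derivative w\<^sub>t X \<tau> - w\<^sub>t Y \<tau> - \<epsilon>) (at \<tau> within {0..T})"
      unfolding h_def by (intro DERIV_diff time X Y XY(3) DERIV_cmult_Id)
    then obtain q where q: "q > 0" "\<And>s. 0 < s \<Longrightarrow> \<tau> - s \<in> {0..T} \<Longrightarrow> s < q \<Longrightarrow> h \<tau> < h (\<tau> - s)"
      using has_real_derivative_neg_dec_left[of h "w\<^sub>t X \<tau> - w\<^sub>t Y \<tau> - \<epsilon>" \<tau> "{0..T}"] le \<epsilon> by auto
    define s where "s = min \<tau> q / 2"
    have s: "0 < s" "s < q" "\<tau> - s \<in> {0..T}" using \<tau> q by (auto simp: s_def)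
    have "h \<tau> < h (\<tau> - s)" using q(2)[OF s(1,3,2)] .
    moreover have "h (\<tau> - s) \<le> h \<tau>" using max[OF XY(1,2) s(3)] by (simp add: Z_def h_def)
    ultimately show False by simp
  qed
  then have "Z x y t \<le> 0" using max[OF xyt] by simp
  moreover have "\<epsilon> * t \<le> e"
  proof -
    have "\<epsilon> * t \<le> \<epsilon> * (T + 1)" using xyt \<epsilon> by (intro mult_left_mono) auto
    then show ?thesis using T by (simp add: \<epsilon>_def)
  qed
  ultimately show "w x t - w y t \<le> two_point_modulus \<alpha> L x y + e" by (simp add: Z_def)
qed


section \<open>Estimates at an interior maximum\<close>

text \<open>
  If the two directions differ by at most \<open>D * \<alpha> * |x - y|\<close>, the mixed term is split by Young's inequality between the
  term with \<open>|\<xi> - \<zeta>|\<^sup>2\<close> and half of the concavity term, and what remains positive is quadratic in \<open>\<alpha>\<close>.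
\<close>

lemma modulus_d2_le:
  fixes x y \<xi> \<zeta> :: "'a::real_inner"
  assumes "x \<noteq> y" and R: "norm (midpoint x y) \<le> R" "norm (x - y) \<le> 2 * R"
    and \<alpha>: "0 \<le> \<alpha>" "\<alpha> * R\<^sup>2 \<le> 1 / 12" and L: "0 \<le> L" and \<delta>: "norm (\<xi> - \<zeta>) \<le> D * \<alpha> * norm (x - y)"
  shows "modulus_d2 \<alpha> L x y \<xi> \<zeta> \<le> L * norm (x - y) * (3 * D\<^sup>2 * \<alpha>\<^sup>2 - \<alpha> / 2 * (norm \<xi>)\<^sup>2)"
proof -
  define r d s m where "r = norm (x - y)" and "d = norm (\<xi> - \<zeta>)" and "s = norm (\<xi> + \<zeta>)" and "m = midpoint x y"
  have r: "r > 0" using assms(1) by (simp add: r_def)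
  have pos: "0 \<le> d" "0 \<le> s" by (auto simp: d_def s_def)
  have R0: "0 \<le> R" using R(1) norm_ge_zero order_trans by blast
  have dr: "d \<le> D * \<alpha> * r" using \<delta> by (simp add: d_def r_def)
  have d2: "d\<^sup>2 \<le> D\<^sup>2 * \<alpha>\<^sup>2 * r\<^sup>2"
    using power_mono[OF dr pos(1), of 2] by (simp add: power_mult_distrib)
  have "- (sgn (x - y) \<bullet> (\<xi> - \<zeta>)) * (m \<bullet> (\<xi> + \<zeta>)) \<le> d * (R * s)"
  proof -
    have "\<bar>sgn (x - y) \<bullet> (\<xi> - \<zeta>)\<bar> \<le> d"
      using Cauchy_Schwarz_ineq2[of "sgn (x - y)" "\<xi> - \<zeta>"] assms(1) by (simp add: norm_sgn d_def)
    moreover have "\<bar>m \<bullet> (\<xi> + \<zeta>)\<bar> \<le> R * s"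
      using Cauchy_Schwarz_ineq2[of m "\<xi> + \<zeta>"] mult_right_mono[OF R(1), of s] by (simp add: m_def s_def)
    ultimately have "\<bar>sgn (x - y) \<bullet> (\<xi> - \<zeta>)\<bar> * \<bar>m \<bullet> (\<xi> + \<zeta>)\<bar> \<le> d * (R * s)"
      using pos by (intro mult_mono) auto
    moreover have "- (sgn (x - y) \<bullet> (\<xi> - \<zeta>)) * (m \<bullet> (\<xi> + \<zeta>)) \<le> \<bar>sgn (x - y) \<bullet> (\<xi> - \<zeta>)\<bar> * \<bar>m \<bullet> (\<xi> + \<zeta>)\<bar>"
      by (metis abs_ge_self abs_minus_cancel abs_mult)
    ultimately show ?thesis by linarith
  qed
  from mult_left_mono[OF this, of "2 * \<alpha>"] \<alpha>(1)
  have cross: "- 2 * \<alpha> * (sgn (x - y) \<bullet> (\<xi> - \<zeta>)) * (m \<bullet> (\<xi> + \<zeta>)) \<le> 2 * \<alpha> * (d * (R * s))"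
    by (simp add: mult.assoc)
  have young: "2 * (d * (R * s)) \<le> r / 4 * s\<^sup>2 + 4 * R\<^sup>2 * d\<^sup>2 / r"
  proof -
    \<comment> \<open>The weights leave half of the concavity term \<open>\<alpha> / 2 * r * s\<^sup>2\<close> after multiplication with \<open>\<alpha>\<close>.\<close>
    have "0 \<le> (r * s - 4 * R * d)\<^sup>2 / (4 * r)" using r by simp
    also have "\<dots> = r / 4 * s\<^sup>2 + 4 * R\<^sup>2 * d\<^sup>2 / r - 2 * (d * (R * s))"
      using r by (simp add: power2_eq_square field_simps)
    finally show ?thesis by simp
  qed
  have xi: "2 * (norm \<xi>)\<^sup>2 - d\<^sup>2 \<le> s\<^sup>2"
  proof -
    have "d\<^sup>2 + s\<^sup>2 = 2 * (norm \<xi>)\<^sup>2 + 2 * (norm \<zeta>)\<^sup>2"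
      by (simp add: d_def s_def power2_norm_eq_inner inner_simps inner_commute)
    then show ?thesis using zero_le_power2[of "norm \<zeta>"] by linarith
  qed
  have \<eta>: "(d\<^sup>2 / r) * (1 - \<alpha> * (norm m)\<^sup>2) \<le> (d\<^sup>2 / r) * 1"
    using r \<alpha>(1) by (intro mult_left_mono) auto
  have dq: "d\<^sup>2 / r \<le> D\<^sup>2 * \<alpha>\<^sup>2 * r"
    using d2 r by (simp add: pos_divide_le_eq power2_eq_square mult.assoc)
  have "modulus_d2 \<alpha> L x y \<xi> \<zeta> = L * ((d\<^sup>2 / r) * (1 - \<alpha> * (norm m)\<^sup>2)
      - 2 * \<alpha> * (sgn (x - y) \<bullet> (\<xi> - \<zeta>)) * (m \<bullet> (\<xi> + \<zeta>)) - \<alpha> / 2 * r * s\<^sup>2)"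
    by (simp add: modulus_d2_def r_def d_def s_def m_def)
  also have "\<dots> \<le> L * (r * (3 * D\<^sup>2 * \<alpha>\<^sup>2 - \<alpha> / 2 * (norm \<xi>)\<^sup>2))"
  proof (rule mult_left_mono[OF _ L])
    have "2 * \<alpha> * (d * (R * s)) \<le> \<alpha> * (r / 4 * s\<^sup>2 + 4 * R\<^sup>2 * d\<^sup>2 / r)"
      using mult_left_mono[OF young \<alpha>(1)] by (simp add: mult.assoc mult.left_commute)
    also have "\<dots> = \<alpha> * r / 4 * s\<^sup>2 + 4 * (\<alpha> * R\<^sup>2) * (d\<^sup>2 / r)" by (simp add: algebra_simps)
    also have "4 * (\<alpha> * R\<^sup>2) * (d\<^sup>2 / r) \<le> 4 * (1 / 12) * (d\<^sup>2 / r)"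
      using \<alpha>(2) r by (intro mult_right_mono mult_left_mono) auto
    finally have 1: "2 * \<alpha> * (d * (R * s)) \<le> \<alpha> * r / 4 * s\<^sup>2 + d\<^sup>2 / r / 3" by simp
    have "\<alpha> * r / 4 * (2 * (norm \<xi>)\<^sup>2 - d\<^sup>2) \<le> \<alpha> * r / 4 * s\<^sup>2"
      using xi \<alpha>(1) r by (intro mult_left_mono) auto
    then have 2: "r * (\<alpha> / 2 * (norm \<xi>)\<^sup>2) - \<alpha> * r / 4 * d\<^sup>2 \<le> \<alpha> * r / 4 * s\<^sup>2"
      by (simp add: algebra_simps)
    have 3: "\<alpha> * r / 4 * d\<^sup>2 \<le> d\<^sup>2 / r / 12"
    proof -
      have "r\<^sup>2 \<le> (2 * R)\<^sup>2" using R(2) r by (intro power_mono) (auto simp: r_def)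
      then have "\<alpha> * r\<^sup>2 \<le> \<alpha> * (2 * R)\<^sup>2" using \<alpha>(1) by (rule mult_left_mono)
      then have "\<alpha> * r\<^sup>2 \<le> 1 / 3" using \<alpha>(2) by (simp add: power_mult_distrib)
      then have "(\<alpha> * r\<^sup>2) * (d\<^sup>2 / (4 * r)) \<le> 1 / 3 * (d\<^sup>2 / (4 * r))" using r by (intro mult_right_mono) auto
      then show ?thesis using r by (simp add: power2_eq_square field_simps)
    qed
    have split: "r * (3 * D\<^sup>2 * \<alpha>\<^sup>2 - \<alpha> / 2 * (norm \<xi>)\<^sup>2) = 3 * (D\<^sup>2 * \<alpha>\<^sup>2 * r) - r * (\<alpha> / 2 * (norm \<xi>)\<^sup>2)"
      "\<alpha> / 2 * r * s\<^sup>2 = 2 * (\<alpha> * r / 4 * s\<^sup>2)"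
      by (simp_all add: algebra_simps)
    have cross': "- (2 * \<alpha> * (sgn (x - y) \<bullet> (\<xi> - \<zeta>)) * (m \<bullet> (\<xi> + \<zeta>))) \<le> 2 * \<alpha> * (d * (R * s))"
      using cross by simp
    have arith: "e - c - 2 * q2 \<le> 3 * q5 - q3" if "e \<le> q1 * 1" "- c \<le> k" "k \<le> q2 + q1 / 3" "q3 - q4 \<le> q2"
      "q4 \<le> q1 / 12" "q1 \<le> q5" "0 \<le> q1" for e c k q1 q2 q3 q4 q5 :: real
      using that by linarith
    show "(d\<^sup>2 / r) * (1 - \<alpha> * (norm m)\<^sup>2) - 2 * \<alpha> * (sgn (x - y) \<bullet> (\<xi> - \<zeta>)) * (m \<bullet> (\<xi> + \<zeta>))
        - \<alpha> / 2 * r * s\<^sup>2 \<le> r * (3 * D\<^sup>2 * \<alpha>\<^sup>2 - \<alpha> / 2 * (norm \<xi>)\<^sup>2)"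
      unfolding split by (rule arith[OF \<eta> cross' 1 2 3 dq]) (use r in simp)
  qed
  finally show ?thesis by (simp add: r_def mult.assoc)
qed

text \<open>
  The gradients of \<open>w\<close> at the two points of an interior maximum.
\<close>

lemma modulus_d1_eq_inner:
  "modulus_d1 \<alpha> L x y v 0 = (L *\<^sub>R ((1 - \<alpha> * (norm (midpoint x y))\<^sup>2) *\<^sub>R sgn (x - y)
      - (\<alpha> * norm (x - y)) *\<^sub>R midpoint x y)) \<bullet> v"
  "- modulus_d1 \<alpha> L x y 0 v = (L *\<^sub>R ((1 - \<alpha> * (norm (midpoint x y))\<^sup>2) *\<^sub>R sgn (x - y)
      + (\<alpha> * norm (x - y)) *\<^sub>R midpoint x y)) \<bullet> v"
  by (simp_all add: modulus_d1_def inner_simps algebra_simps)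

lemma convex_C1_lipschitz:
  fixes f :: "real^'n \<Rightarrow> real"
  assumes K: "compact K" "convex K" and f: "Ck_on 1 K f"
  obtains M where "0 \<le> M" "\<And>x. x \<in> K \<Longrightarrow> \<bar>f x\<bar> \<le> M"
    "\<And>x y. x \<in> K \<Longrightarrow> y \<in> K \<Longrightarrow> \<bar>f x - f y\<bar> \<le> M * norm (x - y)" "\<And>x. x \<in> K \<Longrightarrow> norm (grad_on K f x) \<le> M"
proof -
  have C: "Ck_on (Suc 0) K f" using f by simp
  have bdd: "\<exists>b. \<forall>x\<in>K. norm (h x) \<le> b" if "continuous_on K h" for h :: "real^'n \<Rightarrow> 'b::real_normed_vector"
    using compact_imp_bounded[OF compact_continuous_image[OF that K(1)]] by (auto simp: bounded_iff)
  obtain b1 where b1: "\<And>x. x \<in> K \<Longrightarrow> \<bar>f x\<bar> \<le> b1"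
    using bdd[OF Ck_on_imp_continuous_on[OF C]] by auto
  have "continuous_on K (grad_on K f)" unfolding grad_on_def
    using Ck_on_SucD(2)[OF C] by (intro continuous_on_vec_lambda) auto
  then obtain b2 where b2: "\<And>x. x \<in> K \<Longrightarrow> norm (grad_on K f x) \<le> b2" using bdd by blast
  define M where "M = \<bar>b1\<bar> + \<bar>b2\<bar>"
  show ?thesis
  proof (rule that[of M])
    show "0 \<le> M" by (simp add: M_def)
    show "\<bar>f x\<bar> \<le> M" if "x \<in> K" for x using b1[OF that] by (simp add: M_def)
    show g: "norm (grad_on K f x) \<le> M" if "x \<in> K" for x using b2[OF that] by (simp add: M_def)
    show "\<bar>f x - f y\<bar> \<le> M * norm (x - y)" if "x \<in> K" "y \<in> K" for x y
    proof -
      have "norm (f x - f y) \<le> M * norm (x - y)"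
      proof (rule differentiable_bound[OF K(2) _ _ that])
        fix z assume z: "z \<in> K"
        show "(f has_derivative (\<lambda>v. dderiv_on K v f z)) (at z within K)" by (rule Ck_on_SucD(1)[OF C z])
        have "norm (dderiv_on K v f z) \<le> M * norm v" for v
        proof -
          have "dderiv_on K v f z = grad_on K f z \<bullet> v"
            by (rule dderiv_on_eq_grad_on[OF differentiableI[OF Ck_on_SucD(1)[OF C z]]])
          then have "norm (dderiv_on K v f z) \<le> norm (grad_on K f z) * norm v"
            using Cauchy_Schwarz_ineq2[of "grad_on K f z" v] by simp
          also have "\<dots> \<le> M * norm v" using g[OF z] by (rule mult_right_mono) simp
          finally show ?thesis .
        qed
        then show "onorm (\<lambda>v. dderiv_on K v f z) \<le> M" by (intro onorm_le)
      qed
      then show ?thesis by simp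
    qed
  qed
qed

lemma interior_second_dderiv_expand:
  fixes f :: "real^'n \<Rightarrow> real"
  assumes C2: "Ck_on 2 K f" and x: "x \<in> \<Omega>" "open \<Omega>" "\<Omega> \<subseteq> K"
  shows "dderiv_on K v (dderiv_on K v f) x = (\<Sum>i\<in>UNIV. \<Sum>j\<in>UNIV. v $ i * v $ j * hess_on K f x $ i $ j)"
proof -
  have eq: "dderiv_on K v h z = dderiv_on \<Omega> v h z" if "z \<in> \<Omega>" for v h z
  proof -
    have "z \<in> interior K" using interior_maximal[OF x(3,2)] that by blast
    then show ?thesis by (simp only: dderiv_on_def at_within_interior at_within_open[OF that x(2)])
  qed
  have eq2: "dderiv_on K a (dderiv_on K b f) x = dderiv_on \<Omega> a (dderiv_on \<Omega> b f) x" for a b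
    unfolding eq[OF x(1)] by (rule dderiv_on_cong[OF eq x(1)])
  have C2': "Ck_on 2 \<Omega> f" by (rule Ck_on_subset[OF cone_condition_open[OF x(2)] x(3) C2])
  have sym: "dderiv_on K a (dderiv_on K b f) x = dderiv_on K b (dderiv_on K a f) x" for a b
    unfolding eq2 by (rule second_derivative_symmetric[OF C2' x(2,1)])
  have C: "Ck_on (Suc (Suc 0)) K f" using C2 by (simp add: numeral_2_eq_2)
  have xK: "x \<in> K" using x by blast
  have exp: "dderiv_on K v (dderiv_on K a f) x = (\<Sum>j\<in>UNIV. v $ j * dderiv_on K (axis j 1) (dderiv_on K a f) x)" for a
    using dderiv_on_eq_grad_on[OF differentiableI[OF Ck_on_SucD(1)[OF Ck_on_SucD(2)[OF C] xK]], of v a]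
    by (simp add: grad_on_def inner_vec_def mult.commute)
  have "dderiv_on K v (dderiv_on K v f) x = (\<Sum>i\<in>UNIV. v $ i * dderiv_on K v (dderiv_on K (axis i 1) f) x)"
    unfolding exp[of v] by (intro sum.cong refl arg_cong2[of _ _ _ _ "(*)"] sym)
  also have "\<dots> = (\<Sum>i\<in>UNIV. v $ i * (\<Sum>j\<in>UNIV. v $ j * dderiv_on K (axis j 1) (dderiv_on K (axis i 1) f) x))"
    by (simp only: exp)
  finally show ?thesis by (simp add: hess_on_def sum_distrib_left mult.assoc)
qed

text \<open>
  The entries of the Hessian are bounded and Lipschitz, and a quadratic form varies with its argument like
  \<open>|\<xi> - \<zeta>| * (|\<xi>| + |\<zeta>|)\<close>.
\<close>

lemma C3_hessian_form_lipschitz: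
  fixes g :: "real^'n \<Rightarrow> real"
  assumes K: "compact (closure \<Omega>)" "convex (closure \<Omega>)" and \<Omega>: "open \<Omega>" and g: "Ck_on 3 (closure \<Omega>) g"
  obtains M where "0 \<le> M"
    "\<And>x y \<xi> \<zeta>. x \<in> \<Omega> \<Longrightarrow> y \<in> \<Omega> \<Longrightarrow>
      dderiv_on (closure \<Omega>) \<xi> (dderiv_on (closure \<Omega>) \<xi> g) x - dderiv_on (closure \<Omega>) \<zeta> (dderiv_on (closure \<Omega>) \<zeta> g) y
      \<le> M * (norm (x - y) * (norm \<xi>)\<^sup>2 + norm (\<xi> - \<zeta>) * (norm \<xi> + norm \<zeta>))"
proof -
  let ?K = "closure \<Omega>"
  let ?h = "\<lambda>i j x. hess_on ?K g x $ i $ j"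
  have C: "Ck_on (Suc (Suc (Suc 0))) ?K g" using g by (simp add: numeral_3_eq_3)
  have "Ck_on 1 ?K (?h i j)" for i j
    using Ck_on_SucD(2)[OF Ck_on_SucD(2)[OF C]] by (simp add: hess_on_def)
  then have "\<exists>M. 0 \<le> M \<and> (\<forall>x\<in>?K. \<bar>?h i j x\<bar> \<le> M) \<and> (\<forall>x\<in>?K. \<forall>y\<in>?K. \<bar>?h i j x - ?h i j y\<bar> \<le> M * norm (x - y))" for i j
    by (rule convex_C1_lipschitz[OF K]) blast
  then obtain M where M: "\<And>i j. 0 \<le> M i j" "\<And>i j x. x \<in> ?K \<Longrightarrow> \<bar>?h i j x\<bar> \<le> M i j"
      "\<And>i j x y. x \<in> ?K \<Longrightarrow> y \<in> ?K \<Longrightarrow> \<bar>?h i j x - ?h i j y\<bar> \<le> M i j * norm (x - y)"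
    by metis
  show ?thesis
  proof (rule that[of "\<Sum>i\<in>UNIV. \<Sum>j\<in>UNIV. M i j"])
    show "0 \<le> (\<Sum>i\<in>UNIV. \<Sum>j\<in>UNIV. M i j)" using M(1) by (intro sum_nonneg)
    fix x y \<xi> \<zeta> :: "real^'n" assume x: "x \<in> \<Omega>" and y: "y \<in> \<Omega>"
    have xK: "x \<in> ?K" and yK: "y \<in> ?K" using x y closure_subset by blast+
    have C2: "Ck_on 2 ?K g" using Ck_on_le[OF g] by simp
    have "dderiv_on ?K \<xi> (dderiv_on ?K \<xi> g) x - dderiv_on ?K \<zeta> (dderiv_on ?K \<zeta> g) y
      = (\<Sum>i\<in>UNIV. \<Sum>j\<in>UNIV. \<xi> $ i * \<xi> $ j * ?h i j x - \<zeta> $ i * \<zeta> $ j * ?h i j y)"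
      by (simp add: interior_second_dderiv_expand[OF C2 x \<Omega> closure_subset]
          interior_second_dderiv_expand[OF C2 y \<Omega> closure_subset] sum_subtractf)
    also have "\<dots> \<le> (\<Sum>i\<in>UNIV. \<Sum>j\<in>UNIV. M i j * (norm (x - y) * (norm \<xi>)\<^sup>2 + norm (\<xi> - \<zeta>) * (norm \<xi> + norm \<zeta>)))"
    proof (intro sum_mono)
      fix i j
      have comp: "\<bar>v $ i\<bar> \<le> norm v" for v :: "real^'n" and i by (rule component_le_norm_cart)
      have "\<xi> $ i * \<xi> $ j * (?h i j x - ?h i j y) \<le> \<bar>\<xi> $ i\<bar> * \<bar>\<xi> $ j\<bar> * \<bar>?h i j x - ?h i j y\<bar>"
        by (metis abs_ge_self abs_mult)
      also have "\<dots> \<le> norm \<xi> * norm \<xi> * (M i j * norm (x - y))"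
        using comp M(1) M(3)[OF xK yK] by (intro mult_mono) auto
      finally have 1: "\<xi> $ i * \<xi> $ j * (?h i j x - ?h i j y) \<le> M i j * (norm (x - y) * (norm \<xi>)\<^sup>2)"
        by (simp add: power2_eq_square mult.assoc mult.left_commute mult.commute)
      have "\<bar>\<xi> $ i * \<xi> $ j - \<zeta> $ i * \<zeta> $ j\<bar> = \<bar>\<xi> $ i * ((\<xi> - \<zeta>) $ j) + \<zeta> $ j * ((\<xi> - \<zeta>) $ i)\<bar>"
        by (simp add: algebra_simps)
      also have "\<dots> \<le> \<bar>\<xi> $ i\<bar> * \<bar>(\<xi> - \<zeta>) $ j\<bar> + \<bar>\<zeta> $ j\<bar> * \<bar>(\<xi> - \<zeta>) $ i\<bar>"
        by (metis abs_mult abs_triangle_ineq)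
      also have "\<dots> \<le> norm \<xi> * norm (\<xi> - \<zeta>) + norm \<zeta> * norm (\<xi> - \<zeta>)"
        by (intro add_mono mult_mono) (simp_all only: comp norm_ge_zero abs_ge_zero)
      finally have 2: "\<bar>\<xi> $ i * \<xi> $ j - \<zeta> $ i * \<zeta> $ j\<bar> \<le> norm (\<xi> - \<zeta>) * (norm \<xi> + norm \<zeta>)"
        by (simp add: algebra_simps)
      have "(\<xi> $ i * \<xi> $ j - \<zeta> $ i * \<zeta> $ j) * ?h i j y \<le> \<bar>\<xi> $ i * \<xi> $ j - \<zeta> $ i * \<zeta> $ j\<bar> * \<bar>?h i j y\<bar>"
        by (metis abs_ge_self abs_mult)
      also have "\<dots> \<le> norm (\<xi> - \<zeta>) * (norm \<xi> + norm \<zeta>) * M i j"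
        using 2 M(2)[OF yK] by (intro mult_mono) auto
      finally show "\<xi> $ i * \<xi> $ j * ?h i j x - \<zeta> $ i * \<zeta> $ j * ?h i j y
          \<le> M i j * (norm (x - y) * (norm \<xi>)\<^sup>2 + norm (\<xi> - \<zeta>) * (norm \<xi> + norm \<zeta>))"
        using 1 by (simp add: algebra_simps)
    qed
    also have "\<dots> = (\<Sum>i\<in>UNIV. \<Sum>j\<in>UNIV. M i j) * (norm (x - y) * (norm \<xi>)\<^sup>2 + norm (\<xi> - \<zeta>) * (norm \<xi> + norm \<zeta>))"
      by (simp only: sum_distrib_right)
    finally show "dderiv_on ?K \<xi> (dderiv_on ?K \<xi> g) x - dderiv_on ?K \<zeta> (dderiv_on ?K \<zeta> g) y
      \<le> (\<Sum>i\<in>UNIV. \<Sum>j\<in>UNIV. M i j) * (norm (x - y) * (norm \<xi>)\<^sup>2 + norm (\<xi> - \<zeta>) * (norm \<xi> + norm \<zeta>))" .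
  qed
qed

lemma factorized_trace:
  fixes f :: "real^'n \<Rightarrow> real" and \<sigma> :: "'b \<Rightarrow> real^'n"
  assumes C2: "Ck_on 2 K f" and x: "x \<in> \<Omega>" "open \<Omega>" "\<Omega> \<subseteq> K"
    and A: "\<And>i j. A i j = (\<Sum>b\<in>B. (\<sigma> b \<bullet> axis i 1) * (\<sigma> b \<bullet> axis j 1))"
  shows "(\<Sum>i\<in>UNIV. \<Sum>j\<in>UNIV. A i j * hess_on K f x $ i $ j) = (\<Sum>b\<in>B. dderiv_on K (\<sigma> b) (dderiv_on K (\<sigma> b) f) x)"
proof -
  have "(\<Sum>i\<in>UNIV. \<Sum>j\<in>UNIV. A i j * hess_on K f x $ i $ j)
      = (\<Sum>i\<in>UNIV. \<Sum>j\<in>UNIV. \<Sum>b\<in>B. \<sigma> b $ i * \<sigma> b $ j * hess_on K f x $ i $ j)"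
    by (simp add: A inner_axis sum_distrib_right)
  also have "\<dots> = (\<Sum>b\<in>B. \<Sum>i\<in>UNIV. \<Sum>j\<in>UNIV. \<sigma> b $ i * \<sigma> b $ j * hess_on K f x $ i $ j)"
    by (subst sum.swap[of _ B UNIV]) (simp add: sum.swap[of _ B UNIV])
  finally show ?thesis by (simp add: interior_second_dderiv_expand[OF C2 x])
qed

lemma Ck_space_on_imp_Ck_on: "Ck_space_on k S I u \<Longrightarrow> t \<in> I \<Longrightarrow> Ck_on k S (\<lambda>x. u x t)"
proof (induction k arbitrary: u)
  case 0
  then have "continuous_on (S \<times> I) (\<lambda>(x, t). u x t)" by simp
  then have "continuous_on S (\<lambda>x. case (x, t) of (x, t) \<Rightarrow> u x t)"
    by (rule continuous_on_compose2) (use 0 in \<open>auto intro!: continuous_intros\<close>)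
  then show ?case by simp
next
  case (Suc k)
  have "Ck_on k S (\<lambda>x. dderiv_on S v (\<lambda>y. u y t) x)" for v
    using Suc.IH[of "\<lambda>x t. dderiv_on S v (\<lambda>y. u y t) x"] Suc.prems by simp
  then show ?case using Suc.prems by simp
qed

lemma dderiv_on_diff:
  assumes "cone_condition S" "x \<in> S" "f differentiable (at x within S)" "g differentiable (at x within S)"
  shows "dderiv_on S v (\<lambda>x. f x - g x) x = dderiv_on S v f x - dderiv_on S v g x"
proof -
  obtain f' g' where fg: "(f has_derivative f') (at x within S)" "(g has_derivative g') (at x within S)"
    using assms(3,4) by (auto simp: differentiable_def)
  show ?thesis
    using dderiv_on_eqI[OF assms(1,2) has_derivative_diff[OF fg]] dderiv_on_eqI[OF assms(1,2) fg(1)]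
      dderiv_on_eqI[OF assms(1,2) fg(2)] by simp
qed

lemma dderiv2_on_diff:
  assumes S: "cone_condition S" "x \<in> S" and f: "Ck_on 2 S f" and g: "Ck_on 2 S g"
  shows "dderiv_on S v (dderiv_on S v (\<lambda>x. f x - g x)) x = dderiv_on S v (dderiv_on S v f) x - dderiv_on S v (dderiv_on S v g) x"
proof -
  have C: "Ck_on (Suc (Suc 0)) S f" "Ck_on (Suc (Suc 0)) S g" using f g by (simp_all add: numeral_2_eq_2)
  have "dderiv_on S v (dderiv_on S v (\<lambda>x. f x - g x)) x = dderiv_on S v (\<lambda>x. dderiv_on S v f x - dderiv_on S v g x) x"
    by (rule dderiv_on_cong[OF dderiv_on_diff[OF S(1) _ differentiableI[OF Ck_on_SucD(1)[OF C(1)]]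
        differentiableI[OF Ck_on_SucD(1)[OF C(2)]]] S(2)])
  also have "\<dots> = dderiv_on S v (dderiv_on S v f) x - dderiv_on S v (dderiv_on S v g) x"
    by (rule dderiv_on_diff[OF S differentiableI[OF Ck_on_SucD(1)[OF Ck_on_SucD(2)[OF C(1)] S(2)]]
        differentiableI[OF Ck_on_SucD(1)[OF Ck_on_SucD(2)[OF C(2)] S(2)]]])
  finally show ?thesis .
qed

lemma Ck_on_diff:
  assumes "cone_condition S" "Ck_on k S f" "Ck_on k S g" shows "Ck_on k S (\<lambda>x. f x - g x)"
  using Ck_on_add[OF assms(1,2) Ck_on_mult[OF assms(1) Ck_on_const[OF assms(1), of k "- 1"] assms(3)]] by simp

text \<open>
  At interior points the one-sided Lipschitz bound is tested in the direction of the gradient; the boundary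
  is reached by continuity of the gradient.
\<close>

lemma gradient_bound_of_modulus:
  fixes \<Omega> :: "(real^'n) set"
  assumes \<Omega>: "open \<Omega>" "cone_condition (closure \<Omega>)"
    and f: "Ck_on 1 (closure \<Omega>) f" and g: "Ck_on 1 (closure \<Omega>) g"
    and G: "\<And>x. x \<in> closure \<Omega> \<Longrightarrow> norm (grad_on (closure \<Omega>) g x) \<le> G" and L: "0 \<le> L"
    and lip: "\<And>x y. x \<in> \<Omega> \<Longrightarrow> y \<in> \<Omega> \<Longrightarrow> (f x - g x) - (f y - g y) \<le> L * norm (x - y)"
    and x: "x \<in> closure \<Omega>"
  shows "norm (grad_on (closure \<Omega>) f x) \<le> L + G"
proof -
  let ?K = "closure \<Omega>"
  have C: "Ck_on (Suc 0) ?K f" "Ck_on (Suc 0) ?K g" using f g by simp_all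
  have interior: "norm (grad_on ?K f x) \<le> L + G" if x: "x \<in> \<Omega>" for x
  proof -
    have xK: "x \<in> ?K" using x closure_subset by blast
    have xint: "x \<in> interior ?K" using interior_maximal[OF closure_subset \<Omega>(1)] x by blast
    define a where "a = grad_on ?K f x - grad_on ?K g x"
    have "norm a \<le> L"
    proof (rule ccontr)
      assume big: "\<not> norm a \<le> L"
      define h where "h s = f (x + s *\<^sub>R a) - g (x + s *\<^sub>R a) - L * norm a * s" for s
      have d: "dderiv_on ?K a f x - dderiv_on ?K a g x = a \<bullet> a"
        unfolding dderiv_on_eq_grad_on[OF differentiableI[OF Ck_on_SucD(1)[OF C(1) xK]]]
          dderiv_on_eq_grad_on[OF differentiableI[OF Ck_on_SucD(1)[OF C(2) xK]]]
        by (simp add: a_def inner_diff_left)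
      have fd: "(f has_derivative (\<lambda>v. dderiv_on ?K v f x)) (at (x + 0 *\<^sub>R a))"
        and gd: "(g has_derivative (\<lambda>v. dderiv_on ?K v g x)) (at (x + 0 *\<^sub>R a))"
        using Ck_on_has_derivative_at[OF C(1) xint] Ck_on_has_derivative_at[OF C(2) xint] by simp_all
      have "(h has_real_derivative dderiv_on ?K a f x - dderiv_on ?K a g x - L * norm a) (at 0)"
        unfolding h_def
        by (intro DERIV_diff DERIV_cmult_Id has_real_derivative_line[OF fd] has_real_derivative_line[OF gd])
      moreover have "dderiv_on ?K a f x - dderiv_on ?K a g x - L * norm a > 0"
      proof -
        have "L * norm a < norm a * norm a" using big L by (intro mult_strict_right_mono) linarith+
        then show ?thesis by (simp add: d dot_square_norm power2_eq_square)
      qed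
      ultimately obtain q where q: "q > 0" "\<And>s. 0 < s \<Longrightarrow> s < q \<Longrightarrow> h 0 < h s"
        using DERIV_pos_inc_right[of h] by (metis add_0)
      obtain r where r: "r > 0" "ball x r \<subseteq> \<Omega>" using x \<Omega>(1) by (meson open_contains_ball)
      have na: "norm a > 0" using big L by linarith
      obtain r' where r': "r' = r / norm a" "0 < r'" using divide_pos_pos[OF r(1) na] by blast
      define s where "s = min q r' / 2"
      have s: "0 < s" "s < q" "s < r / norm a" using q(1) r'(2) unfolding r'(1)[symmetric] by (auto simp: s_def)
      have "s * norm a < r" using s(3) na by (simp add: pos_less_divide_eq)
      then have "x + s *\<^sub>R a \<in> \<Omega>" using s(1) by (intro subsetD[OF r(2)]) (simp add: dist_norm)
      from lip[OF this x] have "h s \<le> h 0" using s(1) by (simp add: h_def mult.commute mult.left_commute)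
      then show False using q(2)[OF s(1,2)] by simp
    qed
    moreover have "norm (grad_on ?K f x) \<le> norm a + norm (grad_on ?K g x)"
      using norm_triangle_ineq[of a "grad_on ?K g x"] by (simp add: a_def)
    ultimately show ?thesis using G[OF xK] by linarith
  qed
  have "continuous_on ?K (grad_on ?K f)" unfolding grad_on_def
    using Ck_on_SucD(2)[OF C(1)] by (intro continuous_on_vec_lambda) auto
  then show ?thesis using continuous_on_closure_norm_le[of \<Omega> "grad_on ?K f" "L + G" x] interior x by blast
qed

text \<open>
  The square root in the equation is \<open>|(Du, -1)|\<close>, so the coefficients are the values of \<open>tau\<close>, and a
  factorization of \<open>tau\<close> turns the right-hand side into a sum of second directional derivatives.
\<close>

lemma flow_solution_facts:
  fixes \<Omega> :: "(real^'n) set"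
  assumes \<Omega>: "open \<Omega>" and u: "C32 \<Omega> T u" and sol: "flow_solution \<Omega> F \<phi> u\<^sub>0 T u"
  shows "continuous_on (closure \<Omega> \<times> {0..T}) (\<lambda>(x, t). u x t)"
    and "t \<in> {0..T} \<Longrightarrow> Ck_on 3 (closure \<Omega>) (\<lambda>x. u x t)"
    and "x \<in> closure \<Omega> \<Longrightarrow> t \<in> {0..T} \<Longrightarrow>
      (u x has_real_derivative vector_derivative (u x) (at t within {0..T})) (at t within {0..T})"
    and "x \<in> frontier \<Omega> \<Longrightarrow> t \<in> {0..T} \<Longrightarrow> dderiv_on (closure \<Omega>) (inward_normal \<Omega> x) (\<lambda>y. u y t) x = \<phi> x"
    and "x \<in> \<Omega> \<Longrightarrow> t \<in> {0..T} \<Longrightarrow> p = grad_on (closure \<Omega>) (\<lambda>y. u y t) x \<Longrightarrow>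
      (\<And>a a'. tau F p a a' = (\<Sum>b\<in>B. (\<sigma> b \<bullet> a) * (\<sigma> b \<bullet> a'))) \<Longrightarrow>
      vector_derivative (u x) (at t within {0..T}) =
        (\<Sum>b\<in>B. dderiv_on (closure \<Omega>) (\<sigma> b) (dderiv_on (closure \<Omega>) (\<sigma> b) (\<lambda>y. u y t)) x)"
    and "0 \<le> T \<Longrightarrow> continuous_on (closure \<Omega>) u\<^sub>0 \<Longrightarrow> x \<in> closure \<Omega> \<Longrightarrow> u x 0 = u\<^sub>0 x"
proof -
  let ?K = "closure \<Omega>"
  have sp: "Ck_space_on 3 ?K {0..T} u" and ti: "Ck_time_on (Suc (Suc 0)) ?K {0..T} u"
    using u by (auto simp: C32_def numeral_2_eq_2)
  show "continuous_on (?K \<times> {0..T}) (\<lambda>(x, t). u x t)" using ti by simp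
  show C3: "Ck_on 3 ?K (\<lambda>x. u x t)" if "t \<in> {0..T}" for t by (rule Ck_space_on_imp_Ck_on[OF sp that])
  show "(u x has_real_derivative vector_derivative (u x) (at t within {0..T})) (at t within {0..T})"
    if "x \<in> ?K" "t \<in> {0..T}" for x t
  proof -
    have "u x differentiable (at t within {0..T})" using ti that by (simp add: differentiable_on_def)
    then show ?thesis
      by (simp add: has_real_derivative_iff_has_vector_derivative vector_derivative_works[symmetric])
  qed
  show "dderiv_on ?K (inward_normal \<Omega> x) (\<lambda>y. u y t) x = \<phi> x" if "x \<in> frontier \<Omega>" "t \<in> {0..T}" for x t
    using sol that by (simp add: flow_solution_def)
  show "vector_derivative (u x) (at t within {0..T}) =
        (\<Sum>b\<in>B. dderiv_on ?K (\<sigma> b) (dderiv_on ?K (\<sigma> b) (\<lambda>y. u y t)) x)"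
    if x: "x \<in> \<Omega>" and t: "t \<in> {0..T}" and p: "p = grad_on ?K (\<lambda>y. u y t) x"
      and tau: "\<And>a a'. tau F p a a' = (\<Sum>b\<in>B. (\<sigma> b \<bullet> a) * (\<sigma> b \<bullet> a'))" for x t p B and \<sigma> :: "'b \<Rightarrow> real^'n"
  proof -
    have "vector_derivative (u x) (at t within {0..T}) = sqrt (1 + (norm p)\<^sup>2) *
          (\<Sum>i\<in>UNIV. \<Sum>j\<in>UNIV. D2 F (p, -1) (axis i 1) (axis j 1) * hess_on ?K (\<lambda>y. u y t) x $ i $ j)"
      using sol x t p by (simp add: flow_solution_def Let_def)
    also have "sqrt (1 + (norm p)\<^sup>2) = norm (p, -1::real)" by (simp add: norm_Pair add.commute)
    finally have "vector_derivative (u x) (at t within {0..T}) =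
        (\<Sum>i\<in>UNIV. \<Sum>j\<in>UNIV. tau F p (axis i 1) (axis j 1) * hess_on ?K (\<lambda>y. u y t) x $ i $ j)"
      by (simp add: tau_def sum_distrib_left mult.assoc)
    also have "\<dots> = (\<Sum>b\<in>B. dderiv_on ?K (\<sigma> b) (dderiv_on ?K (\<sigma> b) (\<lambda>y. u y t)) x)"
      by (rule factorized_trace[OF Ck_on_le[OF C3[OF t]] x \<Omega> closure_subset tau]) simp
    finally show ?thesis .
  qed
  show "u x 0 = u\<^sub>0 x" if T: "0 \<le> T" and c: "continuous_on ?K u\<^sub>0" and x: "x \<in> ?K"
  proof -
    have "continuous_on ?K (\<lambda>x. u x 0 - u\<^sub>0 x)"
      using Ck_on_imp_continuous_on[OF C3[of 0]] T c by (intro continuous_intros) auto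
    moreover have "u z 0 - u\<^sub>0 z = 0" if "z \<in> \<Omega>" for z using sol that by (simp add: flow_solution_def)
    ultimately have "u x 0 - u\<^sub>0 x = 0" using continuous_constant_on_closure[of \<Omega> "\<lambda>x. u x 0 - u\<^sub>0 x" 0 x] x by blast
    then show ?thesis by simp
  qed
qed


section \<open>The gradient bound\<close>

text \<open>
  In the application \<open>a\<close> and \<open>a'\<close> are the gradients of \<open>g\<close>, and \<open>p\<close> and \<open>q\<close> those of \<open>u\<close>. Both of the
  latter are at least \<open>L / 2\<close> long, and they differ by at most \<open>L * \<alpha> * |x - y| * (2 * R + 1)\<close>, so that \<open>\<sigma>\<close> changes by at most
  \<open>D * \<alpha> * |x - y|\<close>. The concavity term then dominates the quadratic error by the choice of \<open>\<alpha>\<close> and the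
  contribution of \<open>g\<close> by the choice of \<open>L\<close>.
\<close>

lemma two_point_interior_estimate:
  fixes \<sigma> :: "'a::real_inner \<Rightarrow> 'b \<Rightarrow> 'a"
  assumes lip: "\<And>p q b. p \<noteq> 0 \<Longrightarrow> q \<noteq> 0 \<Longrightarrow> b \<in> B \<Longrightarrow> norm (\<sigma> p b - \<sigma> q b) \<le> K * norm (p - q) / norm p"
    and bound: "\<And>p b. p \<noteq> 0 \<Longrightarrow> b \<in> B \<Longrightarrow> norm (\<sigma> p b) \<le> \<Lambda>"
    and lower: "\<And>p. p \<noteq> 0 \<Longrightarrow> c \<le> (\<Sum>b\<in>B. (norm (\<sigma> p b))\<^sup>2)"
    and K: "0 \<le> K" "0 \<le> M" "0 \<le> G" and D: "D = 2 * K * (2 * R + 1)"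
    and \<alpha>: "0 < \<alpha>" "\<alpha> * R\<^sup>2 \<le> 1 / 12" "12 * real (card B) * D\<^sup>2 * \<alpha> \<le> c"
    and L: "0 < L" "4 * G \<le> L" "G \<le> \<alpha> * L" "4 * real (card B) * M * (\<Lambda>\<^sup>2 + 2 * D * \<alpha> * \<Lambda>) \<le> L * \<alpha> * c"
    and xy: "x \<noteq> y" "norm x \<le> R" "norm y \<le> R"
    and p: "p = L *\<^sub>R ((1 - \<alpha> * (norm (midpoint x y))\<^sup>2) *\<^sub>R sgn (x - y) - (\<alpha> * norm (x - y)) *\<^sub>R midpoint x y) + a"
    and q: "q = L *\<^sub>R ((1 - \<alpha> * (norm (midpoint x y))\<^sup>2) *\<^sub>R sgn (x - y) + (\<alpha> * norm (x - y)) *\<^sub>R midpoint x y) + a'"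
    and a: "norm a \<le> G" "norm a' \<le> G" "norm (a - a') \<le> G * norm (x - y)"
  shows "p \<noteq> 0" "q \<noteq> 0"
    "(\<Sum>b\<in>B. modulus_d2 \<alpha> L x y (\<sigma> p b) (\<sigma> q b)) + (\<Sum>b\<in>B. M * (norm (x - y) * (norm (\<sigma> p b))\<^sup>2
       + norm (\<sigma> p b - \<sigma> q b) * (norm (\<sigma> p b) + norm (\<sigma> q b)))) \<le> 0"
proof -
  define r m where "r = norm (x - y)" and "m = midpoint x y"
  define \<eta> where "\<eta> = 1 - \<alpha> * (norm m)\<^sup>2"
  have r: "r > 0" "r \<le> 2 * R" using xy norm_triangle_ineq4[of x y] by (auto simp: r_def)
  have R: "0 \<le> R" using xy(2) norm_ge_zero order_trans by blast
  have m: "norm m \<le> R"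
    using xy norm_triangle_ineq[of x y] by (simp add: m_def midpoint_def)
  have \<eta>: "11 / 12 \<le> \<eta>"
  proof -
    have "(norm m)\<^sup>2 \<le> R\<^sup>2" using m by (intro power_mono) auto
    then have "\<alpha> * (norm m)\<^sup>2 \<le> \<alpha> * R\<^sup>2" using \<alpha>(1) by simp
    then show ?thesis using \<alpha>(2) by (simp add: \<eta>_def)
  qed
  have small: "\<alpha> * r * norm m \<le> 1 / 6"
  proof -
    have "r * norm m \<le> 2 * R * R" using r m R by (intro mult_mono) auto
    then have "\<alpha> * (r * norm m) \<le> \<alpha> * (2 * R * R)" using \<alpha>(1) by simp
    moreover have "\<alpha> * (2 * R * R) = 2 * (\<alpha> * R\<^sup>2)" by (simp add: power2_eq_square)
    moreover have "\<alpha> * r * norm m = \<alpha> * (r * norm m)" by simp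
    ultimately show ?thesis using \<alpha>(2) by linarith
  qed
  have n1: "norm (sgn (x - y)) = 1" using xy(1) by (simp add: norm_sgn)
  have core: "3 / 4 \<le> norm (\<eta> *\<^sub>R sgn (x - y) + v)" if "norm v = \<alpha> * r * norm m" for v
    using norm_triangle_ineq2[of "\<eta> *\<^sub>R sgn (x - y)" "- v"] that small \<eta> n1 by simp
  have vm: "norm ((\<alpha> * r) *\<^sub>R m) = \<alpha> * r * norm m" "norm (- ((\<alpha> * r) *\<^sub>R m)) = \<alpha> * r * norm m"
    using \<alpha>(1) r by simp_all
  have p': "p = L *\<^sub>R (\<eta> *\<^sub>R sgn (x - y) + - ((\<alpha> * r) *\<^sub>R m)) + a"
    and q': "q = L *\<^sub>R (\<eta> *\<^sub>R sgn (x - y) + (\<alpha> * r) *\<^sub>R m) + a'"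
    using p q by (simp_all add: \<eta>_def r_def m_def)
  have big: "L / 2 \<le> norm (L *\<^sub>R (\<eta> *\<^sub>R sgn (x - y) + v) + z)" if v: "norm v = \<alpha> * r * norm m" and z: "norm z \<le> G" for v z
  proof -
    have "L * (3 / 4) \<le> L * norm (\<eta> *\<^sub>R sgn (x - y) + v)" using core[OF v] L(1) by simp
    moreover have "norm (L *\<^sub>R (\<eta> *\<^sub>R sgn (x - y) + v)) - norm z \<le> norm (L *\<^sub>R (\<eta> *\<^sub>R sgn (x - y) + v) + z)"
      using norm_triangle_ineq2[of "L *\<^sub>R (\<eta> *\<^sub>R sgn (x - y) + v)" "- z"] by simp
    moreover have "norm (L *\<^sub>R (\<eta> *\<^sub>R sgn (x - y) + v)) = L * norm (\<eta> *\<^sub>R sgn (x - y) + v)" using L(1) by simp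
    ultimately show ?thesis using z L(2) by linarith
  qed
  have pL: "L / 2 \<le> norm p" and qL: "L / 2 \<le> norm q"
    unfolding p' q' using big vm a by blast+
  show p0: "p \<noteq> 0" and q0: "q \<noteq> 0" using pL qL L(1) by auto
  have pq: "norm (p - q) \<le> L * \<alpha> * r * (2 * R + 1)"
  proof -
    have "p - q = (a - a') - (2 * L * \<alpha> * r) *\<^sub>R m"
      unfolding p' q' by (simp add: scaleR_add_right algebra_simps flip: scaleR_add_left)
    then have "norm (p - q) \<le> norm (a - a') + 2 * L * \<alpha> * r * norm m"
      using norm_triangle_ineq4[of "a - a'" "(2 * L * \<alpha> * r) *\<^sub>R m"] L(1) \<alpha>(1) r by simp
    also have "\<dots> \<le> (\<alpha> * L) * r + 2 * L * \<alpha> * r * R"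
    proof (intro add_mono mult_left_mono)
      show "norm (a - a') \<le> (\<alpha> * L) * r"
        by (rule order_trans[OF a(3)[folded r_def] mult_right_mono[OF L(3) less_imp_le[OF r(1)]]])
    qed (use m L(1) \<alpha>(1) r in auto)
    also have "\<dots> = L * \<alpha> * r * (2 * R + 1)" by (simp add: algebra_simps)
    finally show ?thesis .
  qed
  have \<delta>: "norm (\<sigma> p b - \<sigma> q b) \<le> D * \<alpha> * r" if "b \<in> B" for b
  proof -
    have "norm (\<sigma> p b - \<sigma> q b) \<le> K * norm (p - q) / norm p" by (rule lip[OF p0 q0 that])
    also have "\<dots> \<le> K * (L * \<alpha> * r * (2 * R + 1)) / (L / 2)"
      using pq pL L(1) K by (intro frac_le mult_left_mono) (auto intro!: mult_nonneg_nonneg simp: \<alpha>(1) r less_imp_le R)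
    also have "\<dots> = D * \<alpha> * r" using L(1) by (simp add: D field_simps)
    finally show ?thesis .
  qed
  define N where "N = real (card B)"
  have D0: "0 \<le> D" using K R by (simp add: D)
  have "(\<Sum>b\<in>B. modulus_d2 \<alpha> L x y (\<sigma> p b) (\<sigma> q b)) \<le> (\<Sum>b\<in>B. L * r * (3 * D\<^sup>2 * \<alpha>\<^sup>2 - \<alpha> / 2 * (norm (\<sigma> p b))\<^sup>2))"
    unfolding r_def using m r \<delta> \<alpha> L(1) xy(1) by (intro sum_mono modulus_d2_le[where R = R]) (auto simp: m_def r_def)
  also have "\<dots> = L * r * (3 * N * D\<^sup>2 * \<alpha>\<^sup>2 - \<alpha> / 2 * (\<Sum>b\<in>B. (norm (\<sigma> p b))\<^sup>2))"
    by (simp only: sum_distrib_left[symmetric] sum_subtractf sum_constant N_def) (simp add: algebra_simps)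
  also have "\<dots> \<le> L * r * (- (\<alpha> * c / 4))"
  proof (rule mult_left_mono)
    have "\<alpha> / 4 * (12 * N * D\<^sup>2 * \<alpha>) \<le> \<alpha> / 4 * c" using \<alpha> by (intro mult_left_mono) (auto simp: N_def)
    moreover have "\<alpha> / 4 * (12 * N * D\<^sup>2 * \<alpha>) = 3 * N * D\<^sup>2 * \<alpha>\<^sup>2" by (simp add: power2_eq_square)
    moreover have "\<alpha> / 2 * c \<le> \<alpha> / 2 * (\<Sum>b\<in>B. (norm (\<sigma> p b))\<^sup>2)" using lower[OF p0] \<alpha>(1) by simp
    ultimately show "3 * N * D\<^sup>2 * \<alpha>\<^sup>2 - \<alpha> / 2 * (\<Sum>b\<in>B. (norm (\<sigma> p b))\<^sup>2) \<le> - (\<alpha> * c / 4)" by linarith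
  qed (use L(1) r in simp)
  finally have 1: "(\<Sum>b\<in>B. modulus_d2 \<alpha> L x y (\<sigma> p b) (\<sigma> q b)) \<le> - (r / 4 * (L * \<alpha> * c))"
    by (simp add: algebra_simps)
  have "(\<Sum>b\<in>B. M * (norm (x - y) * (norm (\<sigma> p b))\<^sup>2 + norm (\<sigma> p b - \<sigma> q b) * (norm (\<sigma> p b) + norm (\<sigma> q b))))
      \<le> (\<Sum>b\<in>B. M * (r * \<Lambda>\<^sup>2 + (D * \<alpha> * r) * (\<Lambda> + \<Lambda>)))"
  proof (intro sum_mono mult_left_mono[OF _ K(2)] add_mono mult_mono)
    fix b assume b: "b \<in> B"
    show "(norm (\<sigma> p b))\<^sup>2 \<le> \<Lambda>\<^sup>2" using bound[OF p0 b] by (intro power_mono) auto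
  qed (use bound p0 q0 \<delta> r D0 \<alpha>(1) in \<open>auto simp: r_def\<close>)
  also have "\<dots> = r / 4 * (4 * N * M * (\<Lambda>\<^sup>2 + 2 * D * \<alpha> * \<Lambda>))" by (simp add: N_def algebra_simps)
  also have "\<dots> \<le> r / 4 * (L * \<alpha> * c)" using L(4) r by (intro mult_left_mono) (auto simp: N_def)
  finally show "(\<Sum>b\<in>B. modulus_d2 \<alpha> L x y (\<sigma> p b) (\<sigma> q b)) + (\<Sum>b\<in>B. M * (norm (x - y) * (norm (\<sigma> p b))\<^sup>2
       + norm (\<sigma> p b - \<sigma> q b) * (norm (\<sigma> p b) + norm (\<sigma> q b)))) \<le> 0" using 1 by linarith
qed

text \<open>
  For \<open>n \<ge> 2\<close> there is a unit vector orthogonal to the gradient, which bounds the trace of the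
  coefficient matrix from below by \<open>c\<^sub>1\<close>. The three bounds in the definition of \<open>\<alpha>\<close> keep the modulus increasing
  in the distance, serve the boundary condition, and serve the interior estimate; the summands of \<open>L\<close> serve
  the initial condition, the size of the two gradients, their difference, and the second derivatives of \<open>g\<close>.
\<close>

lemma gradient_bound_multidimensional:
  fixes \<Omega> :: "(real^'n) set"
  assumes n: "2 \<le> CARD('n)"
    and \<Omega>: "open \<Omega>" "\<Omega> \<noteq> {}" "bounded \<Omega>" "strictly_convex \<Omega>" "smooth_boundary \<Omega>" "0 < k\<^sub>0" "curvature_ge \<Omega> k\<^sub>0"
    and F: "admissible_anisotropy F" "tau_bounds F c\<^sub>1 c\<^sub>2 c\<^sub>3" "0 < c\<^sub>1" "0 < c\<^sub>2" "2 * c\<^sub>2 \<le> c\<^sub>1"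
    and \<phi>: "Ck_on 3 (closure \<Omega>) \<phi>" and u0: "Ck_on 3 (closure \<Omega>) u\<^sub>0"
  shows "\<exists>C. \<forall>T>0. \<forall>u. C32 \<Omega> T u \<and> flow_solution \<Omega> F \<phi> u\<^sub>0 T u \<longrightarrow>
          (\<forall>x\<in>closure \<Omega>. \<forall>t\<in>{0..T}. norm (grad_on (closure \<Omega>) (\<lambda>y. u y t) x) \<le> C)"
proof -
  let ?K = "closure \<Omega>"
  let ?B = "Basis :: ((real^'n) \<times> real) set"
  have conv: "convex \<Omega>" by (rule strictly_convex_imp_convex[OF \<Omega>(1,4)])
  have cone: "cone_condition ?K" by (rule cone_condition_closure_convex[OF conv \<Omega>(1,2)])
  have cK: "compact ?K" and vK: "convex ?K" using \<Omega>(3) conv by (auto simp: compact_closure convex_closure)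
  obtain \<kappa> where \<kappa>: "0 < \<kappa>"
      "\<And>x y. x \<in> frontier \<Omega> \<Longrightarrow> y \<in> ?K \<Longrightarrow> \<kappa> * (norm (y - x))\<^sup>2 \<le> inward_normal \<Omega> x \<bullet> (y - x)"
    using uniformly_convex_at_boundary[OF \<Omega>(1,3,5,4,6,7)] by blast
  obtain \<sigma> :: "real^'n \<Rightarrow> (real^'n) \<times> real \<Rightarrow> real^'n" and K \<Lambda> where \<sigma>: "0 \<le> K" "0 \<le> \<Lambda>"
      "\<And>p a a'. p \<noteq> 0 \<Longrightarrow> tau F p a a' = (\<Sum>b\<in>?B. (\<sigma> p b \<bullet> a) * (\<sigma> p b \<bullet> a'))"
      "\<And>p q b. p \<noteq> 0 \<Longrightarrow> q \<noteq> 0 \<Longrightarrow> b \<in> ?B \<Longrightarrow> norm (\<sigma> p b - \<sigma> q b) \<le> K * norm (p - q) / norm p"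
      "\<And>p b. p \<noteq> 0 \<Longrightarrow> b \<in> ?B \<Longrightarrow> norm (\<sigma> p b) \<le> \<Lambda>"
  proof (rule anisotropy_factorization[OF F], goal_cases)
    case (1 \<sigma> K \<Lambda>)
    show ?thesis by (rule 1(1)[OF 1(2-6)])
  qed
  have lower: "c\<^sub>1 \<le> (\<Sum>b\<in>?B. (norm (\<sigma> p b))\<^sup>2)" if p: "p \<noteq> 0" for p
  proof -
    obtain y where y: "y \<noteq> 0" "orthogonal p y" using orthogonal_to_vector_exists[of p] n by auto
    define a where "a = sgn y"
    have a: "norm a = 1" "a \<bullet> p = 0"
      using y by (auto simp: a_def norm_sgn sgn_div_norm orthogonal_def inner_commute)
    have "c\<^sub>1 \<le> (\<Sum>b\<in>?B. (\<sigma> p b \<bullet> a) * (\<sigma> p b \<bullet> a))"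
      using tau_lower_bounds(2)[OF F(2) p a] \<sigma>(3)[OF p] by simp
    also have "\<dots> \<le> (\<Sum>b\<in>?B. (norm (\<sigma> p b))\<^sup>2)"
    proof (rule sum_mono)
      fix b
      have "\<bar>\<sigma> p b \<bullet> a\<bar>\<^sup>2 \<le> (norm (\<sigma> p b))\<^sup>2"
        using Cauchy_Schwarz_ineq2[of "\<sigma> p b" a] a(1) by (intro power_mono) auto
      then show "(\<sigma> p b \<bullet> a) * (\<sigma> p b \<bullet> a) \<le> (norm (\<sigma> p b))\<^sup>2" by (simp add: power2_eq_square)
    qed
    finally show ?thesis .
  qed
  obtain g where g: "Ck_on 3 ?K g"
      "\<And>x v. x \<in> frontier \<Omega> \<Longrightarrow> dderiv_on ?K v g x = \<phi> x * (inward_normal \<Omega> x \<bullet> v)"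
  proof (rule neumann_extension[OF \<Omega>(1,3,5) cone \<phi>], goal_cases)
    case (1 g)
    show ?thesis by (rule 1(1)[OF 1(2-3)])
  qed
  have g1: "Ck_on 1 ?K g" by (rule Ck_on_le[OF g(1)]) simp
  have g2: "Ck_on 2 ?K g" by (rule Ck_on_le[OF g(1)]) simp
  obtain M where M: "0 \<le> M"
    "\<And>x y \<xi> \<zeta>. x \<in> \<Omega> \<Longrightarrow> y \<in> \<Omega> \<Longrightarrow>
      dderiv_on ?K \<xi> (dderiv_on ?K \<xi> g) x - dderiv_on ?K \<zeta> (dderiv_on ?K \<zeta> g) y
      \<le> M * (norm (x - y) * (norm \<xi>)\<^sup>2 + norm (\<xi> - \<zeta>) * (norm \<xi> + norm \<zeta>))"
  proof (rule C3_hessian_form_lipschitz[OF cK vK \<Omega>(1) g(1)], goal_cases)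
    case (1 M)
    show ?thesis by (rule 1(1)[OF 1(2-3)])
  qed
  obtain G1 where G1: "0 \<le> G1" "\<And>x. x \<in> ?K \<Longrightarrow> norm (grad_on ?K g x) \<le> G1"
    using convex_C1_lipschitz[OF cK vK g1] by metis
  have "\<exists>G. 0 \<le> G \<and> (\<forall>x\<in>?K. \<forall>y\<in>?K. \<bar>dderiv_on ?K (axis i 1) g x - dderiv_on ?K (axis i 1) g y\<bar> \<le> G * norm (x - y))" for i
  proof -
    have "Ck_on 1 ?K (dderiv_on ?K (axis i 1) g)"
      using Ck_on_SucD(2)[of 1 ?K g] g2 by (simp add: numeral_2_eq_2)
    then show ?thesis by (rule convex_C1_lipschitz[OF cK vK]) blast
  qed
  then obtain Gi where Gi: "\<And>i. 0 \<le> Gi i"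
      "\<And>i x y. x \<in> ?K \<Longrightarrow> y \<in> ?K \<Longrightarrow> \<bar>dderiv_on ?K (axis i 1) g x - dderiv_on ?K (axis i 1) g y\<bar> \<le> Gi i * norm (x - y)"
    by metis
  define G where "G = G1 + (\<Sum>i\<in>UNIV. Gi i)"
  have Gs0: "0 \<le> (\<Sum>i\<in>UNIV. Gi i)" using Gi(1) by (intro sum_nonneg)
  have G0: "0 \<le> G" using G1 Gs0 by (simp add: G_def)
  have Ggrad: "norm (grad_on ?K g x) \<le> G" if "x \<in> ?K" for x using G1(2)[OF that] Gs0 by (simp add: G_def)
  have Glip: "norm (grad_on ?K g x - grad_on ?K g y) \<le> G * norm (x - y)" if "x \<in> ?K" "y \<in> ?K" for x y
  proof -
    have "norm (grad_on ?K g x - grad_on ?K g y) \<le> (\<Sum>i\<in>UNIV. \<bar>(grad_on ?K g x - grad_on ?K g y) $ i\<bar>)"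
      by (rule norm_le_l1_cart)
    also have "\<dots> \<le> (\<Sum>i\<in>UNIV. Gi i * norm (x - y))"
      using Gi(2)[OF that] by (intro sum_mono) (simp add: grad_on_def)
    also have "\<dots> \<le> G * norm (x - y)" using G1(1) by (simp add: G_def distrib_right flip: sum_distrib_right)
    finally show ?thesis .
  qed
  have "Ck_on 1 ?K (\<lambda>x. u\<^sub>0 x - g x)" by (rule Ck_on_diff[OF cone Ck_on_le[OF u0] g1]) simp
  then obtain M0 where M0: "0 \<le> M0"
      "\<And>x y. x \<in> ?K \<Longrightarrow> y \<in> ?K \<Longrightarrow> \<bar>(u\<^sub>0 x - g x) - (u\<^sub>0 y - g y)\<bar> \<le> M0 * norm (x - y)"
  proof (rule convex_C1_lipschitz[OF cK vK], goal_cases)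
    case (1 M)
    show ?thesis by (rule 1(1)[OF 1(2,4)])
  qed
  obtain R where R: "1 \<le> R" "\<And>x. x \<in> ?K \<Longrightarrow> norm x \<le> R"
  proof -
    obtain b where "\<And>x. x \<in> ?K \<Longrightarrow> norm x \<le> b" using compact_imp_bounded[OF cK] by (auto simp: bounded_iff)
    then show ?thesis by (intro that[of "max 1 b"]) (auto simp: le_max_iff_disj)
  qed
  define N where "N = real (card ?B)"
  define D where "D = 2 * K * (2 * R + 1)"
  have D0: "0 \<le> D" using \<sigma>(1) R(1) by (simp add: D_def)
  define \<alpha> where "\<alpha> = min (1 / (12 * R\<^sup>2)) (min (\<kappa> / (4 * R)) (c\<^sub>1 / (12 * N * D\<^sup>2 + 1)))"
  have N0: "0 \<le> N" by (simp add: N_def)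
  have den: "0 < 12 * N * D\<^sup>2 + 1" using N0 by (simp add: add_nonneg_pos)
  have \<alpha>0: "0 < \<alpha>" using R(1) \<kappa>(1) F(3) den by (simp add: \<alpha>_def)
  have \<alpha>1: "\<alpha> * R\<^sup>2 \<le> 1 / 12"
  proof -
    have "\<alpha> \<le> 1 / (12 * R\<^sup>2)" by (simp add: \<alpha>_def)
    then show ?thesis using R(1) by (simp add: field_simps)
  qed
  have \<alpha>2: "\<alpha> * R \<le> \<kappa> / 4"
  proof -
    have "\<alpha> \<le> \<kappa> / (4 * R)" by (simp add: \<alpha>_def)
    then show ?thesis using R(1) by (simp add: field_simps)
  qed
  have \<alpha>3: "12 * N * D\<^sup>2 * \<alpha> \<le> c\<^sub>1"
  proof -
    have "\<alpha> \<le> c\<^sub>1 / (12 * N * D\<^sup>2 + 1)" by (simp add: \<alpha>_def)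
    then have "\<alpha> * (12 * N * D\<^sup>2 + 1) \<le> c\<^sub>1" using den by (simp add: pos_le_divide_eq)
    then show ?thesis using \<alpha>0 by (simp add: algebra_simps)
  qed
  define E where "E = 4 * N * M * (\<Lambda>\<^sup>2 + 2 * D * \<alpha> * \<Lambda>)"
  have E0: "0 \<le> E" using N0 M(1) D0 \<alpha>0 \<sigma>(2) by (simp add: E_def)
  have ac: "0 < \<alpha> * c\<^sub>1" using \<alpha>0 F(3) by simp
  define L where "L = 1 + 2 * M0 + 4 * G + G / \<alpha> + E / (\<alpha> * c\<^sub>1)"
  have parts: "0 \<le> G / \<alpha>" "0 \<le> E / (\<alpha> * c\<^sub>1)" using G0 \<alpha>0 E0 ac by auto
  have L0: "0 < L" "4 * G \<le> L" "2 * M0 \<le> L" using parts M0(1) G0 by (auto simp: L_def)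
  have L1: "G \<le> \<alpha> * L"
  proof -
    have "G / \<alpha> \<le> L" using parts M0(1) G0 by (simp add: L_def)
    then show ?thesis using \<alpha>0 by (simp add: pos_divide_le_eq mult.commute)
  qed
  have L2: "E \<le> L * \<alpha> * c\<^sub>1"
  proof -
    have "E / (\<alpha> * c\<^sub>1) \<le> L" using parts M0(1) G0 by (simp add: L_def)
    then show ?thesis using ac by (simp add: pos_divide_le_eq mult.assoc)
  qed
  have mid: "norm (midpoint x y) \<le> R" if "x \<in> ?K" "y \<in> ?K" for x y
    using R(2)[OF that(1)] R(2)[OF that(2)] norm_triangle_ineq[of x y] by (simp add: midpoint_def)
  have \<eta>: "1 / 2 \<le> 1 - \<alpha> * (norm (midpoint x y))\<^sup>2" if "x \<in> ?K" "y \<in> ?K" for x y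
  proof -
    have "(norm (midpoint x y))\<^sup>2 \<le> R\<^sup>2" using mid[OF that] by (intro power_mono) auto
    then have "\<alpha> * (norm (midpoint x y))\<^sup>2 \<le> \<alpha> * R\<^sup>2" using \<alpha>0 by simp
    then show ?thesis using \<alpha>1 by simp
  qed
  show ?thesis
  proof (intro exI[of _ "L + G"] allI impI ballI)
    fix T u x t
    assume T: "(0::real) < T" and uu: "C32 \<Omega> T u \<and> flow_solution \<Omega> F \<phi> u\<^sub>0 T u"
      and x: "x \<in> ?K" and t: "t \<in> {0..T}"
    note facts = flow_solution_facts[OF \<Omega>(1) conjunct1[OF uu] conjunct2[OF uu]]
    define w where "w x t = u x t - g x" for x t
    define wt where "wt x t = vector_derivative (u x) (at t within {0..T})" for x t
    have u2: "Ck_on 2 ?K (\<lambda>x. u x t)" if "t \<in> {0..T}" for t by (rule Ck_on_le[OF facts(2)[OF that]]) simp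
    have diff: "(\<lambda>x. u x t) differentiable (at x within ?K)" "g differentiable (at x within ?K)"
      if "t \<in> {0..T}" "x \<in> ?K" for x t
      using u2[OF that(1)] g2 that(2) by (simp_all add: numeral_2_eq_2 differentiable_on_def)
    have dw: "dderiv_on ?K v (\<lambda>x. w x t) x = dderiv_on ?K v (\<lambda>x. u x t) x - dderiv_on ?K v g x"
      if "t \<in> {0..T}" "x \<in> ?K" for v x t
      unfolding w_def by (rule dderiv_on_diff[OF cone that(2) diff[OF that]])
    have lip: "w x t - w y t \<le> two_point_modulus \<alpha> L x y" if "x \<in> ?K" "y \<in> ?K" "t \<in> {0..T}" for x y t
    proof (rule two_point_maximum_principle[OF \<Omega>(1,3,5) R(2) _ _ _ _ _ _ _ _ _ that])
      show "0 \<le> \<alpha>" "\<alpha> * R\<^sup>2 \<le> 1" "0 \<le> L" using \<alpha>0 \<alpha>1 L0 by auto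
      have "continuous_on (?K \<times> {0..T}) (\<lambda>p. g (fst p))"
        by (rule continuous_on_compose2[OF Ck_on_imp_continuous_on[OF g1] continuous_on_fst]) (auto intro: continuous_on_id)
      then show "continuous_on (?K \<times> {0..T}) (\<lambda>(x, t). w x t)"
        using continuous_on_diff[OF facts(1)] by (simp add: w_def case_prod_unfold)
      show "Ck_on 2 ?K (\<lambda>x. w x t)" if "t \<in> {0..T}" for t
        unfolding w_def by (rule Ck_on_diff[OF cone u2[OF that] g2])
      show "(w x has_real_derivative wt x t) (at t within {0..T})" if "x \<in> \<Omega>" "t \<in> {0..T}" for x t
        using DERIV_diff[OF facts(3)[of x t] DERIV_const[of "g x"]] that closure_subset
        by (auto simp: w_def[abs_def] wt_def)
      show "w x 0 - w y 0 \<le> two_point_modulus \<alpha> L x y" if "x \<in> ?K" "y \<in> ?K" for x y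
      proof -
        have u00: "u z 0 = u\<^sub>0 z" if "z \<in> ?K" for z
          by (rule facts(6)[OF less_imp_le[OF T] Ck_on_imp_continuous_on[OF u0] that])
        have "w x 0 - w y 0 \<le> M0 * norm (x - y)"
          using abs_le_D1[OF M0(2)[OF that]] unfolding w_def u00[OF that(1)] u00[OF that(2)] .
        also have "\<dots> \<le> L * (1 / 2) * norm (x - y)" using L0(3) by (intro mult_right_mono) auto
        also have "\<dots> \<le> L * (1 - \<alpha> * (norm (midpoint x y))\<^sup>2) * norm (x - y)"
          using \<eta>[OF that] L0(1) by (intro mult_right_mono mult_left_mono) auto
        finally show ?thesis by (simp add: two_point_modulus_def algebra_simps)
      qed
      show "\<bar>dderiv_on ?K (inward_normal \<Omega> x) (\<lambda>x. w x t) x\<bar> < - modulus_d1 \<alpha> L x y (inward_normal \<Omega> x) 0"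
        if x: "x \<in> frontier \<Omega>" and y: "y \<in> ?K" "y \<noteq> x" and t: "t \<in> {0..T}" for x y t
      proof -
        let ?N = "inward_normal \<Omega> x"
        have xK: "x \<in> ?K" using x by (simp add: frontier_def)
        have N1: "norm ?N = 1" by (rule norm_inward_normal[OF \<Omega>(1,5) x])
        have "dderiv_on ?K ?N (\<lambda>x. w x t) x = 0"
          using facts(4)[OF x t] g(2)[OF x] N1 by (simp add: dw[OF t xK] dot_square_norm)
        moreover have "modulus_d1 \<alpha> L x y ?N 0 < 0"
        proof -
          define r where "r = norm (x - y)"
          have r: "r > 0" using y by (simp add: r_def)
          have "sgn (x - y) \<bullet> ?N = - (?N \<bullet> (y - x)) / r"
            by (simp add: sgn_div_norm r_def inner_diff_left inner_diff_right inner_commute divide_inverse algebra_simps)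
          also have "\<dots> \<le> - (\<kappa> * r\<^sup>2) / r"
            using \<kappa>(2)[OF x y(1)] r by (intro divide_right_mono) (auto simp: r_def norm_minus_commute)
          finally have e: "sgn (x - y) \<bullet> ?N \<le> - (\<kappa> * r)" using r by (simp add: power2_eq_square)
          have "(sgn (x - y) \<bullet> ?N) * (1 - \<alpha> * (norm (midpoint x y))\<^sup>2) \<le> - (\<kappa> * r) * (1 - \<alpha> * (norm (midpoint x y))\<^sup>2)"
            using e \<eta>[OF xK y(1)] by (intro mult_right_mono) auto
          also have "\<dots> \<le> - (\<kappa> * r) * (1 / 2)"
            using \<eta>[OF xK y(1)] \<kappa>(1) r by (intro mult_left_mono_neg) auto
          finally have 1: "(sgn (x - y) \<bullet> ?N) * (1 - \<alpha> * (norm (midpoint x y))\<^sup>2) \<le> - (\<kappa> * r / 2)" by simp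
          have "- (midpoint x y \<bullet> ?N) \<le> R"
            using Cauchy_Schwarz_ineq2[of "midpoint x y" ?N] mid[OF xK y(1)] N1 by simp
          then have "\<alpha> * r * (- (midpoint x y \<bullet> ?N)) \<le> \<alpha> * r * R" using \<alpha>0 r by (intro mult_left_mono) auto
          also have "\<dots> = r * (\<alpha> * R)" by simp
          also have "\<dots> \<le> r * (\<kappa> / 4)" using \<alpha>2 r by (intro mult_left_mono) auto
          finally have "- (\<alpha> * r * (midpoint x y \<bullet> ?N)) \<le> \<kappa> * r / 4" by (simp add: mult.commute)
          then have "(sgn (x - y) \<bullet> ?N) * (1 - \<alpha> * (norm (midpoint x y))\<^sup>2) - \<alpha> * r * (midpoint x y \<bullet> ?N) \<le> - (\<kappa> * r / 4)"
            using 1 by linarith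
          also have "\<dots> < 0" using \<kappa>(1) r by simp
          finally show ?thesis using L0(1) by (simp add: modulus_d1_def r_def mult_pos_neg)
        qed
        ultimately show ?thesis by simp
      qed
      show "wt x t \<le> wt y t"
        if x: "x \<in> \<Omega>" and y: "y \<in> \<Omega>" and ne: "x \<noteq> y" and t: "t \<in> {0..T}"
          and d1x: "\<And>v. dderiv_on ?K v (\<lambda>x. w x t) x = modulus_d1 \<alpha> L x y v 0"
          and d1y: "\<And>v. dderiv_on ?K v (\<lambda>x. w x t) y = - modulus_d1 \<alpha> L x y 0 v"
          and d2: "\<And>\<xi> \<zeta>. dderiv_on ?K \<xi> (dderiv_on ?K \<xi> (\<lambda>x. w x t)) x
            - dderiv_on ?K \<zeta> (dderiv_on ?K \<zeta> (\<lambda>x. w x t)) y \<le> modulus_d2 \<alpha> L x y \<xi> \<zeta>"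
        for x y t
      proof -
        have xK: "x \<in> ?K" and yK: "y \<in> ?K" using x y closure_subset by blast+
        define p q where "p = grad_on ?K (\<lambda>x. u x t) x" and "q = grad_on ?K (\<lambda>x. u x t) y"
        have grad_eq: "grad_on ?K (\<lambda>x. u x t) z = a + grad_on ?K g z"
          if z: "z \<in> ?K" and a: "\<And>v. dderiv_on ?K v (\<lambda>x. w x t) z = a \<bullet> v" for z a
        proof -
          have "grad_on ?K (\<lambda>x. u x t) z $ i = (a + grad_on ?K g z) $ i" for i
            using a[of "axis i 1"] by (simp add: dw[OF t z] grad_on_def inner_axis)
          then show ?thesis by (simp add: vec_eq_iff)
        qed
        have p: "p = L *\<^sub>R ((1 - \<alpha> * (norm (midpoint x y))\<^sup>2) *\<^sub>R sgn (x - y)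
            - (\<alpha> * norm (x - y)) *\<^sub>R midpoint x y) + grad_on ?K g x"
          unfolding p_def by (rule grad_eq[OF xK]) (simp only: d1x modulus_d1_eq_inner)
        have q: "q = L *\<^sub>R ((1 - \<alpha> * (norm (midpoint x y))\<^sup>2) *\<^sub>R sgn (x - y)
            + (\<alpha> * norm (x - y)) *\<^sub>R midpoint x y) + grad_on ?K g y"
          unfolding q_def by (rule grad_eq[OF yK]) (simp only: d1y modulus_d1_eq_inner)
        note est = two_point_interior_estimate[of ?B \<sigma> K \<Lambda> c\<^sub>1 M G D R \<alpha> L x y p "grad_on ?K g x" q "grad_on ?K g y",
            OF \<sigma>(4,5) lower \<sigma>(1) M(1) G0 D_def \<alpha>0 \<alpha>1 \<alpha>3[unfolded N_def] L0(1,2) L1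
              L2[unfolded E_def N_def] ne R(2)[OF xK] R(2)[OF yK] p q Ggrad[OF xK] Ggrad[OF yK] Glip[OF xK yK]]
        have dd: "dderiv_on ?K v (dderiv_on ?K v (\<lambda>x. u x t)) z
            = dderiv_on ?K v (dderiv_on ?K v (\<lambda>x. w x t)) z + dderiv_on ?K v (dderiv_on ?K v g) z" if "z \<in> ?K" for z v
          unfolding w_def using dderiv2_on_diff[OF cone that u2[OF t] g2] by simp
        have "wt x t - wt y t = (\<Sum>b\<in>?B. dderiv_on ?K (\<sigma> p b) (dderiv_on ?K (\<sigma> p b) (\<lambda>x. u x t)) x)
            - (\<Sum>b\<in>?B. dderiv_on ?K (\<sigma> q b) (dderiv_on ?K (\<sigma> q b) (\<lambda>x. u x t)) y)"
          using facts(5)[OF x t p_def \<sigma>(3)[OF est(1)]] facts(5)[OF y t q_def \<sigma>(3)[OF est(2)]]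
          by (simp add: wt_def)
        also have "\<dots> = (\<Sum>b\<in>?B. dderiv_on ?K (\<sigma> p b) (dderiv_on ?K (\<sigma> p b) (\<lambda>x. w x t)) x
              - dderiv_on ?K (\<sigma> q b) (dderiv_on ?K (\<sigma> q b) (\<lambda>x. w x t)) y)
            + (\<Sum>b\<in>?B. dderiv_on ?K (\<sigma> p b) (dderiv_on ?K (\<sigma> p b) g) x
              - dderiv_on ?K (\<sigma> q b) (dderiv_on ?K (\<sigma> q b) g) y)"
          by (simp only: dd[OF xK] dd[OF yK] sum_subtractf sum.distrib)
        also have "\<dots> \<le> (\<Sum>b\<in>?B. modulus_d2 \<alpha> L x y (\<sigma> p b) (\<sigma> q b)) + (\<Sum>b\<in>?B. M * (norm (x - y) * (norm (\<sigma> p b))\<^sup>2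
            + norm (\<sigma> p b - \<sigma> q b) * (norm (\<sigma> p b) + norm (\<sigma> q b))))"
          by (intro add_mono sum_mono d2 M(2)[OF x y])
        also have "\<dots> \<le> 0" by (rule est(3))
        finally show ?thesis by simp
      qed
    qed
    show "norm (grad_on ?K (\<lambda>y. u y t) x) \<le> L + G"
    proof (rule gradient_bound_of_modulus[OF \<Omega>(1) cone _ g1 Ggrad _ _ x])
      show "Ck_on 1 ?K (\<lambda>y. u y t)" by (rule Ck_on_le[OF u2[OF t]]) simp
      show "(u x t - g x) - (u y t - g y) \<le> L * norm (x - y)" if "x \<in> \<Omega>" "y \<in> \<Omega>" for x y
      proof -
        have "w x t - w y t \<le> L * norm (x - y) * (1 - \<alpha> * (norm (midpoint x y))\<^sup>2)"
          using lip[of x y t] that t closure_subset by (auto simp: two_point_modulus_def)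
        also have "\<dots> \<le> L * norm (x - y) * 1" using L0(1) \<alpha>0 by (intro mult_left_mono) auto
        finally show ?thesis by (simp add: w_def)
      qed
    qed (use L0 in auto)
  qed
qed

text \<open>
  With \<open>\<alpha> = 0\<close> the modulus is \<open>L * |x - y|\<close>. Both points of an interior maximum have the same gradient, hence
  the same coefficients, and moving \<open>x\<close> and \<open>y\<close> in parallel leaves the modulus unchanged.
\<close>

lemma gradient_bound_one_dimensional:
  fixes \<Omega> :: "(real^'n) set"
  assumes n: "CARD('n) = 1"
    and \<Omega>: "open \<Omega>" "\<Omega> \<noteq> {}" "bounded \<Omega>" "strictly_convex \<Omega>" "smooth_boundary \<Omega>"
    and F: "admissible_anisotropy F" "tau_bounds F c\<^sub>1 c\<^sub>2 c\<^sub>3" "0 < c\<^sub>1" "0 < c\<^sub>2" "2 * c\<^sub>2 \<le> c\<^sub>1"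
    and \<phi>: "Ck_on 3 (closure \<Omega>) \<phi>" and u0: "Ck_on 3 (closure \<Omega>) u\<^sub>0"
  shows "\<exists>C. \<forall>T>0. \<forall>u. C32 \<Omega> T u \<and> flow_solution \<Omega> F \<phi> u\<^sub>0 T u \<longrightarrow>
          (\<forall>x\<in>closure \<Omega>. \<forall>t\<in>{0..T}. norm (grad_on (closure \<Omega>) (\<lambda>y. u y t) x) \<le> C)"
proof -
  let ?K = "closure \<Omega>"
  let ?B = "Basis :: ((real^'n) \<times> real) set"
  have conv: "convex \<Omega>" by (rule strictly_convex_imp_convex[OF \<Omega>(1,4)])
  have cone: "cone_condition ?K" by (rule cone_condition_closure_convex[OF conv \<Omega>(1,2)])
  have cK: "compact ?K" and vK: "convex ?K" using \<Omega>(3) conv by (auto simp: compact_closure convex_closure)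
  have line: "\<bar>a \<bullet> b\<bar> = norm a * norm b" for a b :: "real^'n"
  proof -
    obtain k where k: "(UNIV :: 'n set) = {k}" using n by (auto simp: card_1_singleton_iff)
    have "norm v = \<bar>v $ k\<bar>" for v :: "real^'n" by (simp add: norm_vec_def L2_set_def k)
    then show ?thesis by (simp add: inner_vec_def k abs_mult)
  qed
  obtain \<sigma> :: "real^'n \<Rightarrow> (real^'n) \<times> real \<Rightarrow> real^'n"
    where \<sigma>: "\<And>p a a'. p \<noteq> 0 \<Longrightarrow> tau F p a a' = (\<Sum>b\<in>?B. (\<sigma> p b \<bullet> a) * (\<sigma> p b \<bullet> a'))"
  proof (rule anisotropy_factorization[OF F], goal_cases)
    case (1 \<sigma> K \<Lambda>)
    show ?thesis by (rule 1(1)[OF 1(4)])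
  qed
  obtain P where P: "0 \<le> P" "\<And>x. x \<in> ?K \<Longrightarrow> \<bar>\<phi> x\<bar> \<le> P"
  proof (rule convex_C1_lipschitz[OF cK vK Ck_on_le[OF \<phi>]], goal_cases)
    case (2 M)
    show ?thesis by (rule 2(1)[OF 2(2,3)])
  qed simp
  obtain M0 where M0: "0 \<le> M0" "\<And>x y. x \<in> ?K \<Longrightarrow> y \<in> ?K \<Longrightarrow> \<bar>u\<^sub>0 x - u\<^sub>0 y\<bar> \<le> M0 * norm (x - y)"
  proof (rule convex_C1_lipschitz[OF cK vK Ck_on_le[OF u0]], goal_cases)
    case (2 M)
    show ?thesis by (rule 2(1)[OF 2(2,4)])
  qed simp
  obtain R where R: "\<And>x. x \<in> ?K \<Longrightarrow> norm x \<le> R"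
    using compact_imp_bounded[OF cK] by (auto simp: bounded_iff)
  define L where "L = 1 + P + M0"
  have L0: "0 < L" "P < L" "M0 \<le> L" using P(1) M0(1) by (auto simp: L_def)
  have modulus: "two_point_modulus 0 L x y = L * norm (x - y)" for x y :: "real^'n"
    by (simp add: two_point_modulus_def)
  show ?thesis
  proof (intro exI[of _ "L + 0"] allI impI ballI)
    fix T u x t
    assume T: "(0::real) < T" and uu: "C32 \<Omega> T u \<and> flow_solution \<Omega> F \<phi> u\<^sub>0 T u"
      and x: "x \<in> ?K" and t: "t \<in> {0..T}"
    note facts = flow_solution_facts[OF \<Omega>(1) conjunct1[OF uu] conjunct2[OF uu]]
    have u2: "Ck_on 2 ?K (\<lambda>x. u x t)" if "t \<in> {0..T}" for t by (rule Ck_on_le[OF facts(2)[OF that]]) simp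
    have lip: "u x t - u y t \<le> two_point_modulus 0 L x y" if "x \<in> ?K" "y \<in> ?K" "t \<in> {0..T}" for x y t
    proof (rule two_point_maximum_principle[OF \<Omega>(1,3,5) R _ _ _ facts(1) u2 _ _ _ _ that])
      show "(0::real) \<le> 0" "0 * R\<^sup>2 \<le> 1" "0 \<le> L" using L0 by auto
      show "(u x has_real_derivative vector_derivative (u x) (at t within {0..T})) (at t within {0..T})"
        if "x \<in> \<Omega>" "t \<in> {0..T}" for x t
        using facts(3) that closure_subset by blast
      show "u x 0 - u y 0 \<le> two_point_modulus 0 L x y" if "x \<in> ?K" "y \<in> ?K" for x y
      proof -
        have u00: "u z 0 = u\<^sub>0 z" if "z \<in> ?K" for z
          by (rule facts(6)[OF less_imp_le[OF T] Ck_on_imp_continuous_on[OF u0] that])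
        have "u x 0 - u y 0 \<le> M0 * norm (x - y)"
          using abs_le_D1[OF M0(2)[OF that]] unfolding u00[OF that(1)] u00[OF that(2)] .
        also have "\<dots> \<le> L * norm (x - y)" using L0(3) by (rule mult_right_mono) simp
        finally show ?thesis by (simp add: modulus)
      qed
      show "\<bar>dderiv_on ?K (inward_normal \<Omega> x) (\<lambda>x. u x t) x\<bar> < - modulus_d1 0 L x y (inward_normal \<Omega> x) 0"
        if x: "x \<in> frontier \<Omega>" and y: "y \<in> ?K" "y \<noteq> x" and t: "t \<in> {0..T}" for x y t
      proof -
        let ?N = "inward_normal \<Omega> x"
        have xK: "x \<in> ?K" using x by (simp add: frontier_def)
        have "?N \<bullet> (y - x) = norm (y - x)"
          using line[of ?N "y - x"] strictly_convex_inner_normal_pos[OF \<Omega>(1,5,4) x y] norm_inward_normal[OF \<Omega>(1,5) x]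
          by simp
        moreover have "sgn (x - y) \<bullet> ?N = - (?N \<bullet> (y - x)) / norm (x - y)"
          by (simp add: sgn_div_norm inner_diff_left inner_diff_right inner_commute divide_inverse algebra_simps)
        ultimately have "sgn (x - y) \<bullet> ?N = - 1" using y(2) by (simp add: norm_minus_commute)
        then have "- modulus_d1 0 L x y ?N 0 = L" by (simp add: modulus_d1_def)
        then show ?thesis using facts(4)[OF x t] P(2)[OF xK] L0(2) by simp
      qed
      show "vector_derivative (u x) (at t within {0..T}) \<le> vector_derivative (u y) (at t within {0..T})"
        if x: "x \<in> \<Omega>" and y: "y \<in> \<Omega>" and ne: "x \<noteq> y" and t: "t \<in> {0..T}"
          and d1x: "\<And>v. dderiv_on ?K v (\<lambda>x. u x t) x = modulus_d1 0 L x y v 0"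
          and d1y: "\<And>v. dderiv_on ?K v (\<lambda>x. u x t) y = - modulus_d1 0 L x y 0 v"
          and d2: "\<And>\<xi> \<zeta>. dderiv_on ?K \<xi> (dderiv_on ?K \<xi> (\<lambda>x. u x t)) x
            - dderiv_on ?K \<zeta> (dderiv_on ?K \<zeta> (\<lambda>x. u x t)) y \<le> modulus_d2 0 L x y \<xi> \<zeta>"
        for x y t
      proof -
        define p where "p = L *\<^sub>R sgn (x - y)"
        have p0: "p \<noteq> 0" using L0(1) ne by (simp add: p_def sgn_zero_iff)
        have px: "p = grad_on ?K (\<lambda>x. u x t) x"
          by (simp add: vec_eq_iff grad_on_def d1x modulus_d1_def p_def inner_axis)
        have py: "p = grad_on ?K (\<lambda>x. u x t) y"
          by (simp add: vec_eq_iff grad_on_def d1y modulus_d1_def p_def inner_axis)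
        have "vector_derivative (u x) (at t within {0..T}) - vector_derivative (u y) (at t within {0..T})
            = (\<Sum>b\<in>?B. dderiv_on ?K (\<sigma> p b) (dderiv_on ?K (\<sigma> p b) (\<lambda>x. u x t)) x
              - dderiv_on ?K (\<sigma> p b) (dderiv_on ?K (\<sigma> p b) (\<lambda>x. u x t)) y)"
          unfolding facts(5)[OF x t px \<sigma>[OF p0]] facts(5)[OF y t py \<sigma>[OF p0]] sum_subtractf ..
        also have "\<dots> \<le> (\<Sum>b\<in>?B. modulus_d2 0 L x y (\<sigma> p b) (\<sigma> p b))" by (intro sum_mono d2)
        also have "\<dots> = 0" by (simp add: modulus_d2_def)
        finally show ?thesis by simp
      qed
    qed
    show "norm (grad_on ?K (\<lambda>y. u y t) x) \<le> L + 0"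
    proof (rule gradient_bound_of_modulus[OF \<Omega>(1) cone _ Ck_on_const[OF cone, of 1 0] _ _ _ x])
      show "Ck_on 1 ?K (\<lambda>y. u y t)" by (rule Ck_on_le[OF u2[OF t]]) simp
      show "norm (grad_on ?K (\<lambda>x. 0) z) \<le> 0" if "z \<in> ?K" for z
        using dderiv_on_eqI[OF cone that has_derivative_const] by (simp add: grad_on_def vec_eq_iff)
      show "(u x t - 0) - (u y t - 0) \<le> L * norm (x - y)" if "x \<in> \<Omega>" "y \<in> \<Omega>" for x y
        using lip[of x y t] that t closure_subset by (auto simp: modulus)
    qed (use L0 in auto)
  qed
qed

theorem theorem4p1:
  shows "\<exists>\<epsilon>\<^sub>2>0. \<forall>(\<Omega> :: (real^'n) set) k\<^sub>0 F c\<^sub>1 c\<^sub>2 c\<^sub>3 \<phi> \<epsilon>\<^sub>1 u\<^sub>0.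
    open \<Omega> \<and> connected \<Omega> \<and> \<Omega> \<noteq> {} \<and> bounded \<Omega> \<and> strictly_convex \<Omega> \<and> smooth_boundary \<Omega> \<and>
    0 < k\<^sub>0 \<and> curvature_ge \<Omega> k\<^sub>0 \<and>
    admissible_anisotropy F \<and> structure_constants F c\<^sub>1 c\<^sub>2 c\<^sub>3 \<and> c\<^sub>2 / c\<^sub>1 < \<epsilon>\<^sub>2 \<and>
    Ck_on 3 (closure \<Omega>) \<phi> \<and> 0 < \<epsilon>\<^sub>1 \<and>
    (SUP x\<in>closure \<Omega>. \<bar>\<phi> x\<bar>) < \<epsilon>\<^sub>1 \<and>
    (SUP x\<in>closure \<Omega>. norm (grad_on (closure \<Omega>) \<phi> x)) < \<epsilon>\<^sub>1 \<and>
    (SUP x\<in>closure \<Omega>. norm (hess_on (closure \<Omega>) \<phi> x)) < \<epsilon>\<^sub>1 \<and>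
    Ck_on 3 (closure \<Omega>) u\<^sub>0 \<and>
    (\<forall>x\<in>frontier \<Omega>. dderiv_on (closure \<Omega>) (inward_normal \<Omega> x) u\<^sub>0 x = \<phi> x)
    \<longrightarrow> (\<exists>C. \<forall>T>0. \<forall>u. C32 \<Omega> T u \<and> flow_solution \<Omega> F \<phi> u\<^sub>0 T u \<longrightarrow>
          (\<forall>x\<in>closure \<Omega>. \<forall>t\<in>{0..T}. norm (grad_on (closure \<Omega>) (\<lambda>y. u y t) x) \<le> C))"
proof (rule exI[of _ "1 / 2"], intro conjI allI impI)
  show "(0::real) < 1 / 2" by simp
  fix \<Omega> :: "(real^'n) set" and k\<^sub>0 c\<^sub>1 c\<^sub>2 c\<^sub>3 \<epsilon>\<^sub>1 :: real
    and F :: "(real^'n) \<times> real \<Rightarrow> real" and \<phi> u\<^sub>0 :: "real^'n \<Rightarrow> real"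
  assume asm: "open \<Omega> \<and> connected \<Omega> \<and> \<Omega> \<noteq> {} \<and> bounded \<Omega> \<and> strictly_convex \<Omega> \<and> smooth_boundary \<Omega> \<and>
    0 < k\<^sub>0 \<and> curvature_ge \<Omega> k\<^sub>0 \<and>
    admissible_anisotropy F \<and> structure_constants F c\<^sub>1 c\<^sub>2 c\<^sub>3 \<and> c\<^sub>2 / c\<^sub>1 < 1 / 2 \<and>
    Ck_on 3 (closure \<Omega>) \<phi> \<and> 0 < \<epsilon>\<^sub>1 \<and>
    (SUP x\<in>closure \<Omega>. \<bar>\<phi> x\<bar>) < \<epsilon>\<^sub>1 \<and>
    (SUP x\<in>closure \<Omega>. norm (grad_on (closure \<Omega>) \<phi> x)) < \<epsilon>\<^sub>1 \<and>
    (SUP x\<in>closure \<Omega>. norm (hess_on (closure \<Omega>) \<phi> x)) < \<epsilon>\<^sub>1 \<and>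
    Ck_on 3 (closure \<Omega>) u\<^sub>0 \<and>
    (\<forall>x\<in>frontier \<Omega>. dderiv_on (closure \<Omega>) (inward_normal \<Omega> x) u\<^sub>0 x = \<phi> x)"
  have \<Omega>: "open \<Omega>" "\<Omega> \<noteq> {}" "bounded \<Omega>" "strictly_convex \<Omega>" "smooth_boundary \<Omega>" "0 < k\<^sub>0" "curvature_ge \<Omega> k\<^sub>0"
    and adm: "admissible_anisotropy F" and str: "structure_constants F c\<^sub>1 c\<^sub>2 c\<^sub>3" and small: "c\<^sub>2 / c\<^sub>1 < 1 / 2"
    and data: "Ck_on 3 (closure \<Omega>) \<phi>" "Ck_on 3 (closure \<Omega>) u\<^sub>0"
    using asm by blast+
  have tb: "tau_bounds F c\<^sub>1 c\<^sub>2 c\<^sub>3" "0 < c\<^sub>1" "0 < c\<^sub>2" using str by (auto simp: structure_constants_def)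
  have c: "2 * c\<^sub>2 \<le> c\<^sub>1" using small tb(2) by (simp add: divide_less_eq)
  have "0 < CARD('n)" by simp
  then consider "CARD('n) = 1" | "2 \<le> CARD('n)" by linarith
  then show "\<exists>C. \<forall>T>0. \<forall>u. C32 \<Omega> T u \<and> flow_solution \<Omega> F \<phi> u\<^sub>0 T u \<longrightarrow>
          (\<forall>x\<in>closure \<Omega>. \<forall>t\<in>{0..T}. norm (grad_on (closure \<Omega>) (\<lambda>y. u y t) x) \<le> C)"
  proof cases
    case 1
    show ?thesis by (rule gradient_bound_one_dimensional[OF 1 \<Omega>(1-5) adm tb c data])
  next
    case 2
    show ?thesis by (rule gradient_bound_multidimensional[OF 2 \<Omega> adm tb c data])
  qed
qed


end
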